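(* Let $n\geq 1$ be an integer and let $s\in (\frac{n+4}2,\infty)\setminus (\frac n2+ \mathbb N)$. Then the infimum $$ I_{2s,n} = \inf_{0< u \in H^s(\mathbb S^n)} \left( \int_{\mathbb S^n} u^{-\frac{2n}{2s-n}}\, d\omega \right)^{\frac{2s-n}{n}} a_{2s}[u] $$ is not attained. If, in addition, $n\geq 2$, then $I_{2s,n}=-\infty$.
   Context: $\mathbb N=\{1,2,3,\ldots\}$ and $\mathbb N_0=\{0,1,2,\ldots\}$. $\mathbb S^n\subset\mathbb R^{n+1}$ is the unit sphere and $d\omega$ its surface measure. $H^s(\mathbb S^n)$ is the usual $L^2$-based Sobolev space of real-valued functions; since $s>\frac n2$ its elements are identified with continuous functions, and $0<u\in H^s(\mathbb S^n)$ means that $u$ is everywhere positive. For $\ell\in\mathbb N_0$, $P_\ell$ is the $L^2(\mathbb S^n)$-orthogonal projection onto spherical harmonics of degree $\ell$, and $$\alpha_{2s,n}(\ell) = \frac{\Gamma(\ell+\frac n2 + s)}{\Gamma(\ell+\frac n2 - s)},\qquad a_{2s}[u] = \sum_{\ell\in\mathbb N_0} \alpha_{2s,n}(\ell)\, \| P_\ell u\|_{L^2(\mathbb S^n)}^2\quad\text{for } u\in H^s(\mathbb S^n).$$ "Attained" means that there is an everywhere positive $u\in H^s(\mathbb S^n)$ for which the quantity in the infimum equals $I_{2s,n}$. *)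

theory Defs
  imports "HOL-Analysis.Analysis"
begin

text \<open>
  The sphere \<open>S\<^sup>n\<close> is \<^term>\<open>sphere 0 1\<close> in a Euclidean space \<open>'a\<close> with \<open>DIM('a) = n + 1\<close>. A
  function on the sphere is a function \<open>'a \<Rightarrow> real\<close> of which only the values on the sphere
  are ever used.

  The surface measure of a Borel set \<open>A\<close> of the sphere is \<open>n + 1\<close> times the volume of the cone
  \<open>{r x | 0 < r < 1, x \<in> A}\<close>, that is, the measure \<open>d\<omega>\<close> for which
  \<open>dx = r\<^sup>n dr d\<omega>\<close> in polar coordinates.
\<close>

definition surface_measure :: "'a::euclidean_space measure" where
  "surface_measure =
     scale_measure (of_nat DIM('a))
       (distr (restrict_space lborel (ball 0 1 - {0})) (restrict_space borel (sphere 0 1))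
          (\<lambda>x. x /\<^sub>R norm x))"

definition laplacian :: "('a::euclidean_space \<Rightarrow> real) \<Rightarrow> 'a \<Rightarrow> real" where
  "laplacian p x = (\<Sum>b\<in>Basis. deriv (deriv (\<lambda>t. p (x + t *\<^sub>R b))) 0)"

definition homogeneous_harmonic_polynomials :: "nat \<Rightarrow> ('a::euclidean_space \<Rightarrow> real) set" where
  "homogeneous_harmonic_polynomials l =
     {p. real_polynomial_function p \<and> (\<forall>t x. p (t *\<^sub>R x) = t ^ l * p x) \<and>
         (\<forall>x. laplacian p x = 0)}"

definition spherical_harmonics :: "nat \<Rightarrow> ('a::euclidean_space \<Rightarrow> real) set" where
  "spherical_harmonics l =
     (\<lambda>p. restrict p (sphere 0 1)) ` homogeneous_harmonic_polynomials l"

definition L2_sphere :: "('a::euclidean_space \<Rightarrow> real) set" where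
  "L2_sphere =
     {u. u \<in> borel_measurable surface_measure \<and> integrable surface_measure (\<lambda>x. (u x)\<^sup>2)}"

definition L2_sphere_norm :: "('a::euclidean_space \<Rightarrow> real) \<Rightarrow> real" where
  "L2_sphere_norm u = sqrt (LINT x|surface_measure. (u x)\<^sup>2)"

text \<open>
  The elements of \<open>spherical_harmonics l\<close> are restricted functions forming a
  finite-dimensional space of continuous functions, so the orthogonal projection onto them is
  unique as a function.
\<close>

definition harmonic_projection ::
    "nat \<Rightarrow> ('a::euclidean_space \<Rightarrow> real) \<Rightarrow> ('a \<Rightarrow> real)" where
  "harmonic_projection l u =
     (THE Y. Y \<in> spherical_harmonics l \<and>
        (\<forall>Z\<in>spherical_harmonics l. (LINT x|surface_measure. (u x - Y x) * Z x) = 0))"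

text \<open>
  The factor \<open>1 + l (l + n - 1)\<close> is the eigenvalue of \<open>1 - \<Delta>\<close> (Laplace--Beltrami) on spherical
  harmonics of degree \<open>l\<close>; the series is the squared \<open>L\<^sup>2\<close> norm of \<open>(1 - \<Delta>)\<^bsup>s/2\<^esup> u\<close>.
\<close>

definition sobolev_sphere :: "nat \<Rightarrow> real \<Rightarrow> ('a::euclidean_space \<Rightarrow> real) set" where
  "sobolev_sphere n s =
     {u \<in> L2_sphere. summable (\<lambda>l. (1 + real l * (real l + real n - 1)) powr s *
                                  (L2_sphere_norm (harmonic_projection l u))\<^sup>2)}"

text \<open>For \<open>s > n/2\<close> every Sobolev class has a unique continuous representative on the sphere.\<close>

definition positive_sobolev_sphere :: "nat \<Rightarrow> real \<Rightarrow> ('a::euclidean_space \<Rightarrow> real) set" where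
  "positive_sobolev_sphere n s =
     {u \<in> sobolev_sphere n s. continuous_on (sphere 0 1) u \<and> (\<forall>x\<in>sphere 0 1. 0 < u x)}"

definition alpha :: "nat \<Rightarrow> real \<Rightarrow> nat \<Rightarrow> real" where
  "alpha n s l = Gamma (real l + real n / 2 + s) / Gamma (real l + real n / 2 - s)"

definition a_form :: "nat \<Rightarrow> real \<Rightarrow> ('a::euclidean_space \<Rightarrow> real) \<Rightarrow> real" where
  "a_form n s u = (\<Sum>l. alpha n s l * (L2_sphere_norm (harmonic_projection l u))\<^sup>2)"

definition sobolev_quotient :: "nat \<Rightarrow> real \<Rightarrow> ('a::euclidean_space \<Rightarrow> real) \<Rightarrow> real" where
  "sobolev_quotient n s u =
     (LINT x|surface_measure. u x powr (- (2 * real n / (2 * s - real n))))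
       powr ((2 * s - real n) / real n) * a_form n s u"

definition sobolev_infimum :: "'a::euclidean_space itself \<Rightarrow> nat \<Rightarrow> real \<Rightarrow> ereal" where
  "sobolev_infimum _ n s =
     (INF u\<in>(positive_sobolev_sphere n s :: ('a \<Rightarrow> real) set). ereal (sobolev_quotient n s u))"

end

theory Submission imports Defs begin

text \<open>
  Put \<open>\<sigma> = s - n/2\<close> and \<open>m = \<lfloor>\<sigma>\<rfloor> \<ge> 2\<close>. For \<open>l \<le> m\<close> the weights \<open>\<alpha>(l) = \<Gamma>(l + n + \<sigma>) / \<Gamma>(l - \<sigma>)\<close> alternate in
  sign with \<open>\<alpha>(m) < 0\<close>, and \<open>\<bar>\<alpha>(l + 1)\<bar> / \<bar>\<alpha>(l)\<bar> = (l + n + \<sigma>) / (\<sigma> - l)\<close> for \<open>l < m\<close>.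

  For \<open>n \<ge> 2\<close> let \<open>t\<close> be a coordinate and let \<open>v = t\<^sup>m\<close> for even \<open>m\<close> and \<open>v = t\<^bsup>m-1\<^esup> + t\<^sup>m\<close> for odd \<open>m\<close>.
  Then \<open>v \<ge> 0\<close> on the sphere and \<open>a[v] < 0\<close>: for even \<open>m\<close> only negative weights occur, and for odd \<open>m\<close>
  the component of \<open>t\<^sup>m\<close> of degree \<open>l + 1\<close> outweighs that of \<open>t\<^bsup>m-1\<^esup>\<close> of degree \<open>l\<close>. As \<open>v\<close> vanishes on
  the equator to an order \<open>k\<close> with \<open>k n / \<sigma> > 1\<close>, the integral of \<open>(v + \<epsilon>)\<^bsup>-n/\<sigma>\<^esup>\<close> tends to infinity as
  \<open>\<epsilon>\<close> tends to \<open>0\<close>, while \<open>a[v + \<epsilon>]\<close> tends to \<open>a[v] < 0\<close>.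

  For \<open>n = 1\<close> the function \<open>K + Re z\<^sup>m\<close> has a negative form if \<open>K > 1\<close> is close to \<open>1\<close>, hence a minimiser
  \<open>u\<close> has \<open>a[u] < 0\<close>. The harmonics of degree \<open>m\<close> form a space of dimension two, so there is a small
  \<open>q \<noteq> 0\<close> among them orthogonal to \<open>u\<close>. Then \<open>a[u \<plusminus> q] = a[u] + \<alpha>(m) \<parallel>q\<parallel>\<^sup>2\<close>, and by convexity the integral
  does not decrease for one of the two signs, so \<open>u\<close> is not a minimiser.
\<close>

section \<open>Directional derivatives of polynomial functions\<close>

text \<open>The Frechet derivative gives linearity in \<open>v\<close> for free. Polynomial
  functions are differentiable everywhere, so no default value enters, and \<open>dird_line\<close>
  links \<open>dird\<close> to the iterated \<open>deriv\<close> inside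
  \<open>laplacian\<close>.\<close>

definition dird :: "'a::euclidean_space \<Rightarrow> ('a \<Rightarrow> real) \<Rightarrow> 'a \<Rightarrow> real" where
  "dird v p x = frechet_derivative p (at x) v"

lemma dirdI: "(p has_derivative D) (at x) \<Longrightarrow> dird v p x = D v"
  unfolding dird_def by (drule frechet_derivative_at) simp

lemma rpf_differentiable: "real_polynomial_function p \<Longrightarrow> p differentiable (at x)"
  by (induction p rule: real_polynomial_function.induct)
     (auto intro: bounded_linear_imp_differentiable)

lemma rpf_has_derivative:
  "real_polynomial_function p \<Longrightarrow> (p has_derivative (\<lambda>v. dird v p x)) (at x)"
  unfolding dird_def by (rule frechet_derivative_works[THEN iffD1]) (rule rpf_differentiable)

lemma dird_linear: "bounded_linear f \<Longrightarrow> dird v f = (\<lambda>x. f v)"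
  by (rule ext, rule dirdI) (rule bounded_linear_imp_has_derivative)

lemma dird_inner [simp]: "dird v (\<lambda>x. x \<bullet> e) = (\<lambda>x. v \<bullet> e)"
  by (rule dird_linear) (rule bounded_linear_inner_left)

lemma dird_const [simp]: "dird v (\<lambda>x. c) = (\<lambda>x. 0)"
  by (rule ext, rule dirdI) simp

lemma dird_add:
  assumes "real_polynomial_function p" "real_polynomial_function q"
  shows "dird v (\<lambda>x. p x + q x) = (\<lambda>x. dird v p x + dird v q x)"
  by (rule ext, rule dirdI) (intro derivative_intros rpf_has_derivative assms)

lemma dird_diff:
  assumes "real_polynomial_function p" "real_polynomial_function q"
  shows "dird v (\<lambda>x. p x - q x) = (\<lambda>x. dird v p x - dird v q x)"
  by (rule ext, rule dirdI) (intro derivative_intros rpf_has_derivative assms)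

lemma dird_mult:
  assumes "real_polynomial_function p" "real_polynomial_function q"
  shows "dird v (\<lambda>x. p x * q x) = (\<lambda>x. dird v p x * q x + p x * dird v q x)"
  by (rule ext, subst dirdI[OF has_derivative_mult[OF rpf_has_derivative rpf_has_derivative]])
     (auto simp: assms)

lemmas rpf_linear = real_polynomial_function.intros(1)
  and rpf_const = real_polynomial_function.intros(2)
  and rpf_add = real_polynomial_function.intros(3)
  and rpf_mult = real_polynomial_function.intros(4)

lemma rpf_inner: "real_polynomial_function (\<lambda>x::'a::euclidean_space. x \<bullet> e)"
  by (rule rpf_linear) (rule bounded_linear_inner_left)

lemma dird_cmult:
  assumes "real_polynomial_function p"
  shows "dird v (\<lambda>x. c * p x) = (\<lambda>x. c * dird v p x)"
  using dird_mult[OF rpf_const assms] by simp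

lemma rpf_dird: "real_polynomial_function p \<Longrightarrow> real_polynomial_function (dird v p)"
proof (induction p rule: real_polynomial_function.induct)
  case (add f g)
  then show ?case by (simp add: dird_add rpf_add)
next
  case (mult f g)
  then show ?case by (simp add: dird_mult rpf_add rpf_mult)
qed (simp_all add: dird_linear rpf_const)

text \<open>Induction on the construction of the polynomial: linear functions have constant
  derivatives, and the product rule applied twice is symmetric in \<open>u\<close> and
  \<open>v\<close>.\<close>

lemma dird_commute:
  "real_polynomial_function p \<Longrightarrow> dird u (dird v p) = dird v (dird u p)"
  by (induction p rule: real_polynomial_function.induct)
     (auto simp: dird_linear dird_add dird_mult rpf_dird real_polynomial_function.intros fun_eq_iff)

lemma dird_line:
  assumes "real_polynomial_function p"
  shows "((\<lambda>t. p (x + t *\<^sub>R b)) has_real_derivative dird b p (x + t *\<^sub>R b)) (at t)"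
proof -
  have "((\<lambda>t. p (x + t *\<^sub>R b)) has_derivative (\<lambda>h. dird (h *\<^sub>R b) p (x + t *\<^sub>R b))) (at t)"
    by (rule has_derivative_compose[where f = "\<lambda>t. x + t *\<^sub>R b" and g = p, OF _ rpf_has_derivative[OF assms]])
       (auto intro!: derivative_eq_intros)
  moreover have "dird (h *\<^sub>R b) p y = dird b p y * h" for h y
    using linear_scale[OF has_derivative_linear[OF rpf_has_derivative[OF assms, of y]], of h b]
    by (simp add: mult.commute)
  ultimately show ?thesis
    by (simp add: has_field_derivative_def)
qed

lemma laplacian_rpf:
  assumes "real_polynomial_function p"
  shows "laplacian p x = (\<Sum>b\<in>Basis. dird b (dird b p) x)"
proof -
  have "deriv (\<lambda>t. p (x + t *\<^sub>R b)) = (\<lambda>t. dird b p (x + t *\<^sub>R b))" for b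
    by (rule ext) (rule DERIV_imp_deriv[OF dird_line[OF assms]])
  moreover have "deriv (\<lambda>t. dird b p (x + t *\<^sub>R b)) 0 = dird b (dird b p) x" for b
    using DERIV_imp_deriv[OF dird_line[OF rpf_dird[OF assms]], of b x b 0] by simp
  ultimately show ?thesis
    by (simp add: laplacian_def)
qed

lemma dird_euclidean:
  assumes "real_polynomial_function p"
  shows "dird v p x = (\<Sum>b\<in>Basis. (v \<bullet> b) * dird b p x)"
proof -
  interpret linear "\<lambda>v. dird v p x"
    by (rule has_derivative_linear[OF rpf_has_derivative[OF assms]])
  have "dird v p x = dird (\<Sum>b\<in>Basis. (v \<bullet> b) *\<^sub>R b) p x"
    by (simp add: euclidean_representation)
  also have "\<dots> = (\<Sum>b\<in>Basis. (v \<bullet> b) * dird b p x)"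
    by (simp add: sum scale)
  finally show ?thesis .
qed

text \<open>Euler's identity, from differentiating \<open>p ((1 + t) x) = (1 + t)^l p x\<close> at
  \<open>t = 0\<close>.\<close>

lemma dird_homogeneous:
  assumes p: "real_polynomial_function p" and h: "\<And>t x. p (t *\<^sub>R x) = t ^ l * p x"
  shows "dird x p x = real l * p x"
proof -
  have "((\<lambda>t. p (x + t *\<^sub>R x)) has_real_derivative dird x p x) (at 0)"
    using dird_line[OF p, of x x 0] by simp
  moreover have "p (x + t *\<^sub>R x) = (1 + t) ^ l * p x" for t
    using h[of "1 + t" x] by (simp add: algebra_simps)
  ultimately have "((\<lambda>t. (1 + t) ^ l * p x) has_real_derivative dird x p x) (at 0)"
    by simp
  moreover have "((\<lambda>t. (1 + t) ^ l * p x) has_real_derivative real l * p x) (at 0)"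
    by (auto intro!: derivative_eq_intros)
  ultimately show ?thesis
    by (rule DERIV_unique)
qed

text \<open>Differentiating \<open>p\<close> at \<open>t x\<close> in the direction
  \<open>t b\<close> in two ways leaves a common factor \<open>t\<close>, which cancels when
  \<open>t\<close> is nonzero. The remaining value \<open>t = 0\<close> belongs to the definition of
  homogeneity and is reached by continuity.\<close>

lemma dird_homogeneous_pred:
  assumes p: "real_polynomial_function p" and h: "\<And>t x. p (t *\<^sub>R x) = t ^ Suc l * p x"
  shows "dird b p (t *\<^sub>R x) = t ^ l * dird b p x"
proof -
  have *: "dird b p (t *\<^sub>R x) = t ^ l * dird b p x" if "t \<noteq> 0" for t
  proof -
    have "((\<lambda>r. p (t *\<^sub>R x + r *\<^sub>R (t *\<^sub>R b))) has_real_derivative dird (t *\<^sub>R b) p (t *\<^sub>R x)) (at 0)"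
      using dird_line[OF p, of "t *\<^sub>R x" "t *\<^sub>R b" 0] by simp
    moreover have "p (t *\<^sub>R x + r *\<^sub>R (t *\<^sub>R b)) = t ^ Suc l * p (x + r *\<^sub>R b)" for r
      using h[of t "x + r *\<^sub>R b"] by (simp add: algebra_simps)
    moreover have "((\<lambda>r. t ^ Suc l * p (x + r *\<^sub>R b)) has_real_derivative t ^ Suc l * dird b p x) (at 0)"
      using dird_line[OF p, of x b 0] by (auto intro!: derivative_eq_intros)
    ultimately have "dird (t *\<^sub>R b) p (t *\<^sub>R x) = t ^ Suc l * dird b p x"
      using DERIV_unique by fastforce
    moreover have "dird (t *\<^sub>R b) p (t *\<^sub>R x) = t * dird b p (t *\<^sub>R x)"
      using linear_scale[OF has_derivative_linear[OF rpf_has_derivative[OF p]]] by simp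
    ultimately show ?thesis
      using that by simp
  qed
  show ?thesis
  proof (cases "t = 0")
    case False
    then show ?thesis by (rule *)
  next
    case True
    have "isCont (dird b p) (0 *\<^sub>R x)"
      using rpf_differentiable[OF rpf_dird[OF p]] differentiable_imp_continuous_within by blast
    moreover have "((\<lambda>t. t *\<^sub>R x) \<longlongrightarrow> 0 *\<^sub>R x) (at 0)"
      by (intro tendsto_intros)
    ultimately have "((\<lambda>t. dird b p (t *\<^sub>R x)) \<longlongrightarrow> dird b p (0 *\<^sub>R x)) (at 0)"
      by (rule isCont_tendsto_compose)
    moreover have "((\<lambda>t. t ^ l * dird b p x) \<longlongrightarrow> 0 ^ l * dird b p x) (at 0)"
      by (intro tendsto_intros)
    then have "((\<lambda>t. dird b p (t *\<^sub>R x)) \<longlongrightarrow> 0 ^ l * dird b p x) (at 0)"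
      by (rule Lim_transform_eventually) (auto simp: eventually_at_filter *)
    ultimately have "dird b p (0 *\<^sub>R x) = 0 ^ l * dird b p x"
      using tendsto_unique trivial_limit_at by blast
    then show ?thesis using True by simp
  qed
qed

section \<open>Integrals over the unit ball\<close>

lemma rpf_continuous: "real_polynomial_function p \<Longrightarrow> continuous_on S p"
  by (simp add: continuous_on_polymonial_function real_polynomial_function_eq)

lemma rpf_borel: "real_polynomial_function p \<Longrightarrow> p \<in> borel_measurable borel"
  by (rule borel_measurable_continuous_onI[OF rpf_continuous])

lemma integrable_bounded_support:
  fixes f :: "'a::euclidean_space \<Rightarrow> real"
  assumes f: "f \<in> borel_measurable borel" and A: "bounded A" "A \<in> sets borel"
    and bd: "\<And>x. x \<in> A \<Longrightarrow> \<bar>f x\<bar> \<le> C" and z: "\<And>x. x \<notin> A \<Longrightarrow> f x = 0"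
  shows "integrable lborel f"
  by (rule integrableI_bounded_set[where A = A and B = C])
     (use assms emeasure_bounded_finite[OF A(1)] in auto)

lemma lborel_integral_scale:
  fixes f :: "'a::euclidean_space \<Rightarrow> real"
  assumes [measurable]: "f \<in> borel_measurable borel" and r: "r > 0"
  shows "(LINT x|lborel. f x) = r ^ DIM('a) * (LINT x|lborel. f (r *\<^sub>R x))"
proof -
  have "(LINT x|lborel. f x)
      = (LINT x|density (distr lborel borel (\<lambda>x. 0 + r *\<^sub>R x)) (\<lambda>_. ennreal (\<bar>r\<bar> ^ DIM('a))). f x)"
    using r by (subst lborel_affine[of r 0]) (simp_all add: ennreal_power)
  also have "\<dots> = r ^ DIM('a) * (LINT x|lborel. f (r *\<^sub>R x))"
    using r by (simp add: integral_density integral_distr)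
  finally show ?thesis .
qed

text \<open>Ball integrals stand in for surface integrals: on homogeneous polynomials the two are
  proportional (\<open>surface_integral_homogeneous\<close>), and on the ball one can integrate by
  parts with Lebesgue measure.\<close>

definition ballint :: "('a::euclidean_space \<Rightarrow> real) \<Rightarrow> real" where
  "ballint f = (LINT x|lborel. indicat_real (ball 0 1) x * f x)"

lemma ballint_scale:
  fixes F :: "'a::euclidean_space \<Rightarrow> real"
  assumes [measurable]: "F \<in> borel_measurable borel" and r: "r > 0"
    and h: "\<And>r x. r > 0 \<Longrightarrow> F (r *\<^sub>R x) = r ^ i * F x"
  shows "(LINT x|lborel. indicat_real (ball 0 r) x * F x) = r ^ (DIM('a) + i) * ballint F"
proof -
  have eq: "indicat_real (ball 0 r) (r *\<^sub>R x) * F (r *\<^sub>R x) = r ^ i * (indicat_real (ball 0 1) x * F x)" for x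
    using r h[of r x] by (auto simp: indicator_def)
  have m: "(\<lambda>x. indicat_real (ball 0 r) x * F x) \<in> borel_measurable borel"
    by (intro borel_measurable_times borel_measurable_indicator) auto
  show ?thesis
    by (subst lborel_integral_scale[OF m r]) (simp only: eq integral_mult_right_zero ballint_def power_add mult.assoc)
qed

text \<open>A substitute for polar coordinates. Write \<open>1 - norm x ^ Suc j\<close> as
  \<open>Suc j\<close> times the integral of \<open>r^j\<close> over \<open>norm x < r < 1\<close>
  and exchange the integrals: the inner one runs over the ball of radius \<open>r\<close> and scales
  like \<open>r^(DIM('a) + i)\<close>, so a one-dimensional power integral remains.\<close>

lemma ballint_radial:
  fixes F :: "'a::euclidean_space \<Rightarrow> real"
  assumes F[measurable]: "F \<in> borel_measurable borel" and C: "\<And>x. x \<in> ball 0 1 \<Longrightarrow> \<bar>F x\<bar> \<le> C"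
    and h: "\<And>r x. r > 0 \<Longrightarrow> F (r *\<^sub>R x) = r ^ i * F x"
  shows "ballint (\<lambda>x. F x * (1 - norm x ^ Suc j)) = real (Suc j) / real (DIM('a) + i + Suc j) * ballint F"
proof -
  define H where "H = (\<lambda>(x::'a) (r::real). indicat_real (ball 0 1) x * F x
     * (r ^ j * indicat_real {0..1} r * indicator {p. norm (fst p) < snd p} (x, r)))"
  have "C \<ge> 0" using C[of 0] by simp
  have [measurable]: "(\<lambda>p::'a \<times> real. indicat_real {p. norm (fst p) < snd p} p) \<in> borel_measurable (borel \<Otimes>\<^sub>M borel)"
  proof (rule borel_measurable_indicator)
    have "{p :: 'a \<times> real. norm (fst p) < snd p} = {p \<in> space (borel \<Otimes>\<^sub>M borel). norm (fst p) < snd p}"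
      by (simp add: space_pair_measure)
    also have "\<dots> \<in> sets (borel \<Otimes>\<^sub>M borel)" by measurable
    finally show "{p :: 'a \<times> real. norm (fst p) < snd p} \<in> sets (borel \<Otimes>\<^sub>M borel)" .
  qed
  have int: "integrable (lborel \<Otimes>\<^sub>M lborel) (\<lambda>(x,r). H x r)"
  proof (rule integrableI_bounded_set[where A = "ball 0 1 \<times> {0..1}" and B = C])
    show "(\<lambda>(x, r). H x r) \<in> borel_measurable (lborel \<Otimes>\<^sub>M lborel)"
    proof -
      have "(\<lambda>p. indicat_real (ball (0::'a) 1) (fst p)) \<in> borel_measurable (borel \<Otimes>\<^sub>M (borel :: real measure))"
        by (rule measurable_compose[OF measurable_fst]) (simp add: borel_measurable_indicator)
      then have "(\<lambda>(x, r). H x r) \<in> borel_measurable (borel \<Otimes>\<^sub>M borel)"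
        unfolding H_def split_beta' by simp
      then show ?thesis
        by (simp add: measurable_cong_sets[OF sets_pair_measure_cong[OF sets_lborel sets_lborel] refl])
    qed
    show "emeasure (lborel \<Otimes>\<^sub>M lborel) (ball (0::'a) 1 \<times> {0..1::real}) < \<infinity>"
      using emeasure_bounded_finite[OF bounded_ball, of "0::'a" 1]
      by (subst lborel.emeasure_pair_measure_Times)
         (auto simp: ennreal_mult_less_top)
    show "AE p\<in>ball 0 1 \<times> {0..1} in lborel \<Otimes>\<^sub>M lborel. norm (case p of (x, r) \<Rightarrow> H x r) \<le> C"
    proof (intro AE_I2 impI)
      fix p :: "'a \<times> real" assume p: "p \<in> ball 0 1 \<times> {0..1}"
      then obtain x r where [simp]: "p = (x, r)" and x: "x \<in> ball 0 1" and r: "0 \<le> r" "r \<le> 1" by auto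
      have "\<bar>F x\<bar> * \<bar>r\<bar> ^ j \<le> C * 1"
        by (intro mult_mono C x power_le_one \<open>C \<ge> 0\<close>) (use r in auto)
      then show "norm (case p of (x, r) \<Rightarrow> H x r) \<le> C"
        using \<open>C \<ge> 0\<close> by (auto simp: H_def indicator_def abs_mult power_abs)
    qed
  qed (auto simp: H_def indicator_def)
  have 1: "(LINT r|lborel. H x r) = indicat_real (ball 0 1) x * F x * ((1 - norm x ^ Suc j) / Suc j)" for x
  proof (cases "x \<in> ball 0 1")
    case True
    have "(LINT r|lborel. H x r) = F x * (LINT r|lborel. r ^ j * indicat_real {norm x..1} r)"
      unfolding integral_mult_right_zero[symmetric]
    proof (rule integral_cong_AE)
      \<comment> \<open>\<open>H\<close> uses the strict inequality \<open>norm x < r\<close>; it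
        differs from the closed interval only at \<open>r = norm x\<close>.\<close>
      show "AE r in lborel. H x r = F x * (r ^ j * indicat_real {norm x..1} r)"
        using AE_lborel_singleton[of "norm x"]
      proof eventually_elim
        case (elim r)
        then show ?case
          using True norm_ge_zero[of x] unfolding H_def by (auto simp: indicator_def simp del: norm_ge_zero)
      qed
      show "H x \<in> borel_measurable lborel"
      proof -
        have "H x = (\<lambda>r. indicat_real (ball 0 1) x * F x * (r ^ j * indicat_real {0..1} r * indicat_real {norm x<..} r))"
          by (auto simp: H_def indicator_def)
        then show ?thesis by simp
      qed
    qed simp
    also have "(LINT r|lborel. r ^ j * indicat_real {norm x..1} r) = (1 - norm x ^ Suc j) / Suc j"
      using True by (subst integral_power) auto
    finally show ?thesis using True by simp
  qed (simp add: H_def)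
  have 2: "(LINT x|lborel. H x r) = r ^ (DIM('a) + i + j) * indicat_real {0..1} r * ballint F" for r
  proof (cases "0 < r \<and> r \<le> 1")
    case True
    have "(LINT x|lborel. H x r) = (LINT x|lborel. r ^ j * (indicat_real (ball 0 r) x * F x))"
      by (rule Bochner_Integration.integral_cong) (use True in \<open>auto simp: H_def indicator_def\<close>)
    also have "\<dots> = r ^ j * (r ^ (DIM('a) + i) * ballint F)"
      using True by (simp add: ballint_scale[OF F _ h])
    finally show ?thesis using True by (simp add: power_add)
  next
    case False
    then have "H x r = 0" for x
      by (auto simp: H_def indicator_def not_less intro: order_trans[OF _ norm_ge_zero] dest: order_antisym
           split: if_splits)
    then show ?thesis using False by (auto simp: indicator_def)
  qed
  have "ballint (\<lambda>x. F x * (1 - norm x ^ Suc j)) = Suc j * (LINT x|lborel. (LINT r|lborel. H x r))"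
    unfolding ballint_def 1 integral_mult_right_zero[symmetric]
    by (rule Bochner_Integration.integral_cong) auto
  also have "(LINT x|lborel. (LINT r|lborel. H x r)) = (LINT r|lborel. (LINT x|lborel. H x r))"
    by (rule lborel_pair.Fubini_integral[OF int, symmetric])
  also have "\<dots> = ballint F / real (DIM('a) + i + Suc j)"
    unfolding 2 integral_mult_left_zero by (subst integral_power) (auto simp: power_0_left)
  finally show ?thesis by (simp add: mult_ac)
qed

text \<open>By the fundamental theorem \<open>F (x + b) - F x\<close> is the integral of
  \<open>G (x + t b)\<close> over \<open>t\<close> in [0,1]. Integrating over \<open>x\<close>, the
  left side vanishes by translation invariance, while Fubini turns the right side into the integral
  of \<open>G\<close>.\<close>

lemma lborel_integral_directional_derivative:
  fixes F G :: "'a::euclidean_space \<Rightarrow> real"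
  assumes d: "\<And>x t. ((\<lambda>t. F (x + t *\<^sub>R b)) has_real_derivative G (x + t *\<^sub>R b)) (at t)"
    and cF: "continuous_on UNIV F" and cG: "continuous_on UNIV G" and b: "norm b \<le> 1"
    and F0: "\<And>x. norm x \<ge> 1 \<Longrightarrow> F x = 0" and G0: "\<And>x. norm x \<ge> 1 \<Longrightarrow> G x = 0"
  shows "(LINT x|lborel. G x) = 0"
proof -
  have [measurable]: "F \<in> borel_measurable borel" "G \<in> borel_measurable borel"
    using cF cG by (auto intro: borel_measurable_continuous_onI)
  have bounded: "\<exists>C. \<forall>x\<in>cball 0 1. \<bar>f x\<bar> \<le> C" if "continuous_on UNIV f" for f :: "'a \<Rightarrow> real"
    using compact_imp_bounded[OF compact_continuous_image[OF continuous_on_subset[OF that] compact_cball[of 0 1]]]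
    by (auto simp: bounded_iff)
  obtain C where C: "\<And>x. x \<in> cball 0 1 \<Longrightarrow> \<bar>G x\<bar> \<le> C" using bounded[OF cG] by blast
  obtain C' where C': "\<And>x. x \<in> cball 0 1 \<Longrightarrow> \<bar>F x\<bar> \<le> C'" using bounded[OF cF] by blast
  have CG: "\<bar>G x\<bar> \<le> C" for x
    using C[of x] C[of 0] G0[of x] by (cases "norm x \<le> 1") auto
  have iF: "integrable lborel F"
    by (rule integrable_bounded_support[of _ "cball 0 1" C']) (use C' F0 in auto)
  define K where "K = (\<lambda>(x::'a) (t::real). indicat_real {0..1} t * G (x + t *\<^sub>R b))"
  have int: "integrable (lborel \<Otimes>\<^sub>M lborel) (\<lambda>(x,t). K x t)"
  proof (rule integrableI_bounded_set[where A = "cball 0 2 \<times> {0..1}" and B = C])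
    show "(\<lambda>(x, t). K x t) \<in> borel_measurable (lborel \<Otimes>\<^sub>M lborel)"
      unfolding K_def split_beta' by measurable
    show "emeasure (lborel \<Otimes>\<^sub>M lborel) (cball (0::'a) 2 \<times> {0..1::real}) < \<infinity>"
      using emeasure_bounded_finite[OF bounded_cball, of "0::'a" 2]
      by (subst lborel.emeasure_pair_measure_Times)
         (auto simp: ennreal_mult_less_top)
    show "AE p\<in>cball 0 2 \<times> {0..1} in lborel \<Otimes>\<^sub>M lborel. norm (case p of (x, t) \<Rightarrow> K x t) \<le> C"
      using CG order_trans[OF abs_ge_zero CG] by (auto simp: K_def indicator_def)
    \<comment> \<open>\<open>G\<close> vanishes outside the unit ball and the shift
      \<open>t b\<close> has norm at most 1, so \<open>K\<close> is supported in the ball of radius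
      2.\<close>
    have K0: "K x t = 0" if "\<not> (norm x \<le> 2 \<and> t \<in> {0..1})" for x t
    proof (cases "t \<in> {0..1}")
      case True
      have "norm x \<le> norm (x + t *\<^sub>R b) + norm (t *\<^sub>R b)"
        by (metis add_diff_cancel_right' norm_triangle_ineq4)
      moreover have "norm (t *\<^sub>R b) \<le> 1"
        using True b mult_mono[of t 1 "norm b" 1] by simp
      ultimately show ?thesis using True that G0[of "x + t *\<^sub>R b"] by (simp add: K_def)
    qed (simp add: K_def)
    show "AE p in lborel \<Otimes>\<^sub>M lborel. p \<notin> cball 0 2 \<times> {0..1} \<longrightarrow> (case p of (x, t) \<Rightarrow> K x t) = 0"
      by (intro AE_I2 impI) (auto intro!: K0)
  qed auto
  have shift: "(LINT x|lborel. f (x + c)) = (LINT x|lborel. f x)"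
    if [measurable]: "f \<in> borel_measurable borel" for f :: "'a \<Rightarrow> real" and c
    by (subst lborel_distr_plus[of c, symmetric]) (simp add: integral_distr add.commute)
  have shift_int: "integrable lborel (\<lambda>x. F (x + b))"
    using iF by (subst (asm) lborel_distr_plus[of b, symmetric]) (simp add: integrable_distr_eq add.commute)
  have 1: "(LINT t|lborel. K x t) = F (x + b) - F x" for x
  proof -
    have "(LINT t|lborel. indicat_real {0..1} t *\<^sub>R G (x + t *\<^sub>R b)) = F (x + 1 *\<^sub>R b) - F (x + 0 *\<^sub>R b)"
      by (rule integral_FTC_Icc)
         (auto intro!: continuous_on_compose2[OF cG] continuous_intros DERIV_subset[OF d]
               simp flip: has_real_derivative_iff_has_vector_derivative)
    then show ?thesis by (simp add: K_def)
  qed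
  have 2: "(LINT x|lborel. K x t) = indicat_real {0..1} t * (LINT x|lborel. G x)" for t
    by (simp add: K_def shift)
  have "(LINT x|lborel. G x) = (LINT t|lborel. (LINT x|lborel. K x t))"
    unfolding 2 by simp
  also have "\<dots> = (LINT x|lborel. (LINT t|lborel. K x t))"
    by (rule lborel_pair.Fubini_integral[OF int])
  also have "\<dots> = 0"
    unfolding 1 by (simp add: Bochner_Integration.integral_diff[OF shift_int iF] shift)
  finally show ?thesis .
qed

section \<open>Orthogonality of solid harmonics\<close>

text \<open>The square makes the weight \<open>(max 0 (1 - x \<bullet> x))^2\<close> continuously
  differentiable across the sphere. Since it vanishes off the ball, integration by parts has no
  boundary term.\<close>

lemma DERIV_positive_part_square:
  "((\<lambda>y::real. (max 0 y)\<^sup>2) has_real_derivative 2 * max 0 y) (at y)"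
proof (cases y "0::real" rule: linorder_cases)
  case equal
  have "((\<lambda>h::real. (max 0 h)\<^sup>2 / h) \<longlongrightarrow> 0) (at 0)"
  proof (rule Lim_transform_eventually)
    have "((\<lambda>h::real. max 0 h) \<longlongrightarrow> max 0 0) (at 0)"
      by (intro tendsto_intros)
    then show "((\<lambda>h::real. max 0 h) \<longlongrightarrow> 0) (at 0)" by simp
  qed (auto simp: eventually_at_filter max_def power2_eq_square)
  then show ?thesis using equal by (simp add: DERIV_def)
next
  case less
  have "((\<lambda>y::real. 0) has_real_derivative 0) (at y)" by simp
  then have "((\<lambda>y::real. (max 0 y)\<^sup>2) has_real_derivative 0) (at y)"
    by (rule has_field_derivative_transform_within_open[where S = "{..<0}"]) (use less in auto)
  then show ?thesis using less by simp
next
  case greater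
  have "((\<lambda>y::real. y\<^sup>2) has_real_derivative 2 * y) (at y)"
    by (auto intro!: derivative_eq_intros)
  then have "((\<lambda>y::real. (max 0 y)\<^sup>2) has_real_derivative 2 * y) (at y)"
    by (rule has_field_derivative_transform_within_open[where S = "{0<..}"]) (use greater in auto)
  then show ?thesis using greater by simp
qed

text \<open>The derivative of \<open>P\<close> times the weight along \<open>b\<close> has integral
  zero; the weight itself contributes \<open>- 4 (x \<bullet> b) max 0 (1 - x \<bullet> x)\<close>,
  whence the factor 4.\<close>

lemma weighted_integration_by_parts:
  fixes P :: "'a::euclidean_space \<Rightarrow> real"
  assumes P: "real_polynomial_function P" and b: "norm b \<le> 1"
  shows "integrable lborel (\<lambda>x. dird b P x * (max 0 (1 - x \<bullet> x))\<^sup>2)" (is ?I1)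
    and "integrable lborel (\<lambda>x. (x \<bullet> b) * P x * max 0 (1 - x \<bullet> x))" (is ?I2)
    and "(LINT x|lborel. dird b P x * (max 0 (1 - x \<bullet> x))\<^sup>2)
       = 4 * (LINT x|lborel. (x \<bullet> b) * P x * max 0 (1 - x \<bullet> x))" (is ?eq)
proof -
  have cP: "continuous_on UNIV P" "continuous_on UNIV (dird b P)"
    by (simp_all add: rpf_continuous rpf_dird P)
  have z: "max 0 (1 - x \<bullet> x) = 0" if "norm x \<ge> 1" for x :: 'a
    using that by (simp add: dot_square_norm)
  have int: "integrable lborel f" if c: "continuous_on UNIV f" and "\<And>x. norm x \<ge> 1 \<Longrightarrow> f x = 0" for f :: "'a \<Rightarrow> real"
  proof -
    have "bounded (f ` cball 0 1)"
      by (intro compact_imp_bounded compact_continuous_image continuous_on_subset[OF c]) auto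
    then obtain C where "\<And>x. x \<in> cball 0 1 \<Longrightarrow> \<bar>f x\<bar> \<le> C"
      by (fastforce simp: bounded_iff)
    then show ?thesis
      by (intro integrable_bounded_support[of _ "cball 0 1" C] borel_measurable_continuous_onI c) (use that in auto)
  qed
  show I1: ?I1 and I2: ?I2
    by (rule int, intro continuous_intros cP; simp add: z)+
  let ?F = "\<lambda>x. P x * (max 0 (1 - x \<bullet> x))\<^sup>2"
  let ?G = "\<lambda>x. dird b P x * (max 0 (1 - x \<bullet> x))\<^sup>2 - 4 * ((x \<bullet> b) * P x * max 0 (1 - x \<bullet> x))"
  have "(LINT x|lborel. ?G x) = 0"
  proof (rule lborel_integral_directional_derivative[of ?F b ?G])
    fix x t
    have "((\<lambda>t. 1 - (x + t *\<^sub>R b) \<bullet> (x + t *\<^sub>R b)) has_real_derivative - 2 * ((x + t *\<^sub>R b) \<bullet> b)) (at t)"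
      unfolding has_field_derivative_def
      by (auto intro!: derivative_eq_intros simp: inner_simps inner_commute algebra_simps)
    note DERIV_chain2[OF DERIV_positive_part_square this]
    from DERIV_mult[OF dird_line[OF P] this]
    show "((\<lambda>t. ?F (x + t *\<^sub>R b)) has_real_derivative ?G (x + t *\<^sub>R b)) (at t)"
      by (rule DERIV_cong) (simp add: algebra_simps)
  qed (use b z in \<open>auto intro!: continuous_intros cP\<close>)
  then show ?eq
    using I1 I2 by simp
qed

text \<open>
  Testing \<open>\<Delta> p = 0\<close> against \<open>q\<close> with the weight \<open>(1 - \<bar>x\<bar>\<^sup>2)\<^sup>2\<close> on the ball turns the energy of
  \<open>p\<close> and \<open>q\<close> into \<open>4 l\<close> times a symmetric form, by Euler's identity.
\<close>

lemma harmonic_energy: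
  fixes p q :: "'a::euclidean_space \<Rightarrow> real"
  assumes p: "p \<in> homogeneous_harmonic_polynomials l" and q: "real_polynomial_function q"
  shows "(LINT x|lborel. (\<Sum>b\<in>Basis. dird b q x * dird b p x) * (max 0 (1 - x \<bullet> x))\<^sup>2)
       = 4 * real l * (LINT x|lborel. p x * q x * max 0 (1 - x \<bullet> x))"
proof -
  have pp: "real_polynomial_function p" and ph: "\<And>t x. p (t *\<^sub>R x) = t ^ l * p x"
    and pl: "\<And>x. laplacian p x = 0"
    using p by (auto simp: homogeneous_harmonic_polynomials_def)
  let ?w = "\<lambda>x::'a. (max 0 (1 - x \<bullet> x))\<^sup>2" and ?u = "\<lambda>x::'a. max 0 (1 - x \<bullet> x)"
  have Q: "real_polynomial_function (\<lambda>x. q x * dird b p x)" for b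
    by (intro rpf_mult q rpf_dird pp)
  have "(LINT x|lborel. (\<Sum>b\<in>Basis. dird b q x * dird b p x) * ?w x)
      = (LINT x|lborel. (\<Sum>b\<in>Basis. dird b (\<lambda>x. q x * dird b p x) x * ?w x))"
  proof (rule Bochner_Integration.integral_cong)
    fix x
    \<comment> \<open>Harmonicity of \<open>p\<close> supplies the missing half of the product rule,
      so each summand becomes a full derivative of \<open>q * dird b p\<close>.\<close>
    have "(\<Sum>b\<in>Basis. q x * dird b (dird b p) x) = 0"
      using pl[of x] by (simp add: laplacian_rpf[OF pp] flip: sum_distrib_left)
    then show "(\<Sum>b\<in>Basis. dird b q x * dird b p x) * ?w x = (\<Sum>b\<in>Basis. dird b (\<lambda>x. q x * dird b p x) x * ?w x)"
      by (simp add: dird_mult[OF q rpf_dird[OF pp]] sum.distrib flip: sum_distrib_right)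
  qed simp
  also have "\<dots> = (\<Sum>b\<in>Basis. LINT x|lborel. dird b (\<lambda>x. q x * dird b p x) x * ?w x)"
    by (rule Bochner_Integration.integral_sum) (simp add: weighted_integration_by_parts(1)[OF Q])
  also have "\<dots> = (\<Sum>b\<in>Basis. 4 * (LINT x|lborel. (x \<bullet> b) * (q x * dird b p x) * ?u x))"
    by (intro sum.cong refl) (simp add: weighted_integration_by_parts(3)[OF Q])
  also have "\<dots> = 4 * (LINT x|lborel. (\<Sum>b\<in>Basis. (x \<bullet> b) * (q x * dird b p x) * ?u x))"
    by (subst Bochner_Integration.integral_sum) (simp_all add: weighted_integration_by_parts(2)[OF Q] sum_distrib_left)
  also have "(\<lambda>x::'a. \<Sum>b\<in>Basis. (x \<bullet> b) * (q x * dird b p x) * ?u x) = (\<lambda>x. real l * (p x * q x * ?u x))"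
  proof
    fix x :: 'a
    have "(\<Sum>b\<in>Basis. (x \<bullet> b) * (q x * dird b p x) * ?u x) = (\<Sum>b\<in>Basis. (x \<bullet> b) * dird b p x) * q x * ?u x"
      by (simp add: sum_distrib_right sum_distrib_left mult_ac)
    also have "\<dots> = real l * (p x * q x * ?u x)"
      using dird_homogeneous[OF pp ph, of x] by (simp add: dird_euclidean[OF pp, of x] mult_ac)
    finally show "(\<Sum>b\<in>Basis. (x \<bullet> b) * (q x * dird b p x) * ?u x) = real l * (p x * q x * ?u x)" .
  qed
  finally show ?thesis by simp
qed

text \<open>The energy is symmetric in \<open>p\<close> and \<open>q\<close>, so by
  \<open>harmonic_energy\<close> it equals both \<open>4 l ?J\<close> and \<open>4 k ?J\<close>,
  which forces \<open>?J = 0\<close>. Since \<open>p * q\<close> is homogeneous,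
  \<open>ballint_radial\<close> shows that the weight \<open>1 - norm x ^ 2\<close> only contributes
  a nonzero factor.\<close>

lemma ballint_harmonic_orthogonal:
  fixes p q :: "'a::euclidean_space \<Rightarrow> real"
  assumes p: "p \<in> homogeneous_harmonic_polynomials l" and q: "q \<in> homogeneous_harmonic_polynomials k"
    and "l \<noteq> k"
  shows "ballint (\<lambda>x. p x * q x) = 0"
proof -
  have pp: "real_polynomial_function p" and ph: "\<And>t x. p (t *\<^sub>R x) = t ^ l * p x"
    using p by (auto simp: homogeneous_harmonic_polynomials_def)
  have qp: "real_polynomial_function q" and qh: "\<And>t x. q (t *\<^sub>R x) = t ^ k * q x"
    using q by (auto simp: homogeneous_harmonic_polynomials_def)
  have pq: "real_polynomial_function (\<lambda>x. p x * q x)"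
    by (rule rpf_mult[OF pp qp])
  let ?J = "LINT x|lborel. p x * q x * max 0 (1 - x \<bullet> x)"
  have "4 * real l * ?J = 4 * real k * ?J"
    using harmonic_energy[OF p qp] harmonic_energy[OF q pp] by (simp add: mult.commute)
  then have "?J = 0" using \<open>l \<noteq> k\<close> by auto
  also have "?J = ballint (\<lambda>x. p x * q x * (1 - norm x ^ Suc 1))"
    unfolding ballint_def
  proof (rule Bochner_Integration.integral_cong)
    fix x :: 'a
    show "p x * q x * max 0 (1 - x \<bullet> x) = indicat_real (ball 0 1) x * (p x * q x * (1 - norm x ^ Suc 1))"
      using power_le_one[of "norm x" 2] one_le_power[of "norm x" 2]
      by (cases "norm x < 1") (simp_all add: dot_square_norm power2_eq_square)
  qed simp
  also have "\<dots> = real (Suc 1) / real (DIM('a) + (l + k) + Suc 1) * ballint (\<lambda>x. p x * q x)"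
  proof -
    have "compact ((\<lambda>x. p x * q x) ` cball 0 1)"
      by (intro compact_continuous_image rpf_continuous pq compact_cball)
    then obtain C where "\<And>x. x \<in> cball 0 1 \<Longrightarrow> \<bar>p x * q x\<bar> \<le> C"
      by (fastforce simp: bounded_iff dest!: compact_imp_bounded)
    then show ?thesis
      by (intro ballint_radial[where C = C] rpf_borel pq) (auto simp: ph qh power_add)
  qed
  finally show ?thesis by simp
qed

section \<open>The surface measure\<close>

lemma space_surface_measure [simp]: "space surface_measure = sphere 0 1"
  by (simp add: surface_measure_def space_scale_measure)

lemma sets_surface_measure [measurable_cong]:
  "sets surface_measure = sets (restrict_space borel (sphere 0 1))"
  by (simp add: surface_measure_def)

lemma radial_projection_measurable:
  "(\<lambda>x::'a::euclidean_space. x /\<^sub>R norm x)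
    \<in> restrict_space lborel (ball 0 1 - {0}) \<rightarrow>\<^sub>M restrict_space borel (sphere 0 1)"
proof (rule measurable_restrict_space2)
  show "(\<lambda>x::'a. x /\<^sub>R norm x) \<in> borel_measurable (restrict_space lborel (ball 0 1 - {0}))"
    by (rule measurable_restrict_space1) simp
qed (auto simp: space_restrict_space)

text \<open>In the form of a constant density the surface measure is accessible to the rules for
  integrals over densities and image measures.\<close>

lemma surface_measure_density:
  "(surface_measure :: 'a::euclidean_space measure) = density (distr (restrict_space lborel (ball 0 1 - {0})) (restrict_space borel (sphere 0 1))
     (\<lambda>x. x /\<^sub>R norm x)) (\<lambda>_. ennreal (real DIM('a)))" (is "_ = density ?M _")
  by (rule measure_eqI) (simp_all add: surface_measure_def emeasure_density_const ennreal_of_nat_eq_real_of_nat)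

lemma emeasure_surface_measure:
  fixes A :: "'a::euclidean_space set"
  assumes "A \<in> sets surface_measure"
  shows "emeasure surface_measure A
    = ennreal (real DIM('a)) * emeasure lborel {x \<in> ball 0 1 - {0}. x /\<^sub>R norm x \<in> A}"
proof -
  have "(\<lambda>x. x /\<^sub>R norm x) -` A \<inter> (ball 0 1 - {0}) = {x \<in> ball 0 1 - {0}. x /\<^sub>R norm x \<in> A}"
    by auto
  then show ?thesis
    using assms
    by (simp add: surface_measure_density emeasure_density_const space_restrict_space
          emeasure_distr[OF radial_projection_measurable] emeasure_restrict_space[of _ lborel] subset_iff)
qed

lemma integral_surface_measure:
  fixes f :: "'a::euclidean_space \<Rightarrow> real"
  assumes f: "f \<in> borel_measurable (restrict_space borel (sphere 0 1))"
  shows "(LINT x|surface_measure. f x)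
    = real DIM('a) * (LINT x|lborel. indicat_real (ball 0 1 - {0}) x * f (x /\<^sub>R norm x))"
proof -
  have "(LINT x|surface_measure. f x)
      = (LINT x|restrict_space lborel (ball 0 1 - {0}). real DIM('a) * f (x /\<^sub>R norm x))"
    unfolding surface_measure_density using f
    by (simp add: integral_density integral_distr[OF radial_projection_measurable])
  also have "\<dots> = real DIM('a) * (LINT x|lborel. indicat_real (ball 0 1 - {0}) x * f (x /\<^sub>R norm x))"
    by (simp add: integral_restrict_space)
  finally show ?thesis .
qed

interpretation surface_measure: finite_measure "surface_measure :: 'a::euclidean_space measure"
proof
  have "emeasure lborel {x :: 'a \<in> ball 0 1 - {0}. x /\<^sub>R norm x \<in> sphere 0 1} < \<infinity>"
    by (intro emeasure_bounded_finite bounded_subset[OF bounded_ball[of 0 1]]) auto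
  moreover have "sphere (0::'a) 1 \<in> sets surface_measure"
    using sets.top[of "surface_measure :: 'a measure"] by simp
  ultimately show "emeasure surface_measure (space (surface_measure :: 'a measure)) \<noteq> \<infinity>"
    by (simp add: emeasure_surface_measure ennreal_mult_eq_top_iff)
qed

lemma continuous_borel_measurable_surface:
  fixes f :: "'a::euclidean_space \<Rightarrow> real"
  assumes "continuous_on (sphere 0 1) f"
  shows "f \<in> borel_measurable surface_measure"
  using borel_measurable_continuous_on_restrict[OF assms]
  by (simp add: measurable_cong_sets[OF sets_surface_measure refl])

lemma continuous_integrable_surface:
  fixes f :: "'a::euclidean_space \<Rightarrow> real"
  assumes c: "continuous_on (sphere 0 1) f"
  shows "integrable surface_measure f"
proof -
  have "bounded (f ` sphere 0 1)"
    by (intro compact_imp_bounded compact_continuous_image c) auto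
  then obtain B where "\<And>x. x \<in> sphere 0 1 \<Longrightarrow> norm (f x) \<le> B"
    by (fastforce simp: bounded_iff)
  then show ?thesis
    by (intro surface_measure.integrable_const_bound[where B = B] continuous_borel_measurable_surface c AE_I2) auto
qed

lemma radial_open_cone:
  fixes U :: "'a::euclidean_space set"
  assumes "open U"
  shows "open {x \<in> ball 0 1 - {0}. x /\<^sub>R norm x \<in> U}"
proof -
  have "open ((ball 0 1 - {0}) \<inter> (\<lambda>x. x /\<^sub>R norm x) -` U)"
    by (rule continuous_open_preimage) (auto intro!: continuous_intros assms)
  also have "(ball 0 1 - {0}) \<inter> (\<lambda>x. x /\<^sub>R norm x) -` U = {x \<in> ball 0 1 - {0}. x /\<^sub>R norm x \<in> U}"
    by auto
  finally show ?thesis .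
qed

text \<open>If \<open>f\<close> were positive at \<open>x\<close>, it would be positive on a
  relatively open set \<open>?A\<close> of the sphere. The cone over \<open>?A\<close> is open and
  contains \<open>x / 2\<close>, so it is not Lebesgue null, whereas a zero integral makes
  \<open>?A\<close> null for the surface measure.\<close>

lemma surface_integral_zero:
  fixes f :: "'a::euclidean_space \<Rightarrow> real"
  assumes c: "continuous_on (sphere 0 1) f" and nn: "\<And>x. x \<in> sphere 0 1 \<Longrightarrow> f x \<ge> 0"
    and z: "(LINT x|surface_measure. f x) = 0" and x: "x \<in> sphere 0 1"
  shows "f x = 0"
proof (rule ccontr)
  assume "f x \<noteq> 0"
  then have fx: "f x > 0" using nn[OF x] by simp
  have "openin (top_of_set (sphere 0 1)) (sphere 0 1 \<inter> f -` {0<..})"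
    by (rule continuous_openin_preimage_gen[OF c]) simp
  then obtain U where U: "open U" "sphere 0 1 \<inter> f -` {0<..} = sphere 0 1 \<inter> U"
    by (auto simp: openin_open)
  let ?A = "sphere 0 1 \<inter> U"
  have A: "?A \<in> sets surface_measure"
    using U(1) by (auto simp: sets_surface_measure sets_restrict_space)
  have "AE y in surface_measure. f y = 0"
    using z by (subst (asm) integral_nonneg_eq_0_iff_AE[OF continuous_integrable_surface[OF c]])
      (auto intro!: AE_I2 nn)
  then have "AE y in surface_measure. y \<notin> ?A"
  proof eventually_elim
    case (elim y)
    then have "y \<notin> sphere 0 1 \<inter> f -` {0<..}" by simp
    then show ?case unfolding U(2) .
  qed
  then have "emeasure surface_measure ?A = 0"
    using A by (subst (asm) AE_iff_measurable[OF A]) (auto simp: space_surface_measure)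
  then have e0: "emeasure lborel {y \<in> ball 0 1 - {0}. y /\<^sub>R norm y \<in> ?A} = 0"
    by (simp add: emeasure_surface_measure[OF A])
  have eq: "{y \<in> ball 0 1 - {0}. y /\<^sub>R norm y \<in> ?A} = {y \<in> ball 0 1 - {0}. y /\<^sub>R norm y \<in> U}"
    by auto
  have op: "open {y \<in> ball 0 1 - {0}. y /\<^sub>R norm y \<in> U}"
    by (rule radial_open_cone[OF U(1)])
  then have "negligible {y \<in> ball 0 1 - {0}. y /\<^sub>R norm y \<in> U}"
    using e0 unfolding eq
    by (simp add: negligible_iff_null_sets null_sets_def)
  then have "{y \<in> ball 0 1 - {0}. y /\<^sub>R norm y \<in> U} = {}"
    using open_not_negligible[OF op] by blast
  moreover have "(1/2) *\<^sub>R x \<in> {y \<in> ball 0 1 - {0}. y /\<^sub>R norm y \<in> U}"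
  proof -
    have "x \<in> sphere 0 1 \<inter> f -` {0<..}" using x fx by simp
    then have "x \<in> U" unfolding U(2) by simp
    moreover have "norm x = 1" using x by simp
    ultimately show ?thesis by auto
  qed
  ultimately show False by blast
qed

text \<open>With \<open>?F x = f (x / norm x)\<close> the surface integral is
  \<open>DIM('a) * ballint ?F\<close> by definition of the measure, and
  \<open>f = ?F * norm x ^ j\<close>. Removing the radial factor by \<open>ballint_radial\<close>
  multiplies by \<open>1 - j / (DIM('a) + j)\<close>.\<close>

lemma surface_integral_homogeneous:
  fixes f :: "'a::euclidean_space \<Rightarrow> real"
  assumes f: "real_polynomial_function f" and h: "\<And>t x. f (t *\<^sub>R x) = t ^ j * f x"
  shows "(LINT x|surface_measure. f x) = real (DIM('a) + j) * ballint f"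
proof -
  have fb[measurable]: "f \<in> borel_measurable borel" by (rule rpf_borel[OF f])
  let ?F = "\<lambda>x::'a. f (x /\<^sub>R norm x)"
  have Fb[measurable]: "?F \<in> borel_measurable borel" by measurable
  have Fh: "?F x * norm x ^ j = f x" for x
    using h[of "norm x" "x /\<^sub>R norm x"] h[of 0 x] by (cases "x = 0") auto
  have "(LINT x|surface_measure. f x)
      = real DIM('a) * (LINT x|lborel. indicat_real (ball 0 1 - {0}) x * ?F x)"
    by (rule integral_surface_measure) (rule measurable_restrict_space1[OF fb])
  also have "(LINT x|lborel. indicat_real (ball 0 1 - {0}) x * ?F x) = ballint ?F"
    unfolding ballint_def
    by (rule integral_cong_AE)
       (auto intro!: AE_I[where N = "{0}"] borel_measurable_times borel_measurable_indicator simp: indicator_def split: if_splits)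
  finally have 1: "(LINT x|surface_measure. f x) = real DIM('a) * ballint ?F" .
  have "compact (f ` cball 0 1)"
    by (intro compact_continuous_image rpf_continuous f compact_cball)
  then obtain C where C: "\<And>x. x \<in> cball 0 1 \<Longrightarrow> \<bar>f x\<bar> \<le> C"
    by (fastforce simp: bounded_iff dest!: compact_imp_bounded)
  have FC: "\<bar>?F x\<bar> \<le> C" for x
    by (rule C) (cases "x = 0"; simp)
  have e1: "ballint f = ballint ?F - ballint (\<lambda>x. ?F x * (1 - norm x ^ j))"
  proof -
    have int: "integrable lborel (\<lambda>x. indicat_real (ball 0 1) x * g x)"
      if g: "g \<in> borel_measurable borel" and C: "\<And>x. x \<in> cball 0 1 \<Longrightarrow> \<bar>g x\<bar> \<le> C" for g :: "'a \<Rightarrow> real"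
    proof (rule integrable_bounded_support[of _ "ball 0 1" C])
      show "(\<lambda>x. indicat_real (ball 0 1) x * g x) \<in> borel_measurable borel"
        by (intro borel_measurable_times[OF _ g] borel_measurable_indicator) simp
    qed (simp_all add: C)
    have "integrable lborel (\<lambda>x. indicat_real (ball 0 1) x * ?F x)"
      by (rule int[OF Fb FC])
    moreover have "integrable lborel (\<lambda>x. indicat_real (ball 0 1) x * f x)"
      by (rule int[OF fb C])
    moreover have "indicat_real (ball 0 1) x * (?F x * (1 - norm x ^ j))
        = indicat_real (ball 0 1) x * ?F x - indicat_real (ball 0 1) x * f x" for x
    proof -
      have "?F x * (1 - norm x ^ j) = ?F x - f x"
        using Fh[of x] by (simp add: right_diff_distrib)
      then show ?thesis by (simp add: right_diff_distrib)
    qed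
    ultimately show ?thesis
      by (simp add: ballint_def)
  qed
  have e2: "ballint (\<lambda>x. ?F x * (1 - norm x ^ j)) = real j / real (DIM('a) + j) * ballint ?F"
  \<comment> \<open>\<open>ballint_radial\<close> speaks of positive exponents; for
    \<open>j = 0\<close> both sides vanish.\<close>
  proof (cases j)
    case 0
    then show ?thesis by (simp add: ballint_def)
  next
    case (Suc j')
    have "?F (r *\<^sub>R x) = r ^ 0 * ?F x" if "r > 0" for r x
    proof -
      have "(r *\<^sub>R x) /\<^sub>R norm (r *\<^sub>R x) = x /\<^sub>R norm x"
        using that by simp
      then show ?thesis by (simp only: power_0 mult_1)
    qed
    from ballint_radial[OF Fb FC this, of j'] show ?thesis unfolding Suc add_0_right .
  qed
  have alg: "(D + J) * a = D * c" if "a = c - J / (D + J) * c" "D > 0" "J \<ge> 0" for a c D J :: real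
    using that by (simp add: field_simps)
  have "real (DIM('a) + j) * ballint f = real DIM('a) * ballint ?F"
    using alg[of "ballint f" "ballint ?F" "real j" "real DIM('a)"] e1 e2 unfolding of_nat_add by simp
  then show ?thesis using 1 by simp
qed

lemma harmonic_orthogonal:
  fixes p q :: "'a::euclidean_space \<Rightarrow> real"
  assumes p: "p \<in> homogeneous_harmonic_polynomials l" and q: "q \<in> homogeneous_harmonic_polynomials k"
    and "l \<noteq> k"
  shows "(LINT x|surface_measure. p x * q x) = 0"
proof -
  have p': "real_polynomial_function p" "\<And>t x. p (t *\<^sub>R x) = t ^ l * p x"
    and q': "real_polynomial_function q" "\<And>t x. q (t *\<^sub>R x) = t ^ k * q x"
    using p q by (auto simp: homogeneous_harmonic_polynomials_def)
  have "(LINT x|surface_measure. p x * q x) = real (DIM('a) + (l + k)) * ballint (\<lambda>x. p x * q x)"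
    by (rule surface_integral_homogeneous[OF rpf_mult[OF p'(1) q'(1)]]) (simp add: p'(2) q'(2) power_add)
  then show ?thesis
    by (simp only: ballint_harmonic_orthogonal[OF assms] mult_zero_right)
qed

text \<open>The cone over the slab contains an explicit box whose edge along \<open>b\<close> has
  length proportional to \<delta> and whose other edges are fixed. Its volume bounds the measure
  from below linearly in \<delta>.\<close>

lemma surface_slab:
  fixes b :: "'a::euclidean_space"
  assumes b: "b \<in> Basis" and d: "DIM('a) \<ge> 2"
  obtains c where "c > 0"
    "\<And>\<delta>. 0 < \<delta> \<Longrightarrow> \<delta> \<le> 1 \<Longrightarrow> c * \<delta> \<le> measure surface_measure {x \<in> sphere 0 1. \<bar>x \<bullet> b\<bar> \<le> \<delta>}"
proof
  \<comment> \<open>All coordinates in the box are at most \<open>2 a\<close> in absolute value, so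
    this \<open>a\<close> bounds the l1 norm by 1/2 and keeps the box inside the unit ball.\<close>
  define a where "a = 1 / (4 * real DIM('a))"
  have a: "a > 0" using d by (simp add: a_def)
  show "real DIM('a) * 2 * a ^ DIM('a) > 0" using a d by simp
  fix \<delta> :: real assume \<delta>: "0 < \<delta>" "\<delta> \<le> 1"
  define l where "l = (\<Sum>i\<in>Basis. (if i = b then - \<delta> * a else a) *\<^sub>R i)"
  define u where "u = (\<Sum>i\<in>Basis. (if i = b then \<delta> * a else 2 * a) *\<^sub>R i)"
  have li: "l \<bullet> i = (if i = b then - \<delta> * a else a)" and ui: "u \<bullet> i = (if i = b then \<delta> * a else 2 * a)"
    if "i \<in> Basis" for i
    using that by (simp_all add: l_def u_def)
  have "(Basis :: 'a set) \<noteq> {b}"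
  proof
    assume "(Basis :: 'a set) = {b}"
    then have "card (Basis :: 'a set) = card {b}" by (rule arg_cong)
    then show False using d by simp
  qed
  \<comment> \<open>In a second direction \<open>e\<close> the coordinate is at least
    \<open>a\<close>, which keeps the box away from 0 and gives \<open>\<bar>x \<bullet> b\<bar>
    \<le> \<delta> * a \<le> \<delta> * norm x\<close>.\<close>
  then obtain e where e: "e \<in> Basis" "e \<noteq> b" using b by blast
  let ?A = "{x \<in> sphere 0 1. \<bar>x \<bullet> b\<bar> \<le> \<delta>}"
  have A: "?A \<in> sets surface_measure"
  proof -
    have "?A = sphere 0 1 \<inter> {x. \<bar>x \<bullet> b\<bar> \<le> \<delta>}" by auto
    moreover have "closed {x. \<bar>x \<bullet> b\<bar> \<le> \<delta>}"
      by (intro closed_Collect_le continuous_intros)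
    ultimately show ?thesis
      by (auto simp: sets_surface_measure sets_restrict_space)
  qed
  have sub: "cbox l u \<subseteq> {x \<in> ball 0 1 - {0}. x /\<^sub>R norm x \<in> ?A}"
  proof
    fix x assume "x \<in> cbox l u"
    then have x: "\<And>i. i \<in> Basis \<Longrightarrow> l \<bullet> i \<le> x \<bullet> i \<and> x \<bullet> i \<le> u \<bullet> i"
      by (auto simp: mem_box)
    have xb: "\<bar>x \<bullet> b\<bar> \<le> \<delta> * a" using x[OF b] by (simp add: li ui b abs_le_iff)
    have xe: "a \<le> x \<bullet> e" using x[OF e(1)] e by (simp add: li)
    have nx: "a \<le> norm x" using xe Basis_le_norm[OF e(1), of x] by linarith
    have "\<bar>x \<bullet> i\<bar> \<le> 2 * a" if "i \<in> Basis" for i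
    proof (cases "i = b")
      case True
      moreover have "\<delta> * a \<le> 1 * a" using \<delta> a by (intro mult_right_mono) auto
      ultimately show ?thesis using xb a unfolding True by linarith
    next
      case False
      then show ?thesis using x[OF that] a that by (simp add: li ui)
    qed
    then have "(\<Sum>i\<in>Basis. \<bar>x \<bullet> i\<bar>) \<le> real DIM('a) * (2 * a)"
      by (intro sum_bounded_above)
    then have "norm x < 1"
      using norm_le_l1[of x] d by (simp add: a_def)
    moreover have "\<bar>x \<bullet> b\<bar> / norm x \<le> \<delta>"
    proof -
      have "\<bar>x \<bullet> b\<bar> \<le> \<delta> * norm x"
        using xb mult_left_mono[OF nx, of \<delta>] \<delta> by linarith
      moreover have "norm x > 0" using nx a by linarith
      ultimately show ?thesis by (simp add: pos_divide_le_eq)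
    qed
    moreover have "x \<noteq> 0" using nx a by auto
    moreover have "\<bar>(x /\<^sub>R norm x) \<bullet> b\<bar> = \<bar>x \<bullet> b\<bar> / norm x"
      by (simp add: abs_mult divide_inverse_commute)
    ultimately show "x \<in> {x \<in> ball 0 1 - {0}. x /\<^sub>R norm x \<in> ?A}"
      by simp
  qed
  have meas: "{x \<in> ball 0 1 - {0}. x /\<^sub>R norm x \<in> ?A} \<in> sets lborel"
  proof -
    have "(\<lambda>x. x /\<^sub>R norm x) -` ?A \<inter> space (restrict_space lborel (ball 0 1 - {0}))
        \<in> sets (restrict_space lborel (ball (0::'a) 1 - {0}))"
      using A by (intro measurable_sets[OF radial_projection_measurable]) (simp add: sets_surface_measure)
    moreover have "(\<lambda>x. x /\<^sub>R norm x) -` ?A \<inter> space (restrict_space lborel (ball 0 1 - {0}))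
       = {x \<in> ball 0 1 - {0}. x /\<^sub>R norm x \<in> ?A}"
      by (auto simp: space_restrict_space)
    ultimately show ?thesis
      by (auto simp: sets_restrict_space_iff)
  qed
  have "ennreal (2 * \<delta> * a ^ DIM('a)) = emeasure lborel (cbox l u)"
  proof -
    have "(\<Prod>i\<in>Basis. (u - l) \<bullet> i) = (\<Prod>i\<in>Basis. a * (if i = b then 2 * \<delta> else 1))"
      by (rule prod.cong) (auto simp: li ui inner_diff_left)
    also have "\<dots> = a ^ DIM('a) * (2 * \<delta>)"
      using b by (simp add: prod.distrib)
    finally show ?thesis
      by (subst emeasure_lborel_cbox) (use a \<delta> in \<open>auto simp: li ui mult_ac\<close>)
  qed
  also have "\<dots> \<le> emeasure lborel {x \<in> ball 0 1 - {0}. x /\<^sub>R norm x \<in> ?A}"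
    by (rule emeasure_mono[OF sub meas])
  finally have "ennreal (real DIM('a)) * ennreal (2 * \<delta> * a ^ DIM('a)) \<le> emeasure surface_measure ?A"
    unfolding emeasure_surface_measure[OF A] by (rule mult_left_mono) simp
  also have "emeasure surface_measure ?A = ennreal (measure surface_measure ?A)"
    by (rule surface_measure.emeasure_eq_measure)
  also have "ennreal (real DIM('a)) * ennreal (2 * \<delta> * a ^ DIM('a)) = ennreal (real DIM('a) * (2 * \<delta> * a ^ DIM('a)))"
    by (rule ennreal_mult[symmetric]) (use a \<delta> in auto)
  finally have "real DIM('a) * (2 * \<delta> * a ^ DIM('a)) \<le> measure surface_measure ?A"
    by (simp only: ennreal_le_iff measure_nonneg)
  then show "real DIM('a) * 2 * a ^ DIM('a) * \<delta> \<le> measure surface_measure ?A"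
    by (simp only: mult_ac)
qed

section \<open>Projections onto spherical harmonics\<close>

lemma homogeneous_harmonicD:
  assumes "p \<in> homogeneous_harmonic_polynomials l"
  shows "real_polynomial_function p" "p (t *\<^sub>R x) = t ^ l * p x" "laplacian p x = 0"
  using assms by (auto simp: homogeneous_harmonic_polynomials_def)

lemma laplacian_add:
  assumes "real_polynomial_function p" "real_polynomial_function q"
  shows "laplacian (\<lambda>x. p x + q x) x = laplacian p x + laplacian q x"
  by (simp add: laplacian_rpf assms rpf_add rpf_dird dird_add sum.distrib)

lemma laplacian_cmult:
  assumes "real_polynomial_function p"
  shows "laplacian (\<lambda>x. c * p x) x = c * laplacian p x"
  by (simp add: laplacian_rpf assms rpf_mult rpf_const rpf_dird dird_cmult sum_distrib_left)

lemma homogeneous_harmonic_add: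
  assumes "p \<in> homogeneous_harmonic_polynomials l" "q \<in> homogeneous_harmonic_polynomials l"
  shows "(\<lambda>x. p x + q x) \<in> homogeneous_harmonic_polynomials l"
  using homogeneous_harmonicD[OF assms(1)] homogeneous_harmonicD[OF assms(2)]
  unfolding homogeneous_harmonic_polynomials_def by (simp add: rpf_add laplacian_add distrib_left)

lemma homogeneous_harmonic_cmult:
  assumes "p \<in> homogeneous_harmonic_polynomials l"
  shows "(\<lambda>x. c * p x) \<in> homogeneous_harmonic_polynomials l"
  using homogeneous_harmonicD[OF assms]
  unfolding homogeneous_harmonic_polynomials_def by (simp add: rpf_mult rpf_const laplacian_cmult)

lemma homogeneous_harmonic_diff:
  assumes "p \<in> homogeneous_harmonic_polynomials l" "q \<in> homogeneous_harmonic_polynomials l"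
  shows "(\<lambda>x. p x - q x) \<in> homogeneous_harmonic_polynomials l"
  using homogeneous_harmonic_add[OF assms(1) homogeneous_harmonic_cmult[OF assms(2), of "-1"]] by simp

lemma homogeneous_harmonic_zero: "(\<lambda>x. 0) \<in> homogeneous_harmonic_polynomials l"
  unfolding homogeneous_harmonic_polynomials_def by (simp add: rpf_const laplacian_rpf)

lemma homogeneous_harmonic_const: "(\<lambda>x. c) \<in> homogeneous_harmonic_polynomials 0"
  unfolding homogeneous_harmonic_polynomials_def by (simp add: rpf_const laplacian_rpf)

lemma surface_integral_cong:
  assumes "\<And>x. x \<in> sphere 0 1 \<Longrightarrow> f x = g x"
  shows "(LINT x|surface_measure. f x) = (LINT x|surface_measure. (g x :: real))"
  by (rule Bochner_Integration.integral_cong) (use assms in auto)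

lemma continuous_L2_sphere:
  assumes "continuous_on (sphere 0 1) u"
  shows "u \<in> L2_sphere"
  unfolding L2_sphere_def
  using continuous_borel_measurable_surface[OF assms]
    continuous_integrable_surface[OF continuous_on_power[OF assms, of 2]] by simp

lemma integrable_L2_mult:
  assumes u: "u \<in> L2_sphere" and f: "f \<in> L2_sphere"
  shows "integrable surface_measure (\<lambda>x. u x * f x)"
proof (rule Bochner_Integration.integrable_bound)
  show "integrable surface_measure (\<lambda>x. (u x)\<^sup>2 + (f x)\<^sup>2)"
    using u f by (auto simp: L2_sphere_def)
  show "(\<lambda>x. u x * f x) \<in> borel_measurable surface_measure"
    using u f by (auto simp: L2_sphere_def)
  show "AE x in surface_measure. norm (u x * f x) \<le> norm ((u x)\<^sup>2 + (f x)\<^sup>2)"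
  proof (rule AE_I2)
    fix x
    have "2 * \<bar>u x\<bar> * \<bar>f x\<bar> \<le> \<bar>u x\<bar>\<^sup>2 + \<bar>f x\<bar>\<^sup>2"
      by (rule sum_squares_bound)
    moreover have "0 \<le> \<bar>u x\<bar> * \<bar>f x\<bar>" by simp
    ultimately have "\<bar>u x\<bar> * \<bar>f x\<bar> \<le> \<bar>u x\<bar>\<^sup>2 + \<bar>f x\<bar>\<^sup>2" by linarith
    then show "norm (u x * f x) \<le> norm ((u x)\<^sup>2 + (f x)\<^sup>2)"
      by (simp add: abs_mult)
  qed
qed

lemma rpf_L2_sphere: "real_polynomial_function p \<Longrightarrow> p \<in> L2_sphere"
  by (intro continuous_L2_sphere rpf_continuous)

lemma L2_sphere_cadd:
  assumes u: "u \<in> L2_sphere" and f: "f \<in> L2_sphere"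
  shows "(\<lambda>x. u x + c * f x) \<in> L2_sphere"
proof -
  have "(\<lambda>x. (u x + c * f x)\<^sup>2) = (\<lambda>x. (u x)\<^sup>2 + 2 * c * (u x * f x) + c\<^sup>2 * (f x)\<^sup>2)"
    by (auto simp: power2_eq_square algebra_simps)
  then show ?thesis
    using u f integrable_L2_mult[OF u f] by (auto simp: L2_sphere_def)
qed

text \<open>The way to evaluate the definite description. Two candidates differ by a harmonic
  \<open>q\<close> of the same degree; testing both orthogonality relations against \<open>q\<close>
  and subtracting yields that the integral of \<open>q^2\<close> is zero, so \<open>q\<close>
  vanishes on the sphere.\<close>

lemma harmonic_projection_eqI:
  fixes u :: "'a::euclidean_space \<Rightarrow> real"
  assumes u: "u \<in> L2_sphere" and p: "p \<in> homogeneous_harmonic_polynomials l"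
    and orth: "\<And>q. q \<in> homogeneous_harmonic_polynomials l \<Longrightarrow> (LINT x|surface_measure. (u x - p x) * q x) = 0"
  shows "harmonic_projection l u = restrict p (sphere 0 1)"
  unfolding harmonic_projection_def
proof (rule the_equality)
  have cong: "(LINT x|surface_measure. (u x - restrict p' (sphere 0 1) x) * restrict q (sphere 0 1) x)
      = (LINT x|surface_measure. (u x - p' x) * q x)" for p' q
    by (rule surface_integral_cong) simp
  show "restrict p (sphere 0 1) \<in> spherical_harmonics l \<and>
    (\<forall>Z\<in>spherical_harmonics l. (LINT x|surface_measure. (u x - restrict p (sphere 0 1) x) * Z x) = 0)"
    unfolding spherical_harmonics_def using p orth by (simp only: ball_simps cong) blast
  fix Y assume Y: "Y \<in> spherical_harmonics l \<and>
    (\<forall>Z\<in>spherical_harmonics l. (LINT x|surface_measure. (u x - Y x) * Z x) = 0)"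
  then obtain p' where p': "p' \<in> homogeneous_harmonic_polynomials l" and Yp: "Y = restrict p' (sphere 0 1)"
    by (auto simp: spherical_harmonics_def)
  define q where "q = (\<lambda>x. p' x - p x)"
  have q: "q \<in> homogeneous_harmonic_polynomials l"
    unfolding q_def by (rule homogeneous_harmonic_diff[OF p' p])
  note rpf = homogeneous_harmonicD(1)
  have 1: "(LINT x|surface_measure. (u x - p x) * q x) = 0" by (rule orth[OF q])
  have 2: "(LINT x|surface_measure. (u x - p' x) * q x) = 0"
  proof -
    have "restrict q (sphere 0 1) \<in> spherical_harmonics l"
      using q by (auto simp: spherical_harmonics_def)
    then have "(LINT x|surface_measure. (u x - Y x) * restrict q (sphere 0 1) x) = 0"
      using Y by blast
    then show ?thesis unfolding Yp cong .
  qed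
  have int: "integrable surface_measure (\<lambda>x. (u x - r x) * q x)" if r: "r \<in> homogeneous_harmonic_polynomials l" for r
    using integrable_L2_mult[OF L2_sphere_cadd[OF u rpf_L2_sphere[OF rpf[OF r]], of "-1"] rpf_L2_sphere[OF rpf[OF q]]]
    by simp
  have "(\<lambda>x. (q x)\<^sup>2) = (\<lambda>x. (u x - p x) * q x - (u x - p' x) * q x)"
    by (auto simp: q_def power2_eq_square algebra_simps)
  then have "(LINT x|surface_measure. (q x)\<^sup>2) = 0"
    using 1 2 by (simp add: Bochner_Integration.integral_diff[OF int[OF p] int[OF p']])
  then have "(q x)\<^sup>2 = 0" if "x \<in> sphere 0 1" for x
    using that by (intro surface_integral_zero[where f = "\<lambda>x. (q x)\<^sup>2"])
      (auto intro!: continuous_intros rpf_continuous rpf[OF q])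
  then show "Y = restrict p (sphere 0 1)"
    unfolding Yp by (intro restrict_ext) (auto simp: q_def)
qed

lemma L2_sphere_norm_restrict: "(L2_sphere_norm (restrict p (sphere 0 1)))\<^sup>2 = (LINT x|surface_measure. (p x)\<^sup>2)"
proof -
  have "(LINT x|surface_measure. (restrict p (sphere 0 1) x)\<^sup>2) = (LINT x|surface_measure. (p x)\<^sup>2)"
    by (rule surface_integral_cong) simp
  then show ?thesis by (simp add: L2_sphere_norm_def)
qed

lemma harmonic_projection_sum:
  fixes u :: "'a::euclidean_space \<Rightarrow> real"
  assumes u: "\<And>x. x \<in> sphere 0 1 \<Longrightarrow> u x = (\<Sum>l\<le>N. p l x)"
    and p: "\<And>l. p l \<in> homogeneous_harmonic_polynomials l"
  shows "harmonic_projection l u = restrict (if l \<le> N then p l else (\<lambda>x. 0)) (sphere 0 1)"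
proof (rule harmonic_projection_eqI)
  note rpf = homogeneous_harmonicD(1)[OF p]
  have "continuous_on (sphere 0 1) (\<lambda>x. \<Sum>l\<le>N. p l x)"
    by (intro continuous_intros rpf_continuous rpf)
  then have "continuous_on (sphere 0 1) u"
    by (rule continuous_on_eq) (simp add: u)
  then show "u \<in> L2_sphere" by (rule continuous_L2_sphere)
  let ?P = "if l \<le> N then p l else (\<lambda>x. 0)"
  show P: "?P \<in> homogeneous_harmonic_polynomials l"
    by (simp add: p homogeneous_harmonic_zero)
  fix q :: "'a \<Rightarrow> real" assume q: "q \<in> homogeneous_harmonic_polynomials l"
  have int: "integrable surface_measure (\<lambda>x. p k x * q x)" for k
    by (intro integrable_L2_mult rpf_L2_sphere rpf homogeneous_harmonicD(1)[OF q])
  have "(LINT x|surface_measure. (u x - ?P x) * q x) = (LINT x|surface_measure. (\<Sum>k\<in>{..N} - {l}. p k x * q x))"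
  proof (rule surface_integral_cong)
    fix x :: 'a assume x: "x \<in> sphere 0 1"
    have "(\<Sum>k\<le>N. p k x) - ?P x = (\<Sum>k\<in>{..N} - {l}. p k x)"
      by (simp add: sum_diff1)
    then show "(u x - ?P x) * q x = (\<Sum>k\<in>{..N} - {l}. p k x * q x)"
      by (simp add: u[OF x] sum_distrib_right)
  qed
  also have "\<dots> = (\<Sum>k\<in>{..N} - {l}. LINT x|surface_measure. p k x * q x)"
    by (rule Bochner_Integration.integral_sum) (rule int)
  also have "\<dots> = 0"
    by (rule sum.neutral) (use harmonic_orthogonal[OF p q] in auto)
  finally show "(LINT x|surface_measure. (u x - ?P x) * q x) = 0" .
qed

text \<open>All explicit test functions below are finite sums of harmonics. For these the
  projections are known by orthogonality, and both series have only finitely many nonzero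
  terms.\<close>

lemma harmonic_sum_sobolev:
  fixes u :: "'a::euclidean_space \<Rightarrow> real"
  assumes u: "\<And>x. x \<in> sphere 0 1 \<Longrightarrow> u x = (\<Sum>l\<le>N. p l x)"
    and p: "\<And>l. p l \<in> homogeneous_harmonic_polynomials l"
  shows "u \<in> sobolev_sphere n s" "continuous_on (sphere 0 1) u"
    and "a_form n s u = (\<Sum>l\<le>N. alpha n s l * (LINT x|surface_measure. (p l x)\<^sup>2))"
proof -
  have norm: "(L2_sphere_norm (harmonic_projection l u))\<^sup>2
      = (if l \<le> N then LINT x|surface_measure. (p l x)\<^sup>2 else 0)" for l
    by (cases "l \<le> N") (simp_all only: harmonic_projection_sum[OF u p] L2_sphere_norm_restrict, simp_all)
  have "continuous_on (sphere 0 1) (\<lambda>x. \<Sum>l\<le>N. p l x)"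
    by (intro continuous_intros rpf_continuous homogeneous_harmonicD(1)[OF p])
  then show c: "continuous_on (sphere 0 1) u"
    by (rule continuous_on_eq) (simp add: u)
  show "u \<in> sobolev_sphere n s"
    unfolding sobolev_sphere_def using continuous_L2_sphere[OF c]
    by (auto simp: norm split: if_splits intro!: summable_finite[of "{..N}"])
  show "a_form n s u = (\<Sum>l\<le>N. alpha n s l * (LINT x|surface_measure. (p l x)\<^sup>2))"
    unfolding a_form_def norm by (subst suminf_finite[of "{..N}"]) auto
qed

text \<open>Adding \<open>c * q\<close> affects the component of degree \<open>m\<close> only. As
  \<open>q\<close> is orthogonal to \<open>u\<close>, it is orthogonal to the component
  \<open>p\<close> of \<open>u\<close> too, so no cross term arises.\<close>

lemma harmonic_perturbation:
  fixes u :: "'a::euclidean_space \<Rightarrow> real"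
  assumes u: "u \<in> sobolev_sphere n s" and sm: "summable (\<lambda>l. alpha n s l * (L2_sphere_norm (harmonic_projection l u))\<^sup>2)"
    and p: "p \<in> homogeneous_harmonic_polynomials m"
    and pu: "\<And>q. q \<in> homogeneous_harmonic_polynomials m \<Longrightarrow> (LINT x|surface_measure. (u x - p x) * q x) = 0"
    and q: "q \<in> homogeneous_harmonic_polynomials m" and uq: "(LINT x|surface_measure. u x * q x) = 0"
  shows "(\<lambda>x. u x + c * q x) \<in> sobolev_sphere n s"
    and "a_form n s (\<lambda>x. u x + c * q x) = a_form n s u + alpha n s m * (c\<^sup>2 * (LINT x|surface_measure. (q x)\<^sup>2))"
proof -
  have uL: "u \<in> L2_sphere" using u by (simp add: sobolev_sphere_def)
  note rpf = homogeneous_harmonicD(1)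
  have qL: "q \<in> L2_sphere" and pL: "p \<in> L2_sphere" by (intro rpf_L2_sphere rpf[OF q] rpf[OF p])+
  let ?v = "\<lambda>x. u x + c * q x"
  have vL: "?v \<in> L2_sphere" by (rule L2_sphere_cadd[OF uL qL])
  have Pm: "harmonic_projection m u = restrict p (sphere 0 1)"
    by (rule harmonic_projection_eqI[OF uL p pu])
  have Pmv: "harmonic_projection m ?v = restrict (\<lambda>x. p x + c * q x) (sphere 0 1)"
    by (rule harmonic_projection_eqI[OF vL])
       (auto intro!: homogeneous_harmonic_add p homogeneous_harmonic_cmult q simp: pu)
  have Pl: "harmonic_projection l ?v = harmonic_projection l u" if "l \<noteq> m" for l
  proof -
    have "(LINT x|surface_measure. (?v x - Y x) * Z x) = (LINT x|surface_measure. (u x - Y x) * Z x)"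
      if YZ: "Y \<in> spherical_harmonics l" "Z \<in> spherical_harmonics l" for Y Z :: "'a \<Rightarrow> real"
    proof -
      obtain y z where y: "y \<in> homogeneous_harmonic_polynomials l" "Y = restrict y (sphere 0 1)"
        and z: "z \<in> homogeneous_harmonic_polynomials l" "Z = restrict z (sphere 0 1)"
        using YZ by (auto simp: spherical_harmonics_def)
      have zL: "z \<in> L2_sphere" by (rule rpf_L2_sphere[OF rpf[OF z(1)]])
      have "(LINT x|surface_measure. (?v x - Y x) * Z x)
          = (LINT x|surface_measure. (u x + (-1) * y x) * z x + c * (q x * z x))"
        by (rule surface_integral_cong) (simp add: y(2) z(2) algebra_simps)
      also have "\<dots> = (LINT x|surface_measure. (u x + (-1) * y x) * z x) + c * (LINT x|surface_measure. q x * z x)"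
        using integrable_L2_mult[OF L2_sphere_cadd[OF uL rpf_L2_sphere[OF rpf[OF y(1)]], of "-1"] zL]
          integrable_L2_mult[OF qL zL]
        by (subst Bochner_Integration.integral_add) auto
      also have "(LINT x|surface_measure. q x * z x) = 0"
        by (rule harmonic_orthogonal[OF q z(1)]) (use \<open>l \<noteq> m\<close> in simp)
      also have "(LINT x|surface_measure. (u x + (-1) * y x) * z x) = (LINT x|surface_measure. (u x - Y x) * Z x)"
        by (rule surface_integral_cong) (simp add: y(2) z(2))
      finally show ?thesis by simp
    qed
    \<comment> \<open>The predicates under the definite descriptions coincide, so the two
      projections agree without any appeal to their existence in degree \<open>l\<close>.\<close>
    then have "(\<lambda>Y. Y \<in> spherical_harmonics l \<and> (\<forall>Z\<in>spherical_harmonics l. (LINT x|surface_measure. (?v x - Y x) * Z x) = 0))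
       = (\<lambda>Y. Y \<in> spherical_harmonics l \<and> (\<forall>Z\<in>spherical_harmonics l. (LINT x|surface_measure. (u x - Y x) * Z x) = 0))"
      by (intro ext) auto
    then show ?thesis unfolding harmonic_projection_def by simp
  qed
  have pq: "(LINT x|surface_measure. p x * q x) = 0"
  proof -
    have "(LINT x|surface_measure. (u x - p x) * q x)
        = (LINT x|surface_measure. u x * q x) - (LINT x|surface_measure. p x * q x)"
      using integrable_L2_mult[OF uL qL] integrable_L2_mult[OF pL qL]
      by (simp add: left_diff_distrib)
    then show ?thesis using pu[OF q] uq by simp
  qed
  let ?Q = "LINT x|surface_measure. (q x)\<^sup>2"
  have nm: "(L2_sphere_norm (harmonic_projection m ?v))\<^sup>2 = (L2_sphere_norm (harmonic_projection m u))\<^sup>2 + c\<^sup>2 * ?Q"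
  proof -
    have "(\<lambda>x. (p x + c * q x)\<^sup>2) = (\<lambda>x. (p x)\<^sup>2 + 2 * c * (p x * q x) + c\<^sup>2 * (q x)\<^sup>2)"
      by (auto simp: power2_eq_square algebra_simps)
    then show ?thesis
      unfolding Pm Pmv L2_sphere_norm_restrict
      using integrable_L2_mult[OF pL qL] pL qL pq by (simp add: L2_sphere_def)
  qed
  \<comment> \<open>Stated for arbitrary weights \<open>w\<close>, since it serves both the Sobolev
    series and the series of \<open>a_form\<close>.\<close>
  have split: "(\<lambda>l. w l * (L2_sphere_norm (harmonic_projection l ?v))\<^sup>2)
      = (\<lambda>l. w l * (L2_sphere_norm (harmonic_projection l u))\<^sup>2 + (if l = m then w l * (c\<^sup>2 * ?Q) else 0))"
    for w :: "nat \<Rightarrow> real"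
    by (intro ext) (auto simp: nm Pl distrib_left)
  show "?v \<in> sobolev_sphere n s"
    using u vL unfolding sobolev_sphere_def
    by (auto simp: split intro!: summable_add summable_single)
  have "(\<lambda>l. if l = m then alpha n s l * (c\<^sup>2 * ?Q) else 0) sums (alpha n s m * (c\<^sup>2 * ?Q))"
    by (rule sums_single)
  from sums_unique[OF sums_add[OF summable_sums[OF sm] this]]
  show "a_form n s ?v = a_form n s u + alpha n s m * (c\<^sup>2 * ?Q)"
    unfolding a_form_def split by simp
qed

section \<open>The weights of the quadratic form\<close>

text \<open>The functional equation of Gamma in numerator and denominator; the excluded values of
  \<open>s\<close> are those for which the lower argument could hit a pole.\<close>

lemma alpha_Suc:
  assumes "\<forall>k::nat. s \<noteq> real n / 2 + real k" "s > real n / 2"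
  shows "alpha n s (Suc l) = alpha n s l * ((real l + real n / 2 + s) / (real l + real n / 2 - s))"
proof -
  let ?a = "real l + real n / 2 + s" and ?b = "real l + real n / 2 - s"
  have "?a > 0" using assms(2) by (smt (verit) of_nat_0_le_iff divide_nonneg_pos)
  then have 1: "Gamma (?a + 1) = ?a * Gamma ?a"
    by (intro Gamma_plus1) (auto elim!: nonpos_Ints_cases)
  have "?b \<notin> \<int>\<^sub>\<le>\<^sub>0"
  proof
    assume "?b \<in> \<int>\<^sub>\<le>\<^sub>0"
    then obtain k where "?b = - real k" by (elim nonpos_Ints_cases') auto
    then have "s = real n / 2 + real (l + k)" by simp
    then show False using assms(1) by blast
  qed
  then have 2: "Gamma (?b + 1) = ?b * Gamma ?b" by (rule Gamma_plus1)
  show ?thesis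
  proof -
    have "real (Suc l) + real n / 2 + s = ?a + 1" "real (Suc l) + real n / 2 - s = ?b + 1"
      by simp_all
    then show ?thesis
      unfolding alpha_def by (simp only: 1 2 times_divide_times_eq mult.commute)
  qed
qed

lemma no_nat_between:
  assumes m: "real n / 2 + real m < s" "s < real n / 2 + real m + 1"
  shows "\<forall>k::nat. s \<noteq> real n / 2 + real k"
proof (intro allI notI)
  fix k :: nat assume "s = real n / 2 + real k"
  then have "real m < real k" "real k < real (Suc m)" using m by auto
  then have "m < k" "k < Suc m" by (simp_all only: of_nat_less_iff)
  then show False by simp
qed

text \<open>Descending induction. At \<open>l = m\<close> the lower argument lies between -1 and 0,
  where Gamma is negative; each step down multiplies by the negative quotient of
  \<open>l + n/2 - s\<close> and \<open>l + n/2 + s\<close>.\<close>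

lemma alpha_sign:
  assumes m: "real n / 2 + real m < s" "s < real n / 2 + real m + 1" and l: "l \<le> m"
  shows "(-1) ^ (m - l) * alpha n s l < 0"
  using l
proof (induction rule: inc_induct)
  case base
  let ?b = "real m + real n / 2 - s"
  have "Gamma (?b + 1) = ?b * Gamma ?b"
  proof (rule Gamma_plus1)
    show "?b \<notin> \<int>\<^sub>\<le>\<^sub>0"
      using m by (auto elim!: nonpos_Ints_cases) (smt (verit, best) of_int_less_iff of_int_0 of_int_minus of_int_1)
  qed
  moreover have "Gamma (?b + 1) > 0" using m by (intro Gamma_real_pos) simp
  ultimately have "Gamma ?b < 0" using m by (simp add: zero_less_mult_iff)
  moreover have "Gamma (real m + real n / 2 + s) > 0"
    using m by (intro Gamma_real_pos) (smt (verit) of_nat_0_le_iff divide_nonneg_pos)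
  ultimately show ?case by (simp add: alpha_def divide_pos_neg)
next
  case (step l)
  have nz: "\<forall>k::nat. s \<noteq> real n / 2 + real k"
    by (rule no_nat_between[OF m])
  let ?a = "real l + real n / 2 + s" and ?b = "real l + real n / 2 - s"
  have ab: "?a > 0" "?b < 0" using m step.hyps by auto
  have "alpha n s (Suc l) = alpha n s l * (?a / ?b)"
    by (rule alpha_Suc[OF nz]) (use m in auto)
  then have "alpha n s l = alpha n s (Suc l) * (?b / ?a)"
    using ab by simp
  moreover have "(-1) ^ (m - l) = - ((-1) ^ (m - Suc l) :: real)"
    using step.hyps by (simp add: Suc_diff_Suc[symmetric])
  moreover have gen: "- y * (x * (b / a)) = (y * x) * (- b / a)" for y x a b :: real
    by simp
  ultimately have "(-1) ^ (m - l) * alpha n s l = ((-1) ^ (m - Suc l) * alpha n s (Suc l)) * (- ?b / ?a)"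
    by (simp only: gen)
  also have "\<dots> < 0"
  proof (rule mult_neg_pos[OF step.IH])
    show "- ?b / ?a > 0" using ab by (intro divide_pos_pos) auto
  qed
  finally show ?case .
qed

lemma alpha_abs_Suc:
  assumes m: "real n / 2 + real m < s" "s < real n / 2 + real m + 1" and l: "l < m"
  shows "\<bar>alpha n s (Suc l)\<bar> = \<bar>alpha n s l\<bar> * ((real l + real n / 2 + s) / (s - real n / 2 - real l))"
proof -
  have nz: "\<forall>k::nat. s \<noteq> real n / 2 + real k"
    by (rule no_nat_between[OF m])
  have "real l + real n / 2 + s > 0" "s - real n / 2 - real l > 0" using m l by auto
  then have "\<bar>(real l + real n / 2 + s) / (real l + real n / 2 - s)\<bar> = (real l + real n / 2 + s) / (s - real n / 2 - real l)"
    by (simp add: abs_divide)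
  moreover have "s > real n / 2" using m by linarith
  ultimately show ?thesis
    by (simp only: alpha_Suc[OF nz] abs_mult)
qed

text \<open>\<open>alpha n s l / alpha n s 0\<close> is a quotient of Pochhammer symbols. Up to the
  power \<open>k powr (2 * s)\<close> it is a quotient of two convergent
  \<open>rGamma_series\<close>, hence bounded.\<close>

lemma alpha_bound:
  assumes nz: "\<forall>k::nat. s \<noteq> real n / 2 + real k" and s: "s > real n / 2" and n: "n \<ge> 1"
  obtains C where "\<And>l. l \<ge> 2 \<Longrightarrow> \<bar>alpha n s l\<bar> \<le> C * (1 + real l * (real l + real n - 1)) powr s"
proof -
  define a where "a = real n / 2 + s"
  define b where "b = real n / 2 - s"
  have a: "a > 0" using s n by (simp add: a_def)
  have an: "a \<notin> \<int>\<^sub>\<le>\<^sub>0" using a by (auto elim!: nonpos_Ints_cases)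
  have bn: "b \<notin> \<int>\<^sub>\<le>\<^sub>0"
  proof
    assume "b \<in> \<int>\<^sub>\<le>\<^sub>0"
    then obtain k where "b = - real k" by (elim nonpos_Ints_cases') auto
    then show False using nz by (auto simp: b_def algebra_simps)
  qed
  have "(\<lambda>l. rGamma_series a l / rGamma_series b l) \<longlonglongrightarrow> rGamma a / rGamma b"
    using bn by (intro tendsto_divide rGamma_series_LIMSEQ) (simp add: rGamma_eq_zero_iff)
  then have "Bseq (\<lambda>l. rGamma_series a l / rGamma_series b l)"
    by (intro convergent_imp_Bseq) (auto simp: convergent_def)
  then obtain K where K: "K > 0" "\<And>l. \<bar>rGamma_series a l / rGamma_series b l\<bar> \<le> K"
    by (auto elim!: BseqE)
  have "\<bar>alpha n s l\<bar> \<le> (\<bar>alpha n s 0\<bar> * K) * (1 + real l * (real l + real n - 1)) powr s" if l: "l \<ge> 2" for l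
  proof -
    \<comment> \<open>\<open>rGamma_series\<close> at index \<open>k\<close> contains the Pochhammer
      symbol of length \<open>k + 1\<close>, hence the shift; \<open>l \<ge> 2\<close> makes
      \<open>k\<close> positive, so that \<open>ln k\<close> and the powers of \<open>k\<close>
      behave as expected.\<close>
    obtain k where k: "l = Suc k" "k \<ge> 1" using l by (cases l) auto
    have 1: "alpha n s l = alpha n s 0 * (pochhammer a l / pochhammer b l)"
      using an bn by (simp add: pochhammer_Gamma alpha_def Gamma_eq_zero_iff a_def b_def add_ac divide_simps)
         (simp add: field_simps)
    have 2: "pochhammer a l / pochhammer b l = rGamma_series a k / rGamma_series b k * real k powr (2 * s)"
    proof -
      have e: "exp (a * ln (real k)) = exp (b * ln (real k)) * real k powr (2 * s)"
        using k by (simp add: powr_def a_def b_def algebra_simps flip: exp_add)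
      have r: "rGamma_series z k = pochhammer z l / (fact k * exp (z * ln (real k)))" for z :: real
        by (simp add: rGamma_series_def k(1))
      have alg: "P / Q = P / (f * (e * w)) / (Q / (f * e)) * w"
        if "f \<noteq> 0" "e \<noteq> 0" "w \<noteq> 0" for P Q f e w :: real
        using that by simp
      show ?thesis
        unfolding r e by (rule alg) (use k(2) in auto)
    qed
    have "real k powr (2 * s) = (real k ^ 2) powr s"
    proof -
      have "(real k)\<^sup>2 = real k powr 2" using k by (simp add: powr_numeral)
      then show ?thesis by (simp only: powr_powr)
    qed
    also have "\<dots> \<le> (1 + real l * (real l + real n - 1)) powr s"
    proof (rule powr_mono2)
      have "real k * real k \<le> real l * (real l + real n - 1)"
        using k n by (intro mult_mono) auto
      then show "(real k)\<^sup>2 \<le> 1 + real l * (real l + real n - 1)" by (simp add: power2_eq_square)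
    qed (use s in auto)
    finally have 3: "real k powr (2 * s) \<le> (1 + real l * (real l + real n - 1)) powr s" .
    have "\<bar>alpha n s l\<bar> = \<bar>alpha n s 0\<bar> * (\<bar>rGamma_series a k / rGamma_series b k\<bar> * real k powr (2 * s))"
      unfolding 1 2 by (simp only: abs_mult abs_of_nonneg powr_ge_zero)
    also have "\<dots> \<le> \<bar>alpha n s 0\<bar> * (K * (1 + real l * (real l + real n - 1)) powr s)"
      by (intro mult_left_mono mult_mono K(2) 3) (use K in auto)
    finally show ?thesis by (simp add: mult_ac)
  qed
  then show ?thesis by (rule that)
qed

text \<open>On the circle the hypothetical minimiser is an arbitrary Sobolev function. Its
  \<open>a_form\<close> is a \<open>suminf\<close>, and summability is what lets
  \<open>harmonic_perturbation\<close> split that series.\<close>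

lemma sobolev_summable_alpha:
  assumes nz: "\<forall>k::nat. s \<noteq> real n / 2 + real k" and s: "s > real n / 2" and n: "n \<ge> 1"
    and u: "u \<in> sobolev_sphere n s"
  shows "summable (\<lambda>l. alpha n s l * (L2_sphere_norm (harmonic_projection l u))\<^sup>2)"
proof -
  obtain C where C: "\<And>l. l \<ge> 2 \<Longrightarrow> \<bar>alpha n s l\<bar> \<le> C * (1 + real l * (real l + real n - 1)) powr s"
    using alpha_bound[OF nz s n] by blast
  show ?thesis
  proof (rule summable_comparison_test')
    show "summable (\<lambda>l. C * ((1 + real l * (real l + real n - 1)) powr s * (L2_sphere_norm (harmonic_projection l u))\<^sup>2))"
      using u by (intro summable_mult) (simp add: sobolev_sphere_def)
    fix l :: nat assume "l \<ge> 2"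
    show "norm (alpha n s l * (L2_sphere_norm (harmonic_projection l u))\<^sup>2)
       \<le> C * ((1 + real l * (real l + real n - 1)) powr s * (L2_sphere_norm (harmonic_projection l u))\<^sup>2)"
      using mult_right_mono[OF C[OF \<open>l \<ge> 2\<close>], of "(L2_sphere_norm (harmonic_projection l u))\<^sup>2"]
      by (simp add: abs_mult mult_ac)
  qed
qed

section \<open>Zonal harmonics\<close>

lemma laplacian_coordinate_mult:
  fixes b :: "'a::euclidean_space"
  assumes p: "real_polynomial_function p" and b: "b \<in> Basis"
  shows "laplacian (\<lambda>x. (x \<bullet> b) * p x) x = (x \<bullet> b) * laplacian p x + 2 * dird b p x"
proof -
  have "dird i (dird i (\<lambda>x. (x \<bullet> b) * p x)) x = (x \<bullet> b) * dird i (dird i p) x + 2 * ((i \<bullet> b) * dird i p x)" for i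
  proof -
    have "dird i (\<lambda>x. (x \<bullet> b) * p x) = (\<lambda>x. (i \<bullet> b) * p x + (x \<bullet> b) * dird i p x)"
      by (simp add: dird_mult[OF rpf_inner p])
    then show ?thesis
      by (simp add: dird_add rpf_mult rpf_const rpf_inner rpf_dird p dird_cmult dird_mult)
  qed
  then show ?thesis
    using dird_euclidean[OF p, of b x]
    by (simp add: laplacian_rpf rpf_mult rpf_inner p sum.distrib sum_distrib_left inner_commute)
qed

lemma rpf_norm_square: "real_polynomial_function (\<lambda>x::'a::euclidean_space. x \<bullet> x)"
proof -
  have "(\<lambda>x::'a. x \<bullet> x) = (\<lambda>x. \<Sum>i\<in>Basis. (x \<bullet> i) * (x \<bullet> i))"
    by (rule ext) (rule euclidean_inner)
  moreover have "real_polynomial_function (\<lambda>x::'a. \<Sum>i\<in>Basis. (x \<bullet> i) * (x \<bullet> i))"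
    by (intro real_polynomial_function_sum rpf_mult rpf_inner) simp
  ultimately show ?thesis by simp
qed

lemma dird_norm_square: "dird v (\<lambda>x::'a::euclidean_space. x \<bullet> x) = (\<lambda>x. 2 * (x \<bullet> v))"
proof
  fix x :: 'a
  have "((\<lambda>x. x \<bullet> x) has_derivative (\<lambda>h. 2 * (x \<bullet> h))) (at x)"
    by (auto intro!: derivative_eq_intros simp: inner_commute)
  then show "dird v (\<lambda>x. x \<bullet> x) x = 2 * (x \<bullet> v)" by (rule dirdI)
qed

text \<open>Leibniz' rule: the Laplacian of \<open>x \<bullet> x\<close> is
  \<open>2 * DIM('a)\<close>, and the mixed term is 4 times the radial derivative, evaluated by
  Euler's identity.\<close>

lemma laplacian_norm_square_mult:
  fixes p :: "'a::euclidean_space \<Rightarrow> real"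
  assumes p: "real_polynomial_function p" and h: "\<And>t x. p (t *\<^sub>R x) = t ^ l * p x"
  shows "laplacian (\<lambda>x. (x \<bullet> x) * p x) x = (2 * real DIM('a) + 4 * real l) * p x + (x \<bullet> x) * laplacian p x"
proof -
  have "dird i (dird i (\<lambda>x. (x \<bullet> x) * p x)) x
      = 2 * (i \<bullet> i) * p x + 4 * ((x \<bullet> i) * dird i p x) + (x \<bullet> x) * dird i (dird i p) x" for i
  proof -
    have "dird i (\<lambda>x. (x \<bullet> x) * p x) = (\<lambda>x. 2 * ((x \<bullet> i) * p x) + (x \<bullet> x) * dird i p x)"
      by (simp add: dird_mult[OF rpf_norm_square p] dird_norm_square mult.assoc)
    then show ?thesis
      by (simp add: dird_add rpf_mult rpf_const rpf_inner rpf_dird p dird_cmult dird_mult rpf_norm_square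
            dird_norm_square)
  qed
  then have "laplacian (\<lambda>x. (x \<bullet> x) * p x) x
      = (\<Sum>i\<in>Basis. 2 * p x + 4 * ((x \<bullet> i) * dird i p x) + (x \<bullet> x) * dird i (dird i p) x)"
    by (simp add: laplacian_rpf rpf_mult rpf_norm_square p)
  also have "\<dots> = 2 * real DIM('a) * p x + 4 * dird x p x + (x \<bullet> x) * laplacian p x"
    by (simp add: sum.distrib laplacian_rpf p dird_euclidean[OF p, of x] flip: sum_distrib_left)
  finally show ?thesis
    by (simp add: dird_homogeneous[OF p h] algebra_simps)
qed

text \<open>The coefficient in the three-term recurrence of the monic Gegenbauer polynomials of
  parameter \<open>(n - 1)/2\<close>. Both factors of the denominator are positive for
  \<open>n \<ge> 2\<close> and \<open>l \<ge> 1\<close>.\<close>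

definition zcoeff :: "nat \<Rightarrow> nat \<Rightarrow> real" where
  "zcoeff n l = real l * (real l + real n - 2) / ((2 * real l + real n - 1) * (2 * real l + real n - 3))"

text \<open>
  Zonal solid harmonics about the axis \<open>b\<close>: Gegenbauer polynomials in \<open>x \<bullet> b\<close> of parameter \<open>(n - 1)/2\<close>,
  homogenised by powers of \<open>\<bar>x\<bar>\<^sup>2\<close> and normalised to be monic as polynomials in \<open>x \<bullet> b\<close> on the sphere.
\<close>

fun zonal :: "nat \<Rightarrow> 'a::euclidean_space \<Rightarrow> nat \<Rightarrow> 'a \<Rightarrow> real" where
  "zonal n b 0 = (\<lambda>x. 1)"
| "zonal n b (Suc 0) = (\<lambda>x. x \<bullet> b)"
| "zonal n b (Suc (Suc l)) = (\<lambda>x. (x \<bullet> b) * zonal n b (Suc l) x - zcoeff n (Suc l) * ((x \<bullet> x) * zonal n b l x))"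

lemma rpf_zonal: "real_polynomial_function (zonal n b l)"
proof (induction n b l rule: zonal.induct)
  case (3 n b l)
  then show ?case
    by (simp add: real_polynomial_function_diff rpf_mult rpf_const rpf_norm_square rpf_inner)
qed (simp_all add: rpf_const rpf_inner)

lemma zonal_homogeneous: "zonal n b l (t *\<^sub>R x) = t ^ l * zonal n b l x"
  by (induction n b l rule: zonal.induct) (simp_all add: algebra_simps)

lemma zcoeff_pos:
  assumes "n \<ge> 2" "l \<ge> 1"
  shows "zcoeff n l > 0"
proof -
  have "real n \<ge> 2" "real l \<ge> 1" using assms by auto
  then show ?thesis unfolding zcoeff_def by (intro divide_pos_pos mult_pos_pos) auto
qed

text \<open>Differentiation along the axis lowers the degree of a zonal harmonic by one. The proof
  differentiates the recurrence and inserts the induction hypothesis for the two preceding degrees,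
  without using harmonicity, since \<open>zonal_harmonic\<close> rests on this formula.\<close>

lemma dird_zonal:
  assumes n: "n \<ge> 2" and b: "b \<bullet> b = 1"
  shows "dird b (zonal n b (Suc l)) x
    = real (Suc l) * (real l + real n - 1) / (2 * real l + real n - 1) * zonal n b l x"
proof (induction l rule: less_induct)
  case (less l)
  have n2: "real n \<ge> 2" using n by simp
  show ?case
  proof (cases l)
    case 0
    then show ?thesis using b n2 by simp
  next
    case l: (Suc k)
    define t where "t = x \<bullet> b"
    \<comment> \<open>For \<open>k = 0\<close> the polynomial \<open>zonal n b k\<close> is
      constant; only for positive \<open>k\<close> does the induction hypothesis describe its
      derivative.\<close>
    define D where "D = (if k = 0 then 0 else dird b (zonal n b k) x)"
    have e: "dird b (zonal n b (Suc l)) x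
        = zonal n b l x + t * dird b (zonal n b l) x - zcoeff n l * (2 * t * zonal n b k x + (x \<bullet> x) * D)"
      unfolding l by (simp add: dird_diff rpf_mult rpf_const rpf_norm_square rpf_inner rpf_zonal
           dird_cmult dird_mult dird_norm_square b t_def D_def algebra_simps)
    have dl: "dird b (zonal n b l) x = real l * (real k + real n - 1) / (2 * real k + real n - 1) * zonal n b k x"
      using less[of k] l by simp
    show ?thesis
    proof (cases k)
      case 0
      then show ?thesis
        using e dl n2 l by (simp add: D_def t_def zcoeff_def divide_simps) (simp add: algebra_simps)
    next
      case k: (Suc j)
      have dk: "D = real k * (real j + real n - 1) / (2 * real j + real n - 1) * zonal n b j x"
        using less[of j] l k by (simp add: D_def)
      have rec: "t * zonal n b k x = zonal n b l x + zcoeff n k * ((x \<bullet> x) * zonal n b j x)"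
        by (simp add: l k t_def)
      define Z where "Z = zonal n b l x"
      define W where "W = (x \<bullet> x) * zonal n b j x"
      define r where "r = real j"
      define N where "N = real n"
      have N: "N \<ge> 2" and r: "r \<ge> 0" using n2 by (simp_all add: N_def r_def)
      define K where "K = (r + 2) * (r + N) / (2 * r + N + 1)"
      define G where "G = (r + 2) * (r + N) / ((2 * r + N + 3) * (2 * r + N + 1))"
      define G' where "G' = (r + 1) * (r + N - 1) / ((2 * r + N + 1) * (2 * r + N - 1))"
      define K' where "K' = (r + 1) * (r + N - 1) / (2 * r + N - 1)"
      have rl: "real l = r + 2" "real k = r + 1"
        by (simp_all add: l k r_def)
      have args: "r + 2 + N - 2 = r + N" "2 * (r + 2) + N - 1 = 2 * r + N + 3" "2 * (r + 2) + N - 3 = 2 * r + N + 1"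
        "r + 1 + N - 2 = r + N - 1" "2 * (r + 1) + N - 1 = 2 * r + N + 1" "2 * (r + 1) + N - 3 = 2 * r + N - 1"
        "r + 1 + N - 1 = r + N"
        by simp_all
      have coeffs: "zcoeff n l = G" "zcoeff n k = G'"
        "real l * (real k + real n - 1) / (2 * real k + real n - 1) = K"
        "real k * (real j + real n - 1) / (2 * real j + real n - 1) = K'"
        unfolding zcoeff_def rl N_def[symmetric] r_def[symmetric] args G_def G'_def K_def K'_def by (rule refl)+
      have "dird b (zonal n b (Suc l)) x = Z + K * (t * zonal n b k x) - G * (2 * (t * zonal n b k x) + K' * W)"
        unfolding e dl dk coeffs Z_def[symmetric] W_def by (simp add: algebra_simps)
      also have "t * zonal n b k x = Z + G' * W"
        unfolding rec coeffs Z_def W_def ..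
      also have "Z + K * (Z + G' * W) - G * (2 * (Z + G' * W) + K' * W)
          = (1 + K - 2 * G) * Z + (K * G' - 2 * G * G' - G * K') * W"
        by (simp add: algebra_simps)
      \<comment> \<open>The multiple of \<open>zonal n b j\<close> must disappear: after factoring
        out \<open>G * G'\<close> there remains
        \<open>(2 * r + N + 3) - 2 - (2 * r + N + 1)\<close>.\<close>
      also have "K * G' - 2 * G * G' - G * K' = 0"
      proof -
        have "K = G * (2 * r + N + 3)" "K' = G' * (2 * r + N + 1)"
          unfolding K_def G_def K'_def G'_def using N r by simp_all
        then show ?thesis by (simp add: algebra_simps)
      qed
      also have "1 + K - 2 * G = (r + 3) * (r + N + 1) / (2 * r + N + 3)"
      proof -
        have "K = G * (2 * r + N + 3)"
          unfolding K_def G_def using N r by simp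
        then have "1 + K - 2 * G = 1 + G * (2 * r + N + 1)" by (simp add: algebra_simps)
        also have "G * (2 * r + N + 1) = (r + 2) * (r + N) / (2 * r + N + 3)"
          unfolding G_def using N r by simp
        also have "1 + \<dots> = (r + 3) * (r + N + 1) / (2 * r + N + 3)"
          using N r by (simp add: field_simps)
        finally show ?thesis .
      qed
      finally show ?thesis
        unfolding Z_def N_def[symmetric] of_nat_Suc rl by (simp add: add_ac add_diff_eq)
    qed
  qed
qed

text \<open>In the recurrence the first term has Laplacian
  \<open>2 * dird b (zonal n b (Suc k))\<close>, the second a multiple of
  \<open>zonal n b k\<close>. By \<open>dird_zonal\<close> both are multiples of the same function,
  and \<open>zcoeff\<close> is the value for which they cancel.\<close>

lemma zonal_harmonic:
  fixes b :: "'a::euclidean_space"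
  assumes n: "n \<ge> 2" and b: "b \<in> Basis" and dim: "DIM('a) = n + 1"
  shows "laplacian (zonal n b l) x = 0"
proof (induction l rule: less_induct)
  case (less l)
  consider "l = 0" | "l = 1" | k where "l = Suc (Suc k)"
    by (metis One_nat_def not0_implies_Suc)
  then show ?case
  proof cases
    case 1
    then show ?thesis by (simp add: laplacian_rpf rpf_const)
  next
    case 2
    then show ?thesis by (simp add: laplacian_rpf rpf_inner)
  next
    case 3
    have n2: "real n \<ge> 2" using n by simp
    have IH: "laplacian (zonal n b (Suc k)) x = 0" "laplacian (zonal n b k) x = 0"
      using less 3 by auto
    have r1: "real_polynomial_function (\<lambda>x. (x \<bullet> b) * zonal n b (Suc k) x)"
      and r2: "real_polynomial_function (\<lambda>x. (x \<bullet> x) * zonal n b k x)"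
      by (intro rpf_mult rpf_inner rpf_norm_square rpf_zonal)+
    have "laplacian (zonal n b l) x
        = laplacian (\<lambda>x. (x \<bullet> b) * zonal n b (Suc k) x + (- zcoeff n (Suc k)) * ((x \<bullet> x) * zonal n b k x)) x"
      unfolding 3 by simp
    also have "\<dots> = 2 * dird b (zonal n b (Suc k)) x - zcoeff n (Suc k) * ((2 * real DIM('a) + 4 * real k) * zonal n b k x)"
      by (subst laplacian_add[OF r1 rpf_mult[OF rpf_const r2]])
         (simp only: laplacian_cmult[OF r2] laplacian_coordinate_mult[OF rpf_zonal b]
           laplacian_norm_square_mult[OF rpf_zonal zonal_homogeneous] IH, simp)
    also have "\<dots> = 0"
    proof -
      have "b \<bullet> b = 1" using b by (simp add: inner_Basis)
      note dird_zonal[OF n this, of k x]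
      moreover have "zcoeff n (Suc k) * (2 * real DIM('a) + 4 * real k)
          = 2 * (real (Suc k) * (real k + real n - 1) / (2 * real k + real n - 1))"
      proof -
        have "2 * real DIM('a) + 4 * real k = 2 * (2 * real k + real n + 1)" by (simp add: dim)
        moreover have "zcoeff n (Suc k)
            = real (Suc k) * (real k + real n - 1) / ((2 * real k + real n + 1) * (2 * real k + real n - 1))"
          by (simp add: zcoeff_def algebra_simps)
        moreover have "A / (B * C) * (2 * B) = 2 * (A / C)" if "B \<noteq> 0" for A B C :: real
          using that by simp
        ultimately show ?thesis using n2 by (simp only:)
      qed
      ultimately show ?thesis by (simp flip: mult.assoc)
    qed
    finally show ?thesis .
  qed
qed

lemma zonal_homogeneous_harmonic:
  fixes b :: "'a::euclidean_space"
  assumes "n \<ge> 2" "b \<in> Basis" "DIM('a) = n + 1"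
  shows "zonal n b l \<in> homogeneous_harmonic_polynomials l"
  unfolding homogeneous_harmonic_polynomials_def
  using zonal_harmonic[OF assms] by (simp add: rpf_zonal zonal_homogeneous)

text \<open>
  Multiplication of a zonal expansion by \<open>t = x \<bullet> b\<close>, with \<open>t Z\<^sub>0 = Z\<^sub>1\<close> and
  \<open>t Z\<^sub>l = Z\<^bsub>l+1\<^esub> + zcoeff n l Z\<^bsub>l-1\<^esub>\<close> on the sphere, gives the recursion.
\<close>

fun mcoeff :: "nat \<Rightarrow> nat \<Rightarrow> nat \<Rightarrow> real" where
  "mcoeff n 0 l = (if l = 0 then 1 else 0)"
| "mcoeff n (Suc m) 0 = zcoeff n 1 * mcoeff n m 1"
| "mcoeff n (Suc m) (Suc l) = mcoeff n m l + zcoeff n (Suc (Suc l)) * mcoeff n m (Suc (Suc l))"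

lemma mcoeff_eq_0: "m < l \<Longrightarrow> mcoeff n m l = 0"
proof (induction m arbitrary: l)
  case (Suc m)
  then show ?case by (cases l) auto
qed simp

lemma mcoeff_parity: "odd (m + l) \<Longrightarrow> mcoeff n m l = 0"
proof (induction m arbitrary: l)
  case (Suc m)
  then show ?case by (cases l) auto
qed (auto elim: oddE)

lemma mcoeff_self [simp]: "mcoeff n m m = 1"
  by (induction m) (auto simp: mcoeff_eq_0)

lemma coordinate_power_expansion:
  assumes x: "x \<in> sphere 0 1"
  shows "(x \<bullet> b) ^ m = (\<Sum>l\<le>m. mcoeff n m l * zonal n b l x)"
proof (induction m)
  case 0
  then show ?case by simp
next
  case (Suc m)
  \<comment> \<open>\<open>W l\<close> is the degree-lowering part of the product of
    \<open>x \<bullet> b\<close> with the \<open>l\<close>-th term. Since \<open>W 0 = 0\<close> and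
    the coefficients beyond \<open>m\<close> vanish, its sum can be extended and shifted to line up
    with the recursion of \<open>mcoeff\<close>.\<close>
  define W where "W = (\<lambda>l. case l of 0 \<Rightarrow> 0 | Suc k \<Rightarrow> mcoeff n m l * zcoeff n l * zonal n b k x)"
  have xx: "x \<bullet> x = 1" using x by (simp add: dot_square_norm)
  have rec: "mcoeff n m l * ((x \<bullet> b) * zonal n b l x) = mcoeff n m l * zonal n b (Suc l) x + W l" for l
    by (cases l) (simp_all add: W_def xx algebra_simps)
  have "(x \<bullet> b) ^ Suc m = (\<Sum>l\<le>m. mcoeff n m l * ((x \<bullet> b) * zonal n b l x))"
    by (simp add: Suc sum_distrib_left mult_ac)
  also have "\<dots> = (\<Sum>l\<le>m. mcoeff n m l * zonal n b (Suc l) x) + (\<Sum>l\<le>m. W l)"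
    by (simp add: rec sum.distrib)
  also have "(\<Sum>l\<le>m. W l) = (\<Sum>l\<le>Suc (Suc m). W l)"
    by (simp add: W_def mcoeff_eq_0)
  also have "\<dots> = (\<Sum>l\<le>Suc m. W (Suc l))"
    by (subst sum.atMost_Suc_shift) (simp add: W_def)
  also have "\<dots> = W 1 + (\<Sum>l\<le>m. W (Suc (Suc l)))"
    by (subst sum.atMost_Suc_shift) simp
  also have "(\<Sum>l\<le>m. mcoeff n m l * zonal n b (Suc l) x) + (W 1 + (\<Sum>l\<le>m. W (Suc (Suc l))))
      = mcoeff n (Suc m) 0 * zonal n b 0 x + (\<Sum>l\<le>m. mcoeff n (Suc m) (Suc l) * zonal n b (Suc l) x)"
    by (simp add: W_def sum.distrib distrib_left distrib_right mult_ac)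
  also have "\<dots> = (\<Sum>l\<le>Suc m. mcoeff n (Suc m) l * zonal n b l x)"
    by (subst sum.atMost_Suc_shift) simp
  finally show ?case .
qed

text \<open>Comparing degree \<open>l + 1\<close> of the power \<open>m + 1\<close> with degree
  \<open>l\<close> of the power \<open>m\<close> gives a rational quotient, as used in
  \<open>power_form_term_less\<close>. Induction on \<open>m\<close> through the recursion of
  \<open>mcoeff\<close>, with \<open>l = 0\<close> apart because that recursion has a single term in
  degree 0.\<close>

lemma mcoeff_ratio:
  assumes n: "n \<ge> 2"
  shows "(real l + 1) * (real n + real m + 1 + real l) * mcoeff n (Suc m) (Suc l)
    = (real m + 1) * (2 * real l + real n + 1) * mcoeff n m l"
proof (induction m arbitrary: l)
  case 0
  then show ?case by (simp add: mcoeff_eq_0 algebra_simps)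
next
  case (Suc m)
  define N where "N = real n"
  define M where "M = real m"
  have N: "N \<ge> 2" and M: "M \<ge> 0" using n by (simp_all add: N_def M_def)
  show ?case
  proof (cases l)
    case 0
    define B where "B = mcoeff n (Suc m) 0"
    define C where "C = mcoeff n m 1"
    define E where "E = mcoeff n (Suc m) 2"
    have B: "B = C / (N + 1)"
      using N by (simp add: B_def C_def zcoeff_def N_def divide_simps)
    have E: "2 * (N + M + 2) * E = (M + 1) * (N + 3) * C"
      using Suc.IH[of 1] by (simp add: E_def C_def N_def M_def numeral_2_eq_2 add_ac)
    have "zcoeff n 2 = 2 * N / ((N + 3) * (N + 1))"
      by (simp add: zcoeff_def N_def add_ac)
    then have "(N + M + 2) * (B + zcoeff n 2 * E) = (N + M + 2) * B + N * (2 * (N + M + 2) * E) / ((N + 3) * (N + 1))"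
      by (simp add: algebra_simps)
    also have "\<dots> = (N + M + 2) * B + N * (M + 1) * B"
      unfolding E B using N by (simp add: mult_ac)
    also have "\<dots> = (M + 2) * (N + 1) * B"
      by (simp add: algebra_simps)
    finally show ?thesis
      unfolding 0 by (simp add: B_def E_def N_def M_def numeral_2_eq_2 add_ac del: mcoeff.simps(2))
  next
    case l: (Suc k)
    define r where "r = real k"
    have r: "r \<ge> 0" by (simp add: r_def)
    define B where "B = mcoeff n (Suc m) (Suc k)"
    define C where "C = mcoeff n m (Suc (Suc k))"
    define D where "D = mcoeff n m k"
    define E where "E = mcoeff n (Suc m) (Suc (Suc (Suc k)))"
    have e1: "B = D + (r + 2) * (r + N) / ((2 * r + N + 3) * (2 * r + N + 1)) * C"
      by (simp add: B_def C_def D_def zcoeff_def N_def r_def algebra_simps)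
    have e2: "(M + 1) * (2 * r + N + 1) * D = (r + 1) * (N + M + 1 + r) * B"
      using Suc.IH[of k] by (simp add: B_def D_def N_def M_def r_def)
    have e3: "(r + 3) * (N + M + 3 + r) * E = (M + 1) * (2 * r + N + 5) * C"
      using Suc.IH[of "Suc (Suc k)"] by (simp add: E_def C_def N_def M_def r_def add_ac)
    have zE: "zcoeff n (Suc (Suc (Suc k))) = (r + 3) * (r + N + 1) / ((2 * r + N + 5) * (2 * r + N + 3))"
      by (simp add: zcoeff_def N_def r_def algebra_simps)
    have pos: "2 * r + N + 1 > 0" "2 * r + N + 3 > 0" "2 * r + N + 5 > 0" "r + N > 0" using N r by auto
    have e1': "(2 * r + N + 3) * (2 * r + N + 1) * (B - D) = (r + 2) * (r + N) * C"
      unfolding e1 using pos by simp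
    \<comment> \<open>Eliminating \<open>D\<close> between \<open>e1'\<close> and \<open>e2\<close>
      expresses \<open>C\<close> through \<open>B\<close>. By \<open>e3\<close> also
      \<open>E\<close> is then a multiple of \<open>B\<close>, and so is the whole right side of the
      recursion.\<close>
    have "(r + N) * ((M + 1) * (r + 2) * C) = (M + 1) * ((r + 2) * (r + N) * C)"
      by (simp add: mult_ac)
    also have "\<dots> = (2 * r + N + 3) * ((M + 1) * (2 * r + N + 1) * B - (M + 1) * (2 * r + N + 1) * D)"
      unfolding e1'[symmetric] by (simp add: algebra_simps)
    also have "\<dots> = (r + N) * ((2 * r + N + 3) * (M - r) * B)"
      unfolding e2 by (simp add: algebra_simps)
    finally have C: "(M + 1) * (r + 2) * C = (2 * r + N + 3) * (M - r) * B"
      using pos by simp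
    have "(r + 2) * (N + M + 3 + r) * (B + zcoeff n (Suc (Suc (Suc k))) * E)
        = (r + 2) * (N + M + 3 + r) * B
          + (r + 2) * (r + N + 1) * ((r + 3) * (N + M + 3 + r) * E) / ((2 * r + N + 5) * (2 * r + N + 3))"
      unfolding zE by (simp add: algebra_simps)
    also have "(r + 2) * (r + N + 1) * ((r + 3) * (N + M + 3 + r) * E) / ((2 * r + N + 5) * (2 * r + N + 3))
        = (r + N + 1) * ((M + 1) * (r + 2) * C) / (2 * r + N + 3)"
      unfolding e3 using pos by simp
    also have "\<dots> = (r + N + 1) * (M - r) * B"
      unfolding C using pos by simp
    also have "(r + 2) * (N + M + 3 + r) * B + (r + N + 1) * (M - r) * B = (M + 2) * (2 * r + N + 3) * B"
      by (simp add: algebra_simps)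
    finally have "(r + 2) * (N + M + 3 + r) * mcoeff n (Suc (Suc m)) (Suc (Suc k)) = (M + 2) * (2 * r + N + 3) * B"
      by (simp add: B_def E_def)
    then show ?thesis
      unfolding l B_def r_def N_def M_def by (simp add: add_ac del: mcoeff.simps)
  qed
qed

section \<open>Norms of zonal harmonics, and the polynomial inequalities for comparing neighbouring
  degrees\<close>

definition zonal_energy :: "nat \<Rightarrow> 'a::euclidean_space \<Rightarrow> nat \<Rightarrow> real" where
  "zonal_energy n b l = (LINT x|surface_measure. (zonal n b l x)\<^sup>2)"

text \<open>The integral of \<open>(x \<bullet> b) * Z_l * Z_(l+1)\<close> is computed twice:
  applying the recurrence to \<open>Z_l\<close> leaves the energy of degree \<open>l + 1\<close>,
  applying it to \<open>Z_(l+1)\<close> leaves \<open>zcoeff\<close> times that of degree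
  \<open>l\<close>.\<close>

lemma zonal_energy_Suc:
  fixes b :: "'a::euclidean_space"
  assumes A: "n \<ge> 2" "b \<in> Basis" "DIM('a) = n + 1"
  shows "zonal_energy n b (Suc l) = zcoeff n (Suc l) * zonal_energy n b l"
proof -
  let ?Z = "zonal n b"
  let ?I = "\<lambda>f :: 'a \<Rightarrow> real. LINT x|surface_measure. f x"
  have orth: "?I (\<lambda>x. ?Z i x * ?Z j x) = 0" if "i \<noteq> j" for i j
    by (rule harmonic_orthogonal[OF zonal_homogeneous_harmonic[OF A] zonal_homogeneous_harmonic[OF A] that])
  have int: "integrable surface_measure (\<lambda>x. ?Z i x * ?Z j x)" for i j
    by (intro integrable_L2_mult rpf_L2_sphere rpf_zonal)
  have rec: "(x \<bullet> b) * ?Z (Suc k) x = ?Z (Suc (Suc k)) x + zcoeff n (Suc k) * ?Z k x" if "x \<in> sphere 0 1" for x k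
    using that by (simp add: dot_square_norm)
  have "?I (\<lambda>x. (x \<bullet> b) * ?Z l x * ?Z (Suc l) x) = zonal_energy n b (Suc l)"
  proof (cases l)
    case 0
    then show ?thesis by (simp add: zonal_energy_def power2_eq_square)
  next
    case (Suc k)
    have "?I (\<lambda>x. (x \<bullet> b) * ?Z l x * ?Z (Suc l) x)
        = ?I (\<lambda>x. ?Z (Suc l) x * ?Z (Suc l) x + zcoeff n l * (?Z k x * ?Z (Suc l) x))"
      by (rule surface_integral_cong) (simp only: Suc rec, simp only: distrib_right mult.assoc)
    also have "\<dots> = zonal_energy n b (Suc l)"
      by (subst Bochner_Integration.integral_add)
         (simp_all only: int integrable_mult_right integral_mult_right_zero orth[of k "Suc (Suc k)"] Suc,
           simp_all add: zonal_energy_def power2_eq_square del: zonal.simps)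
    finally show ?thesis .
  qed
  moreover have "?I (\<lambda>x. (x \<bullet> b) * ?Z l x * ?Z (Suc l) x) = zcoeff n (Suc l) * zonal_energy n b l"
  proof -
    have "?I (\<lambda>x. (x \<bullet> b) * ?Z l x * ?Z (Suc l) x)
        = ?I (\<lambda>x. ?Z (Suc (Suc l)) x * ?Z l x + zcoeff n (Suc l) * (?Z l x * ?Z l x))"
    proof (rule surface_integral_cong)
      fix x :: 'a assume x: "x \<in> sphere 0 1"
      have "(x \<bullet> b) * ?Z l x * ?Z (Suc l) x = ((x \<bullet> b) * ?Z (Suc l) x) * ?Z l x" by (simp only: mult_ac)
      then show "(x \<bullet> b) * ?Z l x * ?Z (Suc l) x = ?Z (Suc (Suc l)) x * ?Z l x + zcoeff n (Suc l) * (?Z l x * ?Z l x)"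
        by (simp only: rec[OF x] distrib_right mult.assoc)
    qed
    also have "\<dots> = zcoeff n (Suc l) * zonal_energy n b l"
      by (subst Bochner_Integration.integral_add)
         (simp_all only: int integrable_mult_right integral_mult_right_zero orth[of "Suc (Suc l)" l],
           simp_all add: zonal_energy_def power2_eq_square del: zonal.simps)
    finally show ?thesis .
  qed
  ultimately show ?thesis by simp
qed


lemma zonal_energy_pos:
  fixes b :: "'a::euclidean_space"
  assumes A: "n \<ge> 2" "b \<in> Basis" "DIM('a) = n + 1"
  shows "zonal_energy n b l > 0"
proof (induction l)
  case 0
  have "measure (surface_measure :: 'a measure) (sphere 0 1) \<noteq> 0"
    using surface_integral_zero[of "\<lambda>x::'a. 1" b] A(2) by auto
  then show ?case by (simp add: zonal_energy_def zero_less_measure_iff)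
next
  case (Suc l)
  then show ?case by (simp add: zonal_energy_Suc[OF A] zcoeff_pos[OF A(1)])
qed

text \<open>The shifted variables measure the distance from the extreme case \<open>l = 2\<close>,
  \<open>m = l + 1\<close>, \<open>n = 2\<close>. In them the difference of the two sides has only
  nonnegative coefficients.\<close>

lemma ratio_inequality:
  fixes a p j :: real
  assumes "a \<ge> 0" "p \<ge> 0" "j \<ge> 0" "l = 2 + a" "m = l + 1 + p" "n = 2 + j"
  shows "(m + 1 - l) * (l + 1) * (n + m + l)\<^sup>2 * (2 * l + n - 1)
    \<le> (l + n + m + 1) * m\<^sup>2 * (2 * l + n + 1) * (l + n - 1)"
proof -
  have "(l + n + m + 1) * m\<^sup>2 * (2 * l + n + 1) * (l + n - 1)
      - (m + 1 - l) * (l + 1) * (n + m + l)\<^sup>2 * (2 * l + n - 1) =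
      4 * a^5 + 2 * a^4 * p + 8 * a^4 * j + 50 * a^4 + 7 * a^3 * p * j + 17 * a^3 * p
      + 5 * a^3 * j^2 + 81 * a^3 * j + 234 * a^3 + 6 * a^2 * p^2 * j + 4 * a^2 * p^2
      + 5 * a^2 * p * j^2 + 62 * a^2 * p * j + 51 * a^2 * p + a^2 * j^3 + 36 * a^2 * j^2
      + 291 * a^2 * j + 490 * a^2 + 2 * a * p^3 * j + 2 * a * p^3 + 5 * a * p^2 * j^2
      + 45 * a * p^2 * j + 30 * a * p^2 + a * p * j^3 + 31 * a * p * j^2 + 188 * a * p * j
      + 68 * a * p + 4 * a * j^3 + 79 * a * j^2 + 425 * a * j + 404 * a + p^3 * j^2
      + 7 * p^3 * j + 6 * p^3 + p^2 * j^3 + 18 * p^2 * j^2 + 83 * p^2 * j + 54 * p^2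
      + 3 * p * j^3 + 48 * p * j^2 + 195 * p * j + 42 * p + 3 * j^3 + 48 * j^2 + 195 * j + 42"
    unfolding assms(4-6) by algebra
  also have "\<dots> \<ge> 0"
    using assms(1-3) by (intro add_nonneg_nonneg mult_nonneg_nonneg zero_le_power) simp_all
  finally show ?thesis by simp
qed

text \<open>The case \<open>l = 0\<close> of the same comparison, with \<open>m \<ge> 3\<close> in
  place of \<open>m \<ge> l + 1\<close>: for \<open>m = 1\<close> it would fail.\<close>

lemma ratio_inequality_0:
  fixes p j :: real
  assumes "p \<ge> 0" "j \<ge> 0" "m = 3 + p" "n = 2 + j"
  shows "(m + 1) * (n + m)\<^sup>2 * (n - 1) \<le> (n + m + 1) * m\<^sup>2 * (n + 1) * (n - 1)"
proof -
  have "(n + m + 1) * m\<^sup>2 * (n + 1) * (n - 1) - (m + 1) * (n + m)\<^sup>2 * (n - 1) =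
      p^3 * j^2 + 3 * p^3 * j + 2 * p^3 + p^2 * j^3 + 14 * p^2 * j^2 + 35 * p^2 * j + 22 * p^2
      + 5 * p * j^3 + 50 * p * j^2 + 115 * p * j + 70 * p + 5 * j^3 + 46 * j^2 + 103 * j + 62"
    unfolding assms(3-4) by algebra
  also have "\<dots> \<ge> 0"
    using assms(1-2) by (intro add_nonneg_nonneg mult_nonneg_nonneg zero_le_power) simp_all
  finally show ?thesis by simp
qed

section \<open>Unboundedness in dimension at least two\<close>

text \<open>The right side is the left side times \<open>X * c^2 * g\<close>, where
  \<open>X\<close>, \<open>c\<close> and \<open>g\<close> are the quotients of weights, coefficients
  and energies between degrees \<open>l + 1\<close> and \<open>l\<close>. This product exceeds
  1.\<close>

lemma power_form_term_less:
  fixes b :: "'a::euclidean_space"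
  assumes A: "n \<ge> 2" "b \<in> Basis" "DIM('a) = n + 1"
    and s: "real n / 2 + real (Suc M) < s" "s < real n / 2 + real (Suc M) + 1"
    and M: "M \<ge> 2" and l: "l \<le> M" "even l" and nz: "mcoeff n M l \<noteq> 0"
  shows "\<bar>alpha n s l\<bar> * ((mcoeff n M l)\<^sup>2 * zonal_energy n b l)
    < \<bar>alpha n s (Suc l)\<bar> * ((mcoeff n (Suc M) (Suc l))\<^sup>2 * zonal_energy n b (Suc l))"
proof -
  define L where "L = real l"
  define N where "N = real n"
  define m where "m = real (Suc M)"
  have pos: "N \<ge> 2" "L \<ge> 0" "m \<ge> 3" "L \<le> m - 1"
    using A(1) M l by (auto simp: L_def N_def m_def)
  define X where "X = (L + N / 2 + s) / (s - N / 2 - L)"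
  \<comment> \<open>The value of \<open>X\<close> at the right end \<open>s = n/2 + m + 1\<close> of
    the open interval. \<open>X\<close> decreases in \<open>s\<close>, so \<open>X0\<close> is a
    strict lower bound, free of \<open>s\<close>.\<close>
  define X0 where "X0 = (L + N + m + 1) / (m + 1 - L)"
  define c where "c = m * (2 * L + N + 1) / ((L + 1) * (N + m + L))"
  define g where "g = (L + 1) * (L + N - 1) / ((2 * L + N + 1) * (2 * L + N - 1))"
  have sl: "0 < s - N / 2 - L" "s - N / 2 - L < m + 1 - L"
    using s pos unfolding N_def m_def by auto
  have "X = 1 + (2 * L + N) / (s - N / 2 - L)" "X0 = 1 + (2 * L + N) / (m + 1 - L)"
    using sl unfolding X_def X0_def by (simp_all add: divide_simps) (simp_all add: algebra_simps)
  moreover have "(2 * L + N) / (m + 1 - L) < (2 * L + N) / (s - N / 2 - L)"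
    using sl pos by (intro divide_strict_left_mono mult_pos_pos) auto
  ultimately have XX: "X0 < X" by simp
  have key: "(m + 1 - L) * (L + 1) * (N + m + L)\<^sup>2 * (2 * L + N - 1)
      \<le> (L + N + m + 1) * m\<^sup>2 * (2 * L + N + 1) * (L + N - 1)"
  proof (cases "l = 0")
    case True
    then show ?thesis
      using ratio_inequality_0[of "m - 3" "N - 2" m N] pos by (simp add: L_def)
  next
    case False
    then have "2 \<le> l" using l(2) by (cases "l = 1") auto
    then have "L \<ge> 2" by (simp add: L_def)
    then show ?thesis
      using ratio_inequality[of "L - 2" "m - L - 1" "N - 2" L m N] pos by simp
  qed
  have gp: "g > 0" and cp: "c > 0" using pos by (auto simp: g_def c_def intro!: divide_pos_pos mult_pos_pos)
  have "1 \<le> X0 * c\<^sup>2 * g"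
  proof -
    have ne: "m + 1 - L > 0" "L + 1 > 0" "N + m + L > 0" "2 * L + N - 1 > 0" "2 * L + N + 1 > 0" using pos by auto
    have alg: "a / d * (m * e / (u * w))\<^sup>2 * (u * y / (e * z)) = (a * m\<^sup>2 * e * y) / (d * u * w\<^sup>2 * z)"
      if "d > 0" "u > 0" "w > 0" "z > 0" "e > 0" for a d m e u w y z :: real
      using that by (simp add: field_simps power2_eq_square)
    have "X0 * c\<^sup>2 * g = (L + N + m + 1) * m\<^sup>2 * (2 * L + N + 1) * (L + N - 1)
       / ((m + 1 - L) * (L + 1) * (N + m + L)\<^sup>2 * (2 * L + N - 1))"
      unfolding X0_def c_def g_def by (rule alg) (use ne in auto)
    moreover have "(m + 1 - L) * (L + 1) * (N + m + L)\<^sup>2 * (2 * L + N - 1) > 0"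
      using ne by (intro mult_pos_pos zero_less_power)
    ultimately show ?thesis using key by (simp add: le_divide_eq_1_pos)
  qed
  also have "X0 * c\<^sup>2 * g < X * c\<^sup>2 * g"
    using XX gp cp by (intro mult_strict_right_mono zero_less_power)
  finally have one: "1 < X * c\<^sup>2 * g" .
  have a: "\<bar>alpha n s (Suc l)\<bar> = \<bar>alpha n s l\<bar> * X"
    unfolding X_def L_def N_def by (rule alpha_abs_Suc[OF s]) (use l in simp)
  have z: "zonal_energy n b (Suc l) = g * zonal_energy n b l"
    by (simp add: zonal_energy_Suc[OF A] zcoeff_def g_def L_def N_def algebra_simps)
  have mc: "mcoeff n (Suc M) (Suc l) = c * mcoeff n M l"
  proof -
    have "(L + 1) * (N + m + L) > 0" using pos by (intro mult_pos_pos) auto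
    moreover have "(L + 1) * (N + m + L) * mcoeff n (Suc M) (Suc l) = m * (2 * L + N + 1) * mcoeff n M l"
      using mcoeff_ratio[OF A(1), of l M] by (simp add: L_def N_def m_def add_ac)
    ultimately show ?thesis
      unfolding c_def by (simp add: field_simps)
  qed
  have "\<bar>alpha n s l\<bar> \<noteq> 0"
    using alpha_sign[OF s, of l] l by auto
  then have "0 < \<bar>alpha n s l\<bar> * ((mcoeff n M l)\<^sup>2 * zonal_energy n b l)"
    using zonal_energy_pos[OF A] nz by (intro mult_pos_pos) auto
  from mult_strict_right_mono[OF one this]
  show ?thesis
    unfolding a z mc by (simp add: power_mult_distrib mult_ac)
qed

lemma power_form_neg_even:
  fixes b :: "'a::euclidean_space"
  assumes A: "n \<ge> 2" "b \<in> Basis" "DIM('a) = n + 1"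
    and s: "real n / 2 + real m < s" "s < real n / 2 + real m + 1" and m: "even m"
  shows "(\<Sum>l\<le>m. alpha n s l * ((mcoeff n m l)\<^sup>2 * zonal_energy n b l)) < 0"
proof -
  have 1: "alpha n s l * ((mcoeff n m l)\<^sup>2 * zonal_energy n b l) \<le> 0" if "l \<le> m" for l
  proof (cases "even l")
    case True
    then have "alpha n s l < 0"
      using alpha_sign[OF s that] m that by simp
    then show ?thesis
      using zonal_energy_pos[OF A, of l] by (intro mult_nonpos_nonneg) auto
  qed (use m in \<open>simp add: mcoeff_parity\<close>)
  have "(\<Sum>l\<le>m. - (alpha n s l * ((mcoeff n m l)\<^sup>2 * zonal_energy n b l))) > 0"
  proof (rule sum_pos2[of _ m])
    show "0 < - (alpha n s m * ((mcoeff n m m)\<^sup>2 * zonal_energy n b m))"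
      using alpha_sign[OF s, of m] zonal_energy_pos[OF A, of m] by (simp add: mult_neg_pos)
  qed (use 1 in auto)
  then show ?thesis by (simp add: sum_negf)
qed

text \<open>The two powers share no degree by parity, so their forms add up. Each positive term,
  from an even degree \<open>l\<close> of the power \<open>M\<close>, is paired in \<open>T\<close>
  with the negative term of degree \<open>l + 1\<close> of the power \<open>Suc M\<close>, which is
  larger in absolute value.\<close>

lemma power_form_neg_odd:
  fixes b :: "'a::euclidean_space"
  assumes A: "n \<ge> 2" "b \<in> Basis" "DIM('a) = n + 1"
    and s: "real n / 2 + real (Suc M) < s" "s < real n / 2 + real (Suc M) + 1" and M: "even M" "M \<ge> 2"
  shows "(\<Sum>l\<le>Suc M. alpha n s l * ((mcoeff n M l + mcoeff n (Suc M) l)\<^sup>2 * zonal_energy n b l)) < 0"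
proof -
  let ?h = "zonal_energy n b"
  define T where "T = (\<lambda>l. alpha n s l * ((mcoeff n M l)\<^sup>2 * ?h l)
    + alpha n s (Suc l) * ((mcoeff n (Suc M) (Suc l))\<^sup>2 * ?h (Suc l)))"
  have sq: "(mcoeff n M l + mcoeff n (Suc M) l)\<^sup>2 = (mcoeff n M l)\<^sup>2 + (mcoeff n (Suc M) l)\<^sup>2" for l
  proof -
    have "mcoeff n M l * mcoeff n (Suc M) l = 0"
      using mcoeff_parity[of M l n] mcoeff_parity[of "Suc M" l n] by (cases "odd (M + l)") auto
    then show ?thesis by (simp add: power2_sum del: mcoeff.simps)
  qed
  have "(\<Sum>l\<le>Suc M. alpha n s l * ((mcoeff n M l + mcoeff n (Suc M) l)\<^sup>2 * ?h l))
      = (\<Sum>l\<le>Suc M. alpha n s l * ((mcoeff n M l)\<^sup>2 * ?h l))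
        + (\<Sum>l\<le>Suc M. alpha n s l * ((mcoeff n (Suc M) l)\<^sup>2 * ?h l))"
    unfolding sq by (simp only: distrib_left distrib_right sum.distrib)
  also have "(\<Sum>l\<le>Suc M. alpha n s l * ((mcoeff n M l)\<^sup>2 * ?h l)) = (\<Sum>l\<le>M. alpha n s l * ((mcoeff n M l)\<^sup>2 * ?h l))"
    by (simp add: mcoeff_eq_0)
  \<comment> \<open>The power \<open>Suc M\<close> is odd and has no component of degree 0, so the
    index shift drops only a zero term.\<close>
  also have "(\<Sum>l\<le>Suc M. alpha n s l * ((mcoeff n (Suc M) l)\<^sup>2 * ?h l))
      = (\<Sum>l\<le>M. alpha n s (Suc l) * ((mcoeff n (Suc M) (Suc l))\<^sup>2 * ?h (Suc l)))"
    using M mcoeff_parity[of "Suc M" 0 n] by (subst sum.atMost_Suc_shift) (simp del: mcoeff.simps)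
  also have "(\<Sum>l\<le>M. alpha n s l * ((mcoeff n M l)\<^sup>2 * ?h l))
      + (\<Sum>l\<le>M. alpha n s (Suc l) * ((mcoeff n (Suc M) (Suc l))\<^sup>2 * ?h (Suc l))) = (\<Sum>l\<le>M. T l)"
    by (simp only: T_def sum.distrib)
  also have "\<dots> < 0"
  proof -
    have less: "T l < 0" if l: "l \<le> M" "even l" "mcoeff n M l \<noteq> 0" for l
    proof -
      have "alpha n s l > 0" "alpha n s (Suc l) < 0"
        using alpha_sign[OF s, of l] alpha_sign[OF s, of "Suc l"] l M by auto
      then show ?thesis
        using power_form_term_less[OF A s M(2) l] by (simp add: T_def del: mcoeff.simps)
    qed
    have le: "T l \<le> 0" if "l \<le> M" for l
    proof (cases "even l \<and> mcoeff n M l \<noteq> 0")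
      case True
      then show ?thesis using less[OF that] by simp
    next
      case False
      have "mcoeff n M l = 0"
        using False M mcoeff_parity[of M l n] by auto
      moreover have "mcoeff n (Suc M) (Suc l) = 0"
        using mcoeff_ratio[OF A(1), of l M] \<open>mcoeff n M l = 0\<close>
        by (simp add: add_nonneg_eq_0_iff del: mcoeff.simps)
      ultimately show ?thesis by (simp add: T_def del: mcoeff.simps)
    qed
    have "(\<Sum>l\<le>M. - T l) > 0"
      by (rule sum_pos2[of _ M]) (use less[of M] le M in auto)
    then show ?thesis by (simp add: sum_negf)
  qed
  finally show ?thesis .
qed

text \<open>The test functions are \<open>v + \<delta>^k\<close>. On the slab of width \<delta>
  around the equator they are at most \<open>(K + 1) * \<delta>^k\<close>, so the integral is at
  least of order \<open>\<delta> powr (1 - k q)\<close>, which is unbounded for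
  \<open>k q > 1\<close>, while the form stays below a negative constant.\<close>

lemma sobolev_infimum_bot:
  fixes v :: "'a::euclidean_space \<Rightarrow> real"
  assumes d: "DIM('a) \<ge> 2" and b: "b \<in> Basis" and n: "n \<ge> 1" and s: "s > real n / 2"
    and v: "\<And>x. x \<in> sphere 0 1 \<Longrightarrow> v x = (\<Sum>l\<le>N. p l x)"
    and p: "\<And>l. p l \<in> homogeneous_harmonic_polynomials l"
    and neg: "(\<Sum>l\<le>N. alpha n s l * (LINT x|surface_measure. (p l x)\<^sup>2)) < 0"
    and v0: "\<And>x. x \<in> sphere 0 1 \<Longrightarrow> 0 \<le> v x"
    and vK: "\<And>x. x \<in> sphere 0 1 \<Longrightarrow> v x \<le> K * \<bar>x \<bullet> b\<bar> ^ k" and K: "K > 0"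
    and k: "real k * (2 * real n / (2 * s - real n)) > 1"
  shows "sobolev_infimum TYPE('a) n s = -\<infinity>"
proof -
  define q where "q = 2 * real n / (2 * s - real n)"
  define P where "P = (2 * s - real n) / real n"
  define A where "A = (\<Sum>l\<le>N. alpha n s l * (LINT x|surface_measure. (p l x)\<^sup>2))"
  define e where "e = real k * q - 1"
  have sn: "2 * s - real n > 0" using s by simp
  have q: "q > 0" and P: "P > 0" and e: "e > 0" and A: "A < 0"
    using sn n k neg by (auto simp: q_def P_def e_def A_def)
  have k1: "k \<ge> 1" using k by (cases k) auto
  obtain c where c: "c > 0" and slab: "\<And>\<delta>. 0 < \<delta> \<Longrightarrow> \<delta> \<le> 1 \<Longrightarrow>
      c * \<delta> \<le> measure surface_measure {x :: 'a \<in> sphere 0 1. \<bar>x \<bullet> b\<bar> \<le> \<delta>}"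
    using surface_slab[OF b d] by blast
  define I where "I = (LINT x|(surface_measure :: 'a measure). p 0 x)"
  define S where "S = (LINT x|(surface_measure :: 'a measure). (1::real))"
  define w where "w = (\<lambda>\<epsilon> x. v x + \<epsilon>)"
  \<comment> \<open>A constant is a harmonic of degree 0, so the shift by \<epsilon> is absorbed
    there and the expansion remains harmonic.\<close>
  define p' where "p' = (\<lambda>(\<epsilon>::real) l (x::'a). p l x + (if l = 0 then \<epsilon> else 0))"
  have p': "p' \<epsilon> l \<in> homogeneous_harmonic_polynomials l" for \<epsilon> l
    unfolding p'_def by (intro homogeneous_harmonic_add p)
      (auto simp: homogeneous_harmonic_zero homogeneous_harmonic_const)
  have w: "w \<epsilon> x = (\<Sum>l\<le>N. p' \<epsilon> l x)" if "x \<in> sphere 0 1" for \<epsilon> x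
    using v[OF that] by (simp add: w_def p'_def sum.distrib)
  have ip: "integrable surface_measure (p l)" "integrable surface_measure (\<lambda>x. (p l x)\<^sup>2)" for l
    by (intro continuous_integrable_surface continuous_intros rpf_continuous homogeneous_harmonicD(1)[OF p])+
  have aw: "a_form n s (w \<epsilon>) = A + alpha n s 0 * (2 * \<epsilon> * I + \<epsilon>\<^sup>2 * S)" for \<epsilon>
  proof -
    have "(LINT x|surface_measure. (p' \<epsilon> l x)\<^sup>2)
        = (LINT x|surface_measure. (p l x)\<^sup>2) + (if l = 0 then 2 * \<epsilon> * I + \<epsilon>\<^sup>2 * S else 0)" for l
    proof (cases "l = 0")
      case True
      have "(\<lambda>x. (p 0 x + \<epsilon>)\<^sup>2) = (\<lambda>x. (p 0 x)\<^sup>2 + (2 * \<epsilon> * p 0 x + \<epsilon>\<^sup>2 * 1))"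
        by (auto simp: power2_eq_square algebra_simps)
      then have "(LINT x|surface_measure. (p 0 x + \<epsilon>)\<^sup>2) = (LINT x|surface_measure. (p 0 x)\<^sup>2) + (2 * \<epsilon> * I + \<epsilon>\<^sup>2 * S)"
        using ip by (simp add: I_def S_def)
      then show ?thesis using True by (simp add: p'_def)
    qed (simp add: p'_def)
    then have "a_form n s (w \<epsilon>) = (\<Sum>l\<le>N. alpha n s l * (LINT x|surface_measure. (p l x)\<^sup>2)
        + (if l = 0 then alpha n s 0 * (2 * \<epsilon> * I + \<epsilon>\<^sup>2 * S) else 0))"
      using harmonic_sum_sobolev(3)[where u = "w \<epsilon>" and p = "p' \<epsilon>", OF w p', of n s] by (auto simp: distrib_left intro!: sum.cong)
    then show ?thesis
      unfolding A_def sum.distrib by simp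
  qed
  have "((\<lambda>\<epsilon>. alpha n s 0 * (2 * \<epsilon> * I + \<epsilon>\<^sup>2 * S)) \<longlongrightarrow> alpha n s 0 * (2 * 0 * I + 0\<^sup>2 * S)) (at_right 0)"
    by (intro tendsto_intros)
  \<comment> \<open>For such \<epsilon> the form of \<open>w \<epsilon>\<close> is below
    \<open>A / 2\<close>.\<close>
  then have "eventually (\<lambda>\<epsilon>. alpha n s 0 * (2 * \<epsilon> * I + \<epsilon>\<^sup>2 * S) < - A / 2) (at_right 0)"
    by (rule order_tendstoD(2)) (use A in simp)
  then obtain \<epsilon>0 where \<epsilon>0: "\<epsilon>0 > 0" "\<And>\<epsilon>. 0 < \<epsilon> \<Longrightarrow> \<epsilon> < \<epsilon>0 \<Longrightarrow> alpha n s 0 * (2 * \<epsilon> * I + \<epsilon>\<^sup>2 * S) < - A / 2"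
    by (auto simp: eventually_at_right_field)
  have pos: "w \<epsilon> \<in> positive_sobolev_sphere n s" if "\<epsilon> > 0" for \<epsilon>
    unfolding positive_sobolev_sphere_def
    using harmonic_sum_sobolev(1,2)[where u = "w \<epsilon>" and p = "p' \<epsilon>", OF w p'] v0 that by (auto simp: w_def intro!: add_nonneg_pos)
  have lower: "(K + 1) powr (-q) * c * \<delta> powr (-e) \<le> (LINT x|surface_measure. w (\<delta> ^ k) x powr (- q))"
    if \<delta>: "0 < \<delta>" "\<delta> \<le> 1" for \<delta>
  proof -
    let ?D = "{x :: 'a \<in> sphere 0 1. \<bar>x \<bullet> b\<bar> \<le> \<delta>}"
    define C where "C = ((K + 1) * \<delta> ^ k) powr (-q)"
    have D: "?D \<in> sets surface_measure"
    proof -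
      have "?D = sphere 0 1 \<inter> {x. \<bar>x \<bullet> b\<bar> \<le> \<delta>}" by auto
      moreover have "closed {x. \<bar>x \<bullet> b\<bar> \<le> \<delta>}"
        by (intro closed_Collect_le continuous_intros)
      ultimately show ?thesis
        by (auto simp: sets_surface_measure sets_restrict_space)
    qed
    have "(K + 1) powr (-q) * c * \<delta> powr (-e) = C * (c * \<delta>)"
    proof -
      have "(\<delta> ^ k) powr (-q) * \<delta> = \<delta> powr (-e)"
      proof -
        have "(\<delta> ^ k) powr (-q) * \<delta> = (\<delta> powr real k) powr (-q) * \<delta> powr 1"
          using \<delta> by (simp add: powr_realpow)
        also have "\<dots> = \<delta> powr (real k * (-q) + 1)"
          unfolding powr_powr powr_add ..
        finally show ?thesis by (simp add: e_def)
      qed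
      then show ?thesis
        using K \<delta> by (simp add: C_def powr_mult)
    qed
    also have "\<dots> \<le> C * measure surface_measure ?D"
      by (intro mult_left_mono slab \<delta>) (simp add: C_def)
    also have "\<dots> = (LINT x|surface_measure. C * indicat_real ?D x)"
    proof -
      have "?D \<inter> space surface_measure = ?D" by auto
      then show ?thesis by (simp only: integral_mult_right_zero Bochner_Integration.integral_indicator)
    qed
    also have "\<dots> \<le> (LINT x|surface_measure. w (\<delta> ^ k) x powr (- q))"
    proof (rule integral_mono)
      show "integrable surface_measure (\<lambda>x. C * indicat_real ?D x)"
        using D by (intro integrable_mult_right integrable_real_indicator)
          (simp_all add: surface_measure.emeasure_eq_measure)
      have "w (\<delta> ^ k) x \<noteq> 0" if "x \<in> sphere 0 1" for x
        using pos[of "\<delta> ^ k"] \<delta> that by (force simp: positive_sobolev_sphere_def)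
      then show "integrable surface_measure (\<lambda>x. w (\<delta> ^ k) x powr (- q))"
        by (intro continuous_integrable_surface continuous_intros harmonic_sum_sobolev(2)[where u = "w (\<delta> ^ k)" and p = "p' (\<delta> ^ k)", OF w p']) auto
      fix x :: 'a assume "x \<in> space surface_measure"
      then have x: "x \<in> sphere 0 1" by simp
      show "C * indicat_real ?D x \<le> w (\<delta> ^ k) x powr (- q)"
      proof (cases "x \<in> ?D")
        case True
        have "w (\<delta> ^ k) x \<le> K * \<bar>x \<bullet> b\<bar> ^ k + \<delta> ^ k"
          using vK[OF x] by (simp add: w_def)
        also have "\<dots> \<le> K * \<delta> ^ k + \<delta> ^ k"
          using True K by (intro add_right_mono mult_left_mono power_mono) auto
        finally have "w (\<delta> ^ k) x \<le> (K + 1) * \<delta> ^ k" by (simp add: algebra_simps)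
        moreover have "0 < w (\<delta> ^ k) x"
          using v0[OF x] \<delta> by (simp add: w_def add_nonneg_pos)
        ultimately have "C \<le> w (\<delta> ^ k) x powr (- q)"
          unfolding C_def using q by (intro powr_mono2') auto
        then show ?thesis using True by simp
      qed simp
    qed
    finally show ?thesis .
  qed
  show ?thesis
  proof (rule ereal_bot)
    fix B :: real
    \<comment> \<open>With this bound on the integral factor,
      \<open>R * (A / 2) \<le> - \<bar>B\<bar> \<le> B\<close>.\<close>
    define R where "R = max 1 (2 * \<bar>B\<bar> / (- A))"
    define c' where "c' = (K + 1) powr (-q) * c"
    have c': "c' > 0" using c K by (simp add: c'_def)
    \<comment> \<open>The solution of \<open>c' * \<delta> powr (-e) = R powr (1 / P)\<close>; a
      smaller \<delta> only enlarges the lower bound for the integral.\<close>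
    define \<delta>1 where "\<delta>1 = (R powr (1 / P) / c') powr (- (1 / e))"
    have R: "R > 0" by (simp add: R_def)
    have \<delta>1: "\<delta>1 > 0" using R c' by (simp add: \<delta>1_def)
    define \<delta> where "\<delta> = min (min 1 \<delta>1) (\<epsilon>0 / 2)"
    have \<delta>: "0 < \<delta>" "\<delta> \<le> 1" "\<delta> \<le> \<delta>1" "\<delta> < \<epsilon>0" using \<delta>1 \<epsilon>0 by (auto simp: \<delta>_def)
    have "\<delta> ^ k \<le> \<delta> ^ 1" using \<delta> k1 by (intro power_decreasing) auto
    then have \<epsilon>: "0 < \<delta> ^ k" "\<delta> ^ k < \<epsilon>0" using \<delta> by auto
    let ?N = "LINT x|surface_measure. w (\<delta> ^ k) x powr (- q)"
    have "R powr (1 / P) / c' = \<delta>1 powr (-e)"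
      unfolding \<delta>1_def powr_powr using e R c' by simp
    also have "\<dots> \<le> \<delta> powr (-e)"
      using \<delta> e by (intro powr_mono2') auto
    finally have "R powr (1 / P) \<le> c' * \<delta> powr (-e)"
      using c' by (simp add: pos_divide_le_eq mult.commute)
    also have "\<dots> \<le> ?N" using lower[OF \<delta>(1,2)] by (simp add: c'_def)
    finally have "(R powr (1 / P)) powr P \<le> ?N powr P"
      using P by (intro powr_mono2) auto
    then have RN: "R \<le> ?N powr P" using P R by (simp add: powr_powr)
    have "a_form n s (w (\<delta> ^ k)) \<le> A / 2"
      using \<epsilon>0(2)[OF \<epsilon>] by (simp add: aw)
    then have "sobolev_quotient n s (w (\<delta> ^ k)) \<le> ?N powr P * (A / 2)"
      unfolding sobolev_quotient_def q_def[symmetric] P_def[symmetric] by (intro mult_left_mono) auto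
    also have "\<dots> \<le> R * (A / 2)"
      using RN A by (intro mult_right_mono_neg) auto
    also have "\<dots> \<le> B"
    proof -
      have "2 * \<bar>B\<bar> / (- A) \<le> R" by (simp add: R_def)
      moreover have "- A > 0" using A by simp
      ultimately have "2 * \<bar>B\<bar> \<le> R * (- A)" by (simp only: pos_divide_le_eq)
      then show ?thesis by linarith
    qed
    finally have "ereal (sobolev_quotient n s (w (\<delta> ^ k))) \<le> ereal B" by simp
    then show "sobolev_infimum TYPE('a) n s \<le> ereal B"
      unfolding sobolev_infimum_def by (rule INF_lower2[OF pos[OF \<epsilon>(1)]])
  qed
qed

section \<open>Non-attainment on the circle\<close>

definition planar :: "'a::euclidean_space \<Rightarrow> 'a \<Rightarrow> 'a \<Rightarrow> complex" where
  "planar e f x = Complex (x \<bullet> e) (x \<bullet> f)"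

text \<open>On the circle \<open>c = 1\<close> gives the cosine and \<open>c = \<i>\<close> the
  negative sine of the \<open>k\<close>-fold angle. One complex coefficient thus parametrises both
  harmonics of degree \<open>k\<close>.\<close>

definition planar_harmonic :: "'a::euclidean_space \<Rightarrow> 'a \<Rightarrow> complex \<Rightarrow> nat \<Rightarrow> 'a \<Rightarrow> real" where
  "planar_harmonic e f c k x = Re (c * planar e f x ^ k)"

lemma planar_has_derivative: "(planar e f has_derivative planar e f) (at x)"
proof -
  have "(\<lambda>x. complex_of_real (x \<bullet> e) + \<i> * complex_of_real (x \<bullet> f)) = planar e f"
    by (auto simp: planar_def complex_eq_iff)
  moreover have "((\<lambda>x. complex_of_real (x \<bullet> e) + \<i> * complex_of_real (x \<bullet> f)) has_derivative
      (\<lambda>x. complex_of_real (x \<bullet> e) + \<i> * complex_of_real (x \<bullet> f))) (at x)"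
    by (auto intro!: derivative_eq_intros)
  ultimately show ?thesis by simp
qed

lemma dird_planar_harmonic:
  "dird v (planar_harmonic e f c k) = planar_harmonic e f (c * of_nat k * planar e f v) (k - 1)"
proof
  fix x
  have "((\<lambda>x. c * planar e f x ^ k) has_derivative (\<lambda>v. c * (of_nat k * planar e f v * planar e f x ^ (k - 1)))) (at x)"
    by (intro has_derivative_mult_right has_derivative_power planar_has_derivative)
  from bounded_linear.has_derivative[OF bounded_linear_Re this]
  show "dird v (planar_harmonic e f c k) x = planar_harmonic e f (c * of_nat k * planar e f v) (k - 1) x"
    unfolding planar_harmonic_def[abs_def] by (subst dirdI) (auto simp: mult_ac)
qed

lemma Re_of_real_mult: "Re (of_real r * w) = r * Re w"
  by simp

lemma planar_harmonic_Suc: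
  "planar_harmonic e f c (Suc k) x
    = (x \<bullet> e) * planar_harmonic e f c k x + (x \<bullet> f) * planar_harmonic e f (\<i> * c) k x"
proof -
  have "c * planar e f x ^ Suc k = complex_of_real (x \<bullet> e) * (c * planar e f x ^ k)
      + complex_of_real (x \<bullet> f) * (\<i> * c * planar e f x ^ k)"
    by (simp add: planar_def complex_eq_iff algebra_simps)
  then show ?thesis
    unfolding planar_harmonic_def by (simp only: plus_complex.sel Re_of_real_mult)
qed

lemma rpf_planar_harmonic: "real_polynomial_function (planar_harmonic e f c k)"
proof (induction k arbitrary: c)
  case 0
  have "planar_harmonic e f c 0 = (\<lambda>x. Re c)" by (simp add: planar_harmonic_def[abs_def])
  then show ?case by (simp add: rpf_const)
next
  case (Suc k)
  have "planar_harmonic e f c (Suc k)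
      = (\<lambda>x. (x \<bullet> e) * planar_harmonic e f c k x + (x \<bullet> f) * planar_harmonic e f (\<i> * c) k x)"
    by (rule ext) (rule planar_harmonic_Suc)
  then show ?case by (simp add: rpf_add rpf_mult rpf_inner Suc)
qed

text \<open>Each derivative along \<open>v\<close> multiplies the coefficient by
  \<open>planar e f v\<close>, which is 1 for \<open>e\<close> and \<open>\<i>\<close> for
  \<open>f\<close>, so the two second derivatives cancel by \<open>\<i>^2 = -1\<close>.\<close>

lemma planar_harmonic_mem:
  fixes e f :: "'a::euclidean_space"
  assumes B: "Basis = {e, f}" "e \<noteq> f"
  shows "planar_harmonic e f c k \<in> homogeneous_harmonic_polynomials k"
  unfolding homogeneous_harmonic_polynomials_def
proof (intro CollectI conjI allI rpf_planar_harmonic)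
  fix t x
  have "planar e f (t *\<^sub>R x) = of_real t * planar e f x"
    by (simp add: planar_def complex_eq_iff)
  then have "c * planar e f (t *\<^sub>R x) ^ k = of_real (t ^ k) * (c * planar e f x ^ k)"
    by (simp add: power_mult_distrib mult_ac)
  then show "planar_harmonic e f c k (t *\<^sub>R x) = t ^ k * planar_harmonic e f c k x"
    unfolding planar_harmonic_def by (simp only: Re_of_real_mult)
next
  fix x
  have "e \<in> Basis" "f \<in> Basis" using B by auto
  then have "planar e f e = 1" "planar e f f = \<i>"
    using B(2) by (auto simp: planar_def inner_Basis complex_eq_iff)
  then show "laplacian (planar_harmonic e f c k) x = 0"
    using B(2) unfolding laplacian_rpf[OF rpf_planar_harmonic] B(1)
    by (simp add: dird_planar_harmonic) (simp add: planar_harmonic_def)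
qed

text \<open>Induction on the degree. Both partial derivatives have the form
  \<open>Re (a z^k)\<close> and \<open>Re (d z^k)\<close>; symmetry of second derivatives and
  Laplace's equation amount to \<open>d = \<i> * a\<close>, the Cauchy-Riemann relation. Euler's
  identity then recovers \<open>p\<close>.\<close>

lemma planar_harmonic_exhaust:
  fixes e f :: "'a::euclidean_space"
  assumes B: "Basis = {e, f}" "e \<noteq> f" and p: "p \<in> homogeneous_harmonic_polynomials k"
  shows "\<exists>c. p = planar_harmonic e f c k"
  using p
proof (induction k arbitrary: p)
  case 0
  have "p x = p 0" for x
    using homogeneous_harmonicD(2)[OF 0, of 0 x] by simp
  then have "p = planar_harmonic e f (of_real (p 0)) 0"
    by (auto simp: planar_harmonic_def fun_eq_iff)
  then show ?case ..
next
  case (Suc k)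
  note rp = homogeneous_harmonicD(1)[OF Suc.prems]
  have h: "\<And>t x. p (t *\<^sub>R x) = t ^ Suc k * p x" by (rule homogeneous_harmonicD(2)[OF Suc.prems])
  have ef: "e \<in> Basis" "f \<in> Basis" using B by auto
  have z: "planar e f e = 1" "planar e f f = \<i>"
    using B(2) ef by (auto simp: planar_def inner_Basis complex_eq_iff)
  have lap: "dird e (dird e p) x + dird f (dird f p) x = 0" for x
    using homogeneous_harmonicD(3)[OF Suc.prems, of x] B(2) unfolding laplacian_rpf[OF rp] B(1) by simp
  have D: "dird b p \<in> homogeneous_harmonic_polynomials k" for b
    unfolding homogeneous_harmonic_polynomials_def
  proof (intro CollectI conjI allI rpf_dird rp)
    show "dird b p (t *\<^sub>R x) = t ^ k * dird b p x" for t x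
      by (rule dird_homogeneous_pred[OF rp h])
    have comm: "dird i (dird i (dird b p)) = dird b (dird i (dird i p))" for i
      by (simp add: dird_commute[of _ _ b] rp rpf_dird)
    have "laplacian (dird b p) x = dird e (dird e (dird b p)) x + dird f (dird f (dird b p)) x" for x
      using B(2) unfolding laplacian_rpf[OF rpf_dird[OF rp]] B(1) by simp
    also have "\<dots> x = dird b (\<lambda>x. dird e (dird e p) x + dird f (dird f p) x) x" for x
      by (simp add: comm dird_add rpf_dird rp)
    finally show "laplacian (dird b p) x = 0" for x by (simp add: lap)
  qed
  obtain a where a: "dird e p = planar_harmonic e f a k" using Suc.IH[OF D] by blast
  obtain d where d: "dird f p = planar_harmonic e f d k" using Suc.IH[OF D] by blast
  have p: "real (Suc k) * p x = (x \<bullet> e) * planar_harmonic e f a k x + (x \<bullet> f) * planar_harmonic e f d k x" for x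
    using dird_homogeneous[OF rp h, of x] B(2) unfolding dird_euclidean[OF rp, of x] B(1)
    by (simp add: a d)
  show ?case
  proof (cases "k = 0")
    case True
    \<comment> \<open>In degree 1 the partial derivatives are constants and determine only the real
      parts of \<open>a\<close> and \<open>d\<close>, so the coefficient is assembled from
      these.\<close>
    have "p x = planar_harmonic e f (Complex (Re a) (- Re d)) (Suc k) x" for x
      using p[of x] True by (simp add: planar_harmonic_def planar_def)
    then show ?thesis by blast
  next
    case False
    have "dird f (dird e p) e = dird e (dird f p) e"
      by (simp add: dird_commute[of p e f] rp)
    then have "Re (\<i> * a) * real k = Re d * real k"
      unfolding a d by (simp add: dird_planar_harmonic z) (simp add: planar_harmonic_def z algebra_simps)
    moreover have "real k \<noteq> 0" using False by simp
    ultimately have 1: "Re (\<i> * a) = Re d" by (metis mult_right_cancel)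
    have "Re a * real k + Re (\<i> * d) * real k = 0"
      using lap[of e] unfolding a d
      by (simp add: dird_planar_harmonic z) (auto simp: planar_harmonic_def z algebra_simps)
    then have "(Re a + Re (\<i> * d)) * real k = 0" by (simp only: distrib_right)
    then have 2: "Re a + Re (\<i> * d) = 0" using False by (metis mult_eq_0_iff of_nat_eq_0_iff)
    have "d = \<i> * a"
      using 1 2 by (simp add: complex_eq_iff)
    then have "real (Suc k) * p x = planar_harmonic e f a (Suc k) x" for x
      unfolding p planar_harmonic_Suc by simp
    then have "p x = planar_harmonic e f (a / of_nat (Suc k)) (Suc k) x" for x
    proof -
      have "planar_harmonic e f a (Suc k) x = real (Suc k) * planar_harmonic e f (a / of_nat (Suc k)) (Suc k) x"
      proof -
        have "a * w = of_real (real (Suc k)) * (a / of_nat (Suc k) * w)" for w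
          by (simp del: of_nat_Suc)
        then show ?thesis
          unfolding planar_harmonic_def Re_of_real_mult[symmetric] by (rule arg_cong)
      qed
      then show ?thesis
        using \<open>\<And>x. real (Suc k) * p x = planar_harmonic e f a (Suc k) x\<close>[of x] by (simp del: of_nat_Suc)
    qed
    then show ?thesis by blast
  qed
qed

lemma surface_area_pos:
  assumes "b \<in> (Basis :: 'a::euclidean_space set)"
  shows "(LINT x|(surface_measure :: 'a measure). (1::real)) > 0"
proof -
  have "(LINT x|(surface_measure :: 'a measure). (1::real)) \<noteq> 0"
    using surface_integral_zero[of "\<lambda>x::'a. 1" b] assms by auto
  moreover have "(LINT x|(surface_measure :: 'a measure). (1::real)) \<ge> 0"
    by (rule Bochner_Integration.integral_nonneg) simp
  ultimately show ?thesis by linarith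
qed

lemma cmod_planar:
  fixes e f :: "'a::euclidean_space"
  assumes B: "Basis = {e, f}" "e \<noteq> f" and x: "x \<in> sphere 0 1"
  shows "cmod (planar e f x) = 1"
proof -
  have "(cmod (planar e f x))\<^sup>2 = (x \<bullet> e)\<^sup>2 + (x \<bullet> f)\<^sup>2"
    by (simp add: cmod_power2 planar_def)
  also have "\<dots> = x \<bullet> x"
    using B(2) euclidean_inner[of x x] by (simp add: B(1) power2_eq_square)
  also have "\<dots> = 1" using x by (simp add: dot_square_norm)
  finally show ?thesis
    using power2_eq_1_iff[of "cmod (planar e f x)"] norm_ge_zero[of "planar e f x"] by linarith
qed

text \<open>A product of real parts is half the real part of the product plus half that of the
  product with one conjugate. The former is a harmonic of degree \<open>2 k > 0\<close> with
  integral zero; the latter is constant because \<open>z\<close> has modulus 1 on the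
  circle.\<close>

lemma planar_harmonic_energy:
  fixes e f :: "'a::euclidean_space"
  assumes B: "Basis = {e, f}" "e \<noteq> f" and k: "k \<ge> 1"
  shows "(LINT x|surface_measure. planar_harmonic e f c k x * planar_harmonic e f d k x)
    = Re (c * cnj d) * ((LINT x|(surface_measure :: 'a measure). 1) / 2)"
proof -
  let ?P = "planar_harmonic e f"
  have "(LINT x|surface_measure. ?P (c * d / 2) (2 * k) x * 1) = 0"
    by (rule harmonic_orthogonal[OF planar_harmonic_mem[OF B] homogeneous_harmonic_const]) (use k in simp)
  then have 0: "(LINT x|surface_measure. ?P (c * d / 2) (2 * k) x) = 0" by simp
  have "(LINT x|surface_measure. ?P c k x * ?P d k x)
      = (LINT x|surface_measure. ?P (c * d / 2) (2 * k) x + Re (c * cnj d) / 2 * 1)"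
  proof (rule surface_integral_cong)
    fix x :: 'a assume x: "x \<in> sphere 0 1"
    define w where "w = planar e f x ^ k"
    have "cmod (planar e f x) = 1" by (rule cmod_planar[OF B x])
    then have "cmod w = 1" by (simp add: w_def norm_power)
    then have ww: "w * cnj w = 1" by (simp add: complex_norm_square[symmetric])
    have "Re (c * w) * Re (d * w) = Re ((c * w) * (d * w)) / 2 + Re ((c * w) * cnj (d * w)) / 2"
      by (simp add: field_simps)
    also have "(c * w) * cnj (d * w) = c * cnj d * (w * cnj w)" by (simp add: mult_ac)
    also have "\<dots> = c * cnj d" by (simp add: ww)
    also have "Re ((c * w) * (d * w)) / 2 = Re (c * d / 2 * w\<^sup>2)"
      by (simp add: power2_eq_square mult_ac)
    finally show "?P c k x * ?P d k x = ?P (c * d / 2) (2 * k) x + Re (c * cnj d) / 2 * 1"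
      by (simp add: planar_harmonic_def w_def power_mult mult.commute[of 2 k])
  qed
  also have "\<dots> = Re (c * cnj d) * ((LINT x|(surface_measure :: 'a measure). 1) / 2)"
  proof -
    have "integrable surface_measure (?P (c * d / 2) (2 * k))"
      by (intro continuous_integrable_surface rpf_continuous rpf_planar_harmonic)
    then show ?thesis
      by (subst Bochner_Integration.integral_add) (simp_all add: 0)
  qed
  finally show ?thesis .
qed

lemma planar_harmonic_split:
  "planar_harmonic e f c k x = Re c * planar_harmonic e f 1 k x + Im c * planar_harmonic e f \<i> k x"
  by (simp add: planar_harmonic_def)

lemma planar_inner_split:
  assumes u: "u \<in> L2_sphere"
  shows "(LINT x|surface_measure. u x * planar_harmonic e f c k x)
    = Re c * (LINT x|surface_measure. u x * planar_harmonic e f 1 k x)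
      + Im c * (LINT x|surface_measure. u x * planar_harmonic e f \<i> k x)"
proof -
  have int: "integrable surface_measure (\<lambda>x. u x * planar_harmonic e f d k x)" for d
    by (intro integrable_L2_mult u rpf_L2_sphere rpf_planar_harmonic)
  have "(\<lambda>x. u x * planar_harmonic e f c k x) = (\<lambda>x. Re c * (u x * planar_harmonic e f 1 k x)
      + Im c * (u x * planar_harmonic e f \<i> k x))"
    by (rule ext) (subst planar_harmonic_split, simp add: algebra_simps)
  then show ?thesis by (simp add: int)
qed

text \<open>Supplies the witness \<open>p\<close> that \<open>harmonic_perturbation\<close> expects:
  the Fourier coefficients of \<open>u\<close> of order \<open>k\<close>.
  \<open>planar_harmonic_exhaust\<close> ensures that orthogonality holds against every harmonic of
  that degree.\<close>

lemma planar_projection_exists: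
  fixes e f :: "'a::euclidean_space" and u :: "'a \<Rightarrow> real"
  assumes B: "Basis = {e, f}" "e \<noteq> f" and k: "k \<ge> 1" and u: "u \<in> L2_sphere"
  obtains p :: "'a \<Rightarrow> real" where "p \<in> homogeneous_harmonic_polynomials k"
    "\<And>q. q \<in> homogeneous_harmonic_polynomials k \<Longrightarrow> (LINT x|surface_measure. (u x - p x) * q x) = 0"
proof
  \<comment> \<open>The squared norm of each of the two basis harmonics.\<close>
  define H where "H = (LINT x|(surface_measure :: 'a measure). (1::real)) / 2"
  have "e \<in> Basis" unfolding B(1) by simp
  then have H: "H > 0" using surface_area_pos[of e] by (simp add: H_def)
  define I where "I = (\<lambda>d. LINT x|surface_measure. u x * planar_harmonic e f d k x)"
  define c where "c = Complex (I 1 / H) (I \<i> / H)"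
  show "planar_harmonic e f c k \<in> homogeneous_harmonic_polynomials k" by (rule planar_harmonic_mem[OF B])
  fix q :: "'a \<Rightarrow> real" assume "q \<in> homogeneous_harmonic_polynomials k"
  then obtain d where q: "q = planar_harmonic e f d k" using planar_harmonic_exhaust[OF B] by blast
  have "(LINT x|surface_measure. (u x - planar_harmonic e f c k x) * q x)
      = I d - (LINT x|surface_measure. planar_harmonic e f c k x * planar_harmonic e f d k x)"
    unfolding q I_def left_diff_distrib
    by (intro Bochner_Integration.integral_diff integrable_L2_mult u rpf_L2_sphere rpf_planar_harmonic)
  also have "\<dots> = Re d * I 1 + Im d * I \<i> - Re (c * cnj d) * H"
    unfolding planar_harmonic_energy[OF B k] H_def I_def by (subst planar_inner_split[OF u]) simp
  also have "\<dots> = 0"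
    using H by (simp add: c_def field_simps)
  finally show "(LINT x|surface_measure. (u x - planar_harmonic e f c k x) * q x) = 0" .
qed

lemma planar_orthogonal_exists:
  fixes e f :: "'a::euclidean_space" and u :: "'a \<Rightarrow> real"
  assumes B: "Basis = {e, f}" "e \<noteq> f" and k: "k \<ge> 1" and u: "u \<in> L2_sphere"
  obtains q :: "'a \<Rightarrow> real" where "q \<in> homogeneous_harmonic_polynomials k" "(LINT x|surface_measure. u x * q x) = 0"
    "(LINT x|surface_measure. (q x)\<^sup>2) > 0"
proof -
  define I where "I = (\<lambda>d. LINT x|surface_measure. u x * planar_harmonic e f d k x)"
  \<comment> \<open>Orthogonality to \<open>u\<close> is one linear equation for the pair
    \<open>Re c\<close>, \<open>Im c\<close>; the swapped pair with one sign changed solves it,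
    unless both integrals vanish and any \<open>c\<close> will do.\<close>
  define c where "c = (if I 1 = 0 \<and> I \<i> = 0 then 1 else Complex (- I \<i>) (I 1))"
  have c: "c \<noteq> 0" by (auto simp: c_def complex_eq_iff)
  have "I c = Re c * I 1 + Im c * I \<i>"
    unfolding I_def by (rule planar_inner_split[OF u])
  then have "I c = 0" by (simp add: c_def)
  moreover have "(LINT x|surface_measure. (planar_harmonic e f c k x)\<^sup>2) > 0"
  proof -
    have "Re (c * cnj c) > 0" using c by (simp add: complex_neq_0 power2_eq_square)
    moreover have "e \<in> Basis" unfolding B(1) by simp
    ultimately show ?thesis
      using surface_area_pos[of e] unfolding power2_eq_square planar_harmonic_energy[OF B k] by simp
  qed
  ultimately show ?thesis
    using planar_harmonic_mem[OF B] that unfolding I_def by blast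
qed

section \<open>Convexity, perturbation of a minimiser, and a competitor with negative form\<close>

lemma powr_neg_midpoint:
  fixes x y r :: real
  assumes "x > 0" "y > 0" "r \<ge> 0"
  shows "2 * ((x + y) / 2) powr (- r) \<le> x powr (- r) + y powr (- r)"
proof -
  \<comment> \<open>Midpoint convexity in two steps through the geometric mean: it is at most the
    arithmetic mean, and it is compared with the sum of the negative powers by the inequality
    between squares and products.\<close>
  have "x * y \<le> ((x + y) / 2)\<^sup>2"
    using zero_le_power2[of "x - y"] by (simp add: power2_eq_square algebra_simps)
  then have "(((x + y) / 2)\<^sup>2) powr (- (r / 2)) \<le> (x * y) powr (- (r / 2))"
    using assms by (intro powr_mono2') auto
  moreover have "((x + y) / 2) powr (- r) = (((x + y) / 2)\<^sup>2) powr (- (r / 2))"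
  proof -
    have "((x + y) / 2)\<^sup>2 = ((x + y) / 2) powr 2" using assms by (simp add: powr_numeral)
    then show ?thesis by (simp only: powr_powr) simp
  qed
  moreover have "2 * (x * y) powr (- (r / 2)) \<le> x powr (- r) + y powr (- r)"
  proof -
    have "(z powr (- (r / 2)))\<^sup>2 = z powr (- r)" for z :: real
      by (simp add: power2_eq_square flip: powr_add)
    then show ?thesis
      using sum_squares_bound[of "x powr (- (r / 2))" "y powr (- (r / 2))"] assms by (simp add: powr_mult)
  qed
  ultimately show ?thesis by linarith
qed

lemma surface_integral_powr_pos:
  fixes u :: "'a::euclidean_space \<Rightarrow> real"
  assumes b: "b \<in> (Basis :: 'a set)" and uc: "continuous_on (sphere 0 1) u"
    and up: "\<And>x. x \<in> sphere 0 1 \<Longrightarrow> u x > 0"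
  shows "(LINT x|surface_measure. u x powr r) > 0"
proof -
  have bS: "b \<in> sphere 0 1" using b by simp
  have "(LINT x|surface_measure. u x powr r) \<noteq> 0"
  proof
    assume "(LINT x|surface_measure. u x powr r) = 0"
    moreover have "continuous_on (sphere 0 1) (\<lambda>x. u x powr r)"
      by (intro continuous_intros uc) (use up in force)
    ultimately have "u b powr r = 0"
      by (intro surface_integral_zero[OF _ _ _ bS, where f = "\<lambda>x. u x powr r"]) auto
    then show False using up[OF bS] by simp
  qed
  moreover have "(LINT x|surface_measure. u x powr r) \<ge> 0"
    by (rule Bochner_Integration.integral_nonneg) simp
  ultimately show ?thesis by linarith
qed

lemma sobolev_quotient_neg_iff:
  fixes u :: "'a::euclidean_space \<Rightarrow> real"
  assumes b: "b \<in> (Basis :: 'a set)" and u: "u \<in> positive_sobolev_sphere n s"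
  shows "sobolev_quotient n s u < 0 \<longleftrightarrow> a_form n s u < 0"
proof -
  have "(LINT x|surface_measure. u x powr r) > 0" for r
    using u by (intro surface_integral_powr_pos[OF b]) (auto simp: positive_sobolev_sphere_def)
  then show ?thesis
    by (simp add: sobolev_quotient_def mult_less_0_iff less_imp_neq[symmetric])
qed

text \<open>
  Convexity of \<open>t \<mapsto> t\<^sup>-\<^sup>r\<close> keeps the integral from decreasing along \<open>q\<close> or along \<open>-q\<close>, while the
  negative quadratic form decreases along both.
\<close>

lemma negative_not_minimizer:
  fixes u :: "'a::euclidean_space \<Rightarrow> real"
  assumes b: "b \<in> (Basis :: 'a set)" and n: "n \<ge> 1" and s: "s > real n / 2" and u: "u \<in> positive_sobolev_sphere n s"
    and sm: "summable (\<lambda>l. alpha n s l * (L2_sphere_norm (harmonic_projection l u))\<^sup>2)"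
    and au: "a_form n s u < 0" and am: "alpha n s m < 0"
    and p: "p \<in> homogeneous_harmonic_polynomials m"
    and pu: "\<And>q. q \<in> homogeneous_harmonic_polynomials m \<Longrightarrow> (LINT x|surface_measure. (u x - p x) * q x) = 0"
    and q: "q \<in> homogeneous_harmonic_polynomials m" and uq: "(LINT x|surface_measure. u x * q x) = 0"
    and qq: "(LINT x|surface_measure. (q x)\<^sup>2) > 0"
  obtains v :: "'a \<Rightarrow> real" where "v \<in> positive_sobolev_sphere n s" "sobolev_quotient n s v < sobolev_quotient n s u"
proof -
  define r where "r = 2 * real n / (2 * s - real n)"
  define P where "P = (2 * s - real n) / real n"
  have r: "r > 0" and P: "P > 0" using s n by (auto simp: r_def P_def)
  have uS: "u \<in> sobolev_sphere n s" and uc: "continuous_on (sphere 0 1) u"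
    and up: "\<And>x. x \<in> sphere 0 1 \<Longrightarrow> u x > 0"
    using u by (auto simp: positive_sobolev_sphere_def)
  have bS: "b \<in> sphere 0 1" using b by simp
  have qc: "continuous_on (sphere 0 1) q" by (intro rpf_continuous homogeneous_harmonicD(1)[OF q])
  obtain x0 where x0: "x0 \<in> sphere 0 1" "\<And>x. x \<in> sphere 0 1 \<Longrightarrow> u x0 \<le> u x"
    using continuous_attains_inf[OF compact_sphere _ uc] bS by blast
  have "bounded (q ` sphere 0 1)"
    by (intro compact_imp_bounded compact_continuous_image qc compact_sphere)
  then obtain C where C: "C > 0" "\<And>x. x \<in> sphere 0 1 \<Longrightarrow> \<bar>q x\<bar> \<le> C"
    by (auto simp: bounded_pos)
  \<comment> \<open>Makes the perturbation at most half the minimum of \<open>u\<close> in absolute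
    value, so both signs keep the function positive.\<close>
  define c where "c = u x0 / (2 * C)"
  have c: "c > 0" using up[OF x0(1)] C(1) by (simp add: c_def)
  define w where "w = (\<lambda>\<sigma> x. u x + \<sigma> * c * q x)"
  have wp: "w \<sigma> x > 0" if "\<sigma> \<in> {-1, 1}" "x \<in> sphere 0 1" for \<sigma> x
  proof -
    have "\<bar>\<sigma> * c * q x\<bar> \<le> c * C"
      using that c C(2)[OF that(2)] by (auto simp: abs_mult)
    also have "\<dots> < u x0" using up[OF x0(1)] C(1) by (simp add: c_def)
    also have "\<dots> \<le> u x" by (rule x0(2)[OF that(2)])
    finally show ?thesis by (simp add: w_def)
  qed
  have wc: "continuous_on (sphere 0 1) (w \<sigma>)" for \<sigma>
    unfolding w_def by (intro continuous_intros uc qc)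
  have wpos: "w \<sigma> \<in> positive_sobolev_sphere n s" if "\<sigma> \<in> {-1, 1}" for \<sigma>
    unfolding positive_sobolev_sphere_def
    using harmonic_perturbation(1)[OF uS sm p pu q uq, of "\<sigma> * c"] wc[of \<sigma>] wp[OF that] by (auto simp: w_def)
  have aw: "a_form n s (w \<sigma>) < a_form n s u" if "\<sigma> \<in> {-1, 1}" for \<sigma>
  proof -
    have "alpha n s m * ((\<sigma> * c)\<^sup>2 * (LINT x|surface_measure. (q x)\<^sup>2)) < 0"
      using that c qq am by (intro mult_neg_pos mult_pos_pos) auto
    then show ?thesis
      using harmonic_perturbation(2)[OF uS sm p pu q uq, of "\<sigma> * c"] by (simp add: w_def)
  qed
  define J where "J = (\<lambda>v. LINT x|(surface_measure :: 'a measure). v x powr (- r))"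
  have int: "integrable surface_measure (\<lambda>x. v x powr (- r))"
    if "continuous_on (sphere 0 1) v" "\<And>x. x \<in> sphere 0 1 \<Longrightarrow> v x > 0" for v :: "'a \<Rightarrow> real"
    by (intro continuous_integrable_surface continuous_intros that) (use that(2) in force)
  have iu: "integrable surface_measure (\<lambda>x. u x powr (- r))" by (rule int[OF uc up])
  have iw: "integrable surface_measure (\<lambda>x. w \<sigma> x powr (- r))" if "\<sigma> \<in> {-1, 1}" for \<sigma>
    by (rule int[OF wc wp[OF that]])
  have "2 * J u \<le> J (w 1) + J (w (-1))"
  proof -
    have "2 * J u = (LINT x|surface_measure. 2 * u x powr (- r))" by (simp add: J_def)
    also have "\<dots> \<le> (LINT x|surface_measure. w 1 x powr (- r) + w (-1) x powr (- r))"
    proof (rule integral_mono)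
      fix x :: 'a assume "x \<in> space surface_measure"
      then have x: "x \<in> sphere 0 1" by simp
      have "(w 1 x + w (-1) x) / 2 = u x" by (simp add: w_def)
      then show "2 * u x powr (- r) \<le> w 1 x powr (- r) + w (-1) x powr (- r)"
        using powr_neg_midpoint[OF wp[OF _ x] wp[OF _ x], of 1 "-1" r] r by simp
    qed (use iu iw in auto)
    also have "\<dots> = J (w 1) + J (w (-1))"
      unfolding J_def by (rule Bochner_Integration.integral_add) (use iw in auto)
    finally show ?thesis .
  qed
  then obtain \<sigma> where \<sigma>: "\<sigma> \<in> {-1, 1}" "J u \<le> J (w \<sigma>)"
    by (cases "J u \<le> J (w 1)") force+
  have Ju: "J u > 0" unfolding J_def by (rule surface_integral_powr_pos[OF b uc up])
  have "sobolev_quotient n s (w \<sigma>) = J (w \<sigma>) powr P * a_form n s (w \<sigma>)"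
    unfolding sobolev_quotient_def J_def r_def P_def ..
  \<comment> \<open>The form is negative, so a larger integral factor only lowers the
    product.\<close>
  also have "\<dots> \<le> J u powr P * a_form n s (w \<sigma>)"
    using \<sigma> Ju P aw[OF \<sigma>(1)] au by (intro mult_right_mono_neg powr_mono2) auto
  also have "\<dots> < J u powr P * a_form n s u"
    using Ju aw[OF \<sigma>(1)] by (intro mult_strict_left_mono) auto
  also have "\<dots> = sobolev_quotient n s u"
    unfolding sobolev_quotient_def J_def r_def P_def ..
  finally show ?thesis using that[OF wpos[OF \<sigma>(1)]] by blast
qed

text \<open>Absolute values of the weights do not decrease up to degree \<open>m\<close>, and the
  last step, from \<open>m - 1\<close> to \<open>m\<close>, multiplies by more than 2. The factor 2
  compensates that the harmonic \<open>Re z^m\<close> has half the energy of the constant 1.\<close>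

lemma alpha_dominates:
  assumes m: "1 / 2 + real m < s" "s < 1 / 2 + real m + 1" and m2: "m \<ge> 2"
  shows "2 * \<bar>alpha 1 s 0\<bar> < \<bar>alpha 1 s m\<bar>"
proof -
  have m': "real 1 / 2 + real m < s" "s < real 1 / 2 + real m + 1" using m by simp_all
  have mono: "\<bar>alpha 1 s 0\<bar> \<le> \<bar>alpha 1 s l\<bar>" if "l \<le> m" for l
    using that
  proof (induction l)
    case (Suc l)
    have "1 \<le> (real l + real 1 / 2 + s) / (s - real 1 / 2 - real l)"
      using m Suc.prems by (simp add: le_divide_eq)
    then have "\<bar>alpha 1 s l\<bar> * 1 \<le> \<bar>alpha 1 s (Suc l)\<bar>"
      unfolding alpha_abs_Suc[OF m' Suc_le_lessD[OF Suc.prems]] by (intro mult_left_mono) auto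
    then show ?case using Suc by simp
  qed simp
  obtain k where k: "m = Suc k" "k \<ge> 1" using m2 by (cases m) auto
  have "2 < (real k + real 1 / 2 + s) / (s - real 1 / 2 - real k)"
    using m k by (simp add: less_divide_eq)
  moreover have "\<bar>alpha 1 s k\<bar> > 0"
    using alpha_sign[OF m', of k] k by auto
  ultimately have "\<bar>alpha 1 s k\<bar> * 2 < \<bar>alpha 1 s k\<bar> * ((real k + real 1 / 2 + s) / (s - real 1 / 2 - real k))"
    by (intro mult_strict_left_mono)
  also have "\<dots> = \<bar>alpha 1 s m\<bar>"
    unfolding k(1) by (rule alpha_abs_Suc[OF m', symmetric]) (simp add: k)
  finally have "\<bar>alpha 1 s k\<bar> * 2 < \<bar>alpha 1 s m\<bar>" .
  moreover have "\<bar>alpha 1 s 0\<bar> \<le> \<bar>alpha 1 s k\<bar>" by (rule mono) (simp add: k)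
  ultimately show ?thesis by linarith
qed

lemma planar_negative_exists:
  fixes e f :: "'a::euclidean_space"
  assumes B: "Basis = {e, f}" "e \<noteq> f" and m: "1 / 2 + real m < s" "s < 1 / 2 + real m + 1" and m2: "m \<ge> 2"
  obtains v :: "'a \<Rightarrow> real" where "v \<in> positive_sobolev_sphere 1 s" "a_form 1 s v < 0"
proof -
  define S where "S = (LINT x|(surface_measure :: 'a measure). (1::real))"
  have "e \<in> Basis" unfolding B(1) by simp
  then have S: "S > 0" using surface_area_pos[of e] by (simp add: S_def)
  have m': "real 1 / 2 + real m < s" "s < real 1 / 2 + real m + 1" using m by simp_all
  have a0: "\<bar>alpha 1 s 0\<bar> > 0" and am: "alpha 1 s m < 0"
    using alpha_sign[OF m', of 0] alpha_sign[OF m', of m] by auto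
  \<comment> \<open>The form of \<open>v\<close> is negative as soon as \<open>K^2 < \<rho>\<close>;
    the absolute value of \<open>alpha 1 s 0\<close> covers both parities of
    \<open>m\<close>.\<close>
  define \<rho> where "\<rho> = \<bar>alpha 1 s m\<bar> / (2 * \<bar>alpha 1 s 0\<bar>)"
  have \<rho>: "\<rho> > 1" using alpha_dominates[OF m m2] a0 by (simp add: \<rho>_def less_divide_eq)
  \<comment> \<open>\<open>K^2\<close> is the midpoint of 1 and \<rho>: \<open>K > 1\<close> makes
    \<open>v\<close> positive, \<open>K^2 < \<rho>\<close> makes its form negative.\<close>
  define K where "K = sqrt ((1 + \<rho>) / 2)"
  have K: "K > 1" "K\<^sup>2 < \<rho>" using \<rho> by (auto simp: K_def real_less_rsqrt)
  define p where "p = (\<lambda>l (x::'a). if l = 0 then K else if l = m then planar_harmonic e f 1 m x else 0)"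
  define v where "v = (\<lambda>x. K + planar_harmonic e f 1 m x)"
  have p: "p l \<in> homogeneous_harmonic_polynomials l" for l
    using planar_harmonic_mem[OF B] m2
    by (cases "l = 0"; cases "l = m") (simp_all add: p_def homogeneous_harmonic_const homogeneous_harmonic_zero)
  have sum0m: "(\<Sum>l\<le>m. g l) = g 0 + g m" if "\<And>l. l \<noteq> 0 \<Longrightarrow> l \<noteq> m \<Longrightarrow> g l = 0" for g :: "nat \<Rightarrow> real"
  proof -
    have "(\<Sum>l\<le>m. g l) = (\<Sum>l\<in>{0, m}. g l)"
      by (rule sum.mono_neutral_right) (use that in auto)
    then show ?thesis using m2 by simp
  qed
  have v: "v x = (\<Sum>l\<le>m. p l x)" for x
    using m2 by (subst sum0m) (auto simp: p_def v_def)
  have "a_form 1 s v = (\<Sum>l\<le>m. alpha 1 s l * (LINT x|surface_measure. (p l x)\<^sup>2))"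
    by (rule harmonic_sum_sobolev(3)[OF v p])
  also have "\<dots> = alpha 1 s 0 * (K\<^sup>2 * S) + alpha 1 s m * (S / 2)"
  proof -
    have "(LINT x|(surface_measure :: 'a measure). K\<^sup>2) = K\<^sup>2 * S"
      unfolding S_def by (subst integral_mult_right_zero[symmetric]) simp
    moreover have "(LINT x|surface_measure. (planar_harmonic e f 1 m x)\<^sup>2) = S / 2"
      using planar_harmonic_energy[OF B, of m 1 1] m2 by (simp add: power2_eq_square S_def)
    ultimately show ?thesis
      using m2 by (subst sum0m) (auto simp: p_def)
  qed
  also have "\<dots> < 0"
  proof -
    have "alpha 1 s 0 * K\<^sup>2 \<le> \<bar>alpha 1 s 0\<bar> * K\<^sup>2" by (intro mult_right_mono) auto
    also have "\<dots> < \<bar>alpha 1 s 0\<bar> * \<rho>" using K a0 by (intro mult_strict_left_mono)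
    also have "\<dots> = - alpha 1 s m / 2" using a0 am by (simp add: \<rho>_def)
    finally have "(alpha 1 s 0 * K\<^sup>2 + alpha 1 s m / 2) * S < 0" using S by (intro mult_neg_pos) auto
    then show ?thesis by (simp add: algebra_simps)
  qed
  finally have "a_form 1 s v < 0" .
  moreover have "v \<in> positive_sobolev_sphere 1 s"
  proof -
    have "v x > 0" if "x \<in> sphere 0 1" for x
    proof -
      have "cmod (planar e f x) = 1" by (rule cmod_planar[OF B that])
      then have "\<bar>planar_harmonic e f 1 m x\<bar> \<le> 1"
        using abs_Re_le_cmod[of "planar e f x ^ m"] by (simp add: planar_harmonic_def norm_power)
      then show ?thesis using K(1) by (simp add: v_def)
    qed
    then show ?thesis
      unfolding positive_sobolev_sphere_def
      using harmonic_sum_sobolev(1,2)[where u = v and p = p, OF v p] by auto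
  qed
  ultimately show ?thesis using that by blast
qed

section \<open>Assembly of the two cases\<close>

theorem theorem2:
  fixes n :: nat and s :: real
  assumes dim: "DIM('a::euclidean_space) = n + 1"
    and n: "n \<ge> 1"
    and s: "s \<in> {(real n + 4) / 2 <..} - {real n / 2 + real k | k. k \<ge> (1::nat)}"
  shows "\<not> (\<exists>u \<in> (positive_sobolev_sphere n s :: ('a \<Rightarrow> real) set).
              ereal (sobolev_quotient n s u) = sobolev_infimum TYPE('a) n s) \<and>
         (n \<ge> 2 \<longrightarrow> sobolev_infimum TYPE('a) n s = -\<infinity>)"
proof -
  define m where "m = nat \<lfloor>s - real n / 2\<rfloor>"
  have s2: "s - real n / 2 > 2" using s by (simp add: field_simps)
  have m2: "m \<ge> 2" using s2 by (simp add: m_def le_nat_iff le_floor_iff)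
  have mle: "real m \<le> s - real n / 2" "s - real n / 2 < real m + 1"
    using s2 by (simp_all add: m_def)
  \<comment> \<open>As \<open>m \<ge> 2\<close>, the value \<open>n/2 + m\<close> is among the
    excluded ones, so the floor bound becomes strict.\<close>
  have "s \<noteq> real n / 2 + real m" using s m2 by auto
  then have m: "real n / 2 + real m < s" "s < real n / 2 + real m + 1" using mle by auto
  have sn: "s > real n / 2" using s2 by simp
  have bot: "sobolev_infimum TYPE('a) n s = -\<infinity>" if n2: "n \<ge> 2"
  proof -
    obtain b :: 'a where b: "b \<in> Basis" using nonempty_Basis by blast
    have d: "DIM('a) \<ge> 2" using dim n2 by simp
    note A = n2 b dim
    have tb: "\<bar>x \<bullet> b\<bar> \<le> 1" if "x \<in> sphere 0 1" for x
      using Basis_le_norm[OF b, of x] that by simp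
    \<comment> \<open>The integrability threshold:
      \<open>2 s - n < 2 (m + 1) \<le> 4 k \<le> 2 k n\<close>, where the last step uses
      \<open>n \<ge> 2\<close>. Both \<open>k = m\<close> for even \<open>m\<close> and
      \<open>k = m - 1\<close> for odd \<open>m \<ge> 3\<close> qualify.\<close>
    have kq: "real k * (2 * real n / (2 * s - real n)) > 1" if "2 * real k \<ge> real m + 1" for k
    proof -
      have "2 * s - real n < 2 * (real m + 1)" using m by simp
      also have "\<dots> \<le> 2 * (2 * real k)" using that by simp
      also have "\<dots> \<le> real k * (2 * real n)" using mult_left_mono[of 2 "real n" "2 * real k"] n2 by simp
      finally show ?thesis using sn by (simp add: less_divide_eq)
    qed
    show ?thesis
    proof (cases "even m")
      case True
      show ?thesis
      proof (rule sobolev_infimum_bot[OF d b n sn, where N = m and p = "\<lambda>l x. mcoeff n m l * zonal n b l x"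
            and v = "\<lambda>x. (x \<bullet> b) ^ m" and K = 1 and k = m])
        show "(x \<bullet> b) ^ m = (\<Sum>l\<le>m. mcoeff n m l * zonal n b l x)" if "x \<in> sphere 0 1" for x
          by (rule coordinate_power_expansion[OF that])
        show "(\<lambda>x. mcoeff n m l * zonal n b l x) \<in> homogeneous_harmonic_polynomials l" for l
          by (intro homogeneous_harmonic_cmult zonal_homogeneous_harmonic[OF A])
        show "(\<Sum>l\<le>m. alpha n s l * (LINT x|surface_measure. (mcoeff n m l * zonal n b l x)\<^sup>2)) < 0"
          using power_form_neg_even[OF A m True] by (simp add: power_mult_distrib zonal_energy_def)
        show "0 \<le> (x \<bullet> b) ^ m" for x using True by (simp add: zero_le_even_power)
        show "(x \<bullet> b) ^ m \<le> 1 * \<bar>x \<bullet> b\<bar> ^ m" for x by (simp add: power_abs[symmetric])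
      qed (use m2 kq[of m] in auto)
    next
      case False
      then obtain M where M: "m = Suc M" "even M" by (cases m) auto
      then have M2: "M \<ge> 2" using m2 by (cases "M = 1") auto
      let ?p = "\<lambda>l x. (mcoeff n M l + mcoeff n (Suc M) l) * zonal n b l x"
      show ?thesis
      \<comment> \<open>Since \<open>M\<close> is even, \<open>v\<close> is the nonnegative power
        \<open>M\<close> of the coordinate times a factor between 0 and 2, whence
        \<open>K = 2\<close> and vanishing order \<open>M\<close>.\<close>
      proof (rule sobolev_infimum_bot[OF d b n sn, where N = m and p = ?p
            and v = "\<lambda>x. (x \<bullet> b) ^ M + (x \<bullet> b) ^ Suc M" and K = 2 and k = M])
        show "(x \<bullet> b) ^ M + (x \<bullet> b) ^ Suc M = (\<Sum>l\<le>m. ?p l x)" if "x \<in> sphere 0 1" for x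
        proof -
          have "(x \<bullet> b) ^ M = (\<Sum>l\<le>m. mcoeff n M l * zonal n b l x)"
            using coordinate_power_expansion[OF that, of b M n] by (simp add: M mcoeff_eq_0)
          moreover have "(x \<bullet> b) ^ Suc M = (\<Sum>l\<le>m. mcoeff n (Suc M) l * zonal n b l x)"
            unfolding M(1) by (rule coordinate_power_expansion[OF that])
          ultimately show ?thesis by (simp only: distrib_right sum.distrib)
        qed
        show "?p l \<in> homogeneous_harmonic_polynomials l" for l
          by (intro homogeneous_harmonic_cmult zonal_homogeneous_harmonic[OF A])
        show "(\<Sum>l\<le>m. alpha n s l * (LINT x|surface_measure. (?p l x)\<^sup>2)) < 0"
          using power_form_neg_odd[OF A _ _ M(2) M2, of s] m
          by (simp only: M power_mult_distrib zonal_energy_def integral_mult_right_zero)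
        show "0 \<le> (x \<bullet> b) ^ M + (x \<bullet> b) ^ Suc M" if "x \<in> sphere 0 1" for x
        proof -
          have "0 \<le> (x \<bullet> b) ^ M * (1 + x \<bullet> b)"
            using M(2) tb[OF that] by (intro mult_nonneg_nonneg) (auto simp: zero_le_even_power)
          then show ?thesis by (simp add: algebra_simps)
        qed
        show "(x \<bullet> b) ^ M + (x \<bullet> b) ^ Suc M \<le> 2 * \<bar>x \<bullet> b\<bar> ^ M" if "x \<in> sphere 0 1" for x
        proof -
          have "(x \<bullet> b) ^ M * (1 + x \<bullet> b) \<le> (x \<bullet> b) ^ M * 2"
            using M(2) tb[OF that] by (intro mult_left_mono) (auto simp: zero_le_even_power)
          then show ?thesis using M(2) by (simp add: algebra_simps power_even_abs)
        qed
      qed (use M M2 kq[of M] in auto)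
    qed
  qed
  have "False" if u: "u \<in> positive_sobolev_sphere n s" and min: "ereal (sobolev_quotient n s u) = sobolev_infimum TYPE('a) n s"
    for u :: "'a \<Rightarrow> real"
  proof (cases "n \<ge> 2")
    case True
    \<comment> \<open>The quotient of a function is a real number and cannot equal minus
      infinity.\<close>
    then show False using min bot by simp
  next
    case False
    then have n1: "n = 1" using n by simp
    have "card (Basis :: 'a set) = 2" using dim n1 by simp
    then obtain e f :: 'a where B: "Basis = {e, f}" "e \<noteq> f" by (auto simp: card_2_iff)
    have m1: "1 / 2 + real m < s" "s < 1 / 2 + real m + 1" using m by (simp_all add: n1)
    have le: "sobolev_quotient n s u \<le> sobolev_quotient n s v" if "v \<in> positive_sobolev_sphere n s" for v :: "'a \<Rightarrow> real"
    proof -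
      have "sobolev_infimum TYPE('a) n s \<le> ereal (sobolev_quotient n s v)"
        unfolding sobolev_infimum_def by (rule INF_lower[OF that])
      then show ?thesis unfolding min[symmetric] by simp
    qed
    obtain v :: "'a \<Rightarrow> real" where v: "v \<in> positive_sobolev_sphere n s" "a_form n s v < 0"
      using planar_negative_exists[OF B m1 m2] unfolding n1 by blast
    have e: "e \<in> Basis" unfolding B(1) by simp
    have "sobolev_quotient n s v < 0"
      using sobolev_quotient_neg_iff[OF e v(1)] v(2) by simp
    \<comment> \<open>The quotient of the minimiser is at most that of \<open>v\<close>, hence
      negative, and it has the sign of the form.\<close>
    then have au: "a_form n s u < 0"
      using le[OF v(1)] sobolev_quotient_neg_iff[OF e u] by linarith
    have uS: "u \<in> sobolev_sphere n s" and uL: "u \<in> L2_sphere"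
      using u by (auto simp: positive_sobolev_sphere_def sobolev_sphere_def)
    obtain p :: "'a \<Rightarrow> real" where p: "p \<in> homogeneous_harmonic_polynomials m"
      "\<And>q. q \<in> homogeneous_harmonic_polynomials m \<Longrightarrow> (LINT x|surface_measure. (u x - p x) * q x) = 0"
      using planar_projection_exists[OF B _ uL, of m] m2 by auto
    obtain q :: "'a \<Rightarrow> real" where q: "q \<in> homogeneous_harmonic_polynomials m" "(LINT x|surface_measure. u x * q x) = 0"
      "(LINT x|surface_measure. (q x)\<^sup>2) > 0"
      using planar_orthogonal_exists[OF B _ uL, of m] m2 by auto
    have am: "alpha n s m < 0" using alpha_sign[OF m, of m] by simp
    obtain w :: "'a \<Rightarrow> real" where "w \<in> positive_sobolev_sphere n s" "sobolev_quotient n s w < sobolev_quotient n s u"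
      by (rule negative_not_minimizer[OF e n sn u sobolev_summable_alpha[OF no_nat_between[OF m] sn n uS] au am p q])
    then show False using le by force
  qed
  then show ?thesis using bot by blast
qed

end
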